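(* Let $S$ be the spline space of degree $p$ associated with a $(p+1)$-open knot vector $\Xi$ on $[a,b]$ in which each interior breakpoint has multiplicity at most $p$. Let $s\in S$ and $\mathrm{TOL}>0$. Then the $H^1$-adaptive knot removal algorithm described in the context, applied to $\mathrm{TOL}$, the control points $\mathbf{c}$ of $s$ and $\Xi$, finishes and returns a spline $\hat s\in\hat S$ (where $\hat S$ is the spline space of degree $p$ associated with the returned knot vector $\hat\Xi$ and $\hat s$ is the spline in $\hat S$ with the returned control points $\hat{\mathbf{c}}$) such that $$\|s-\hat s\|_{H^1}<\mathrm{TOL}.$$
   Context: Here $\|f\|_{H^1}^2=\|f\|_{L^2(a,b)}^2+\|f'\|_{L^2(a,b)}^2$, and $p\in\mathbb{N}$ is a positive integer. Splines of degree $q\ge 0$. Given breakpoints $a=\zeta_1<\dots<\zeta_N=b$ and multiplicities $1\le m_j\le q+1$, $j=2,\dots,N-1$, the spline space consists of the piecewise polynomial functions of degree $\le q$ having $q-m_j$ continuous derivatives at $\zeta_j$ (no continuity if $m_j=q+1$); its dimension is $n=q+1+\sum_{j=2}^{N-1}m_j$. A $(q+1)$-basic knot vector is $\Xi=\{\xi_1,\dots,\xi_{n+q+1}\}$ with $\xi_1\le\dots\le\xi_{q+1}=\zeta_1$, followed by each interior $\zeta_j$ repeated $m_j$ times in increasing order, followed by $\zeta_N=\xi_{n+1}\le\dots\le\xi_{n+q+1}$; it is $(q+1)$-open if $\xi_1=\dots=\xi_{q+1}$ and $\xi_{n+1}=\dots=\xi_{n+q+1}$. The control points of a spline are its coefficients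 in the associated B-spline basis $B_1,\dots,B_n$ of degree $q$ (normalized to sum to one on $[a,b]$). For $s=\sum_i c_iB_i$, $\|s\|_\Xi:=\big(\sum_{i=1}^n c_i^2\frac{\xi_{i+q+1}-\xi_i}{q+1}\big)^{1/2}$. Single knot removal (degree $q$). For $2\le j\le N-1$ let $i_0:=q+1+\sum_{r=2}^{j}m_r$, $\ell:=m_j-1$, let $\hat S_j$ be the spline space of degree $q$ associated with $\Xi\setminus\{\xi_{i_0}\}$, and $\mathbb{E}_{\Xi,j}(s):=\min_{g\in\hat S_j}\|g-s\|_\Xi$. For $r=1,\dots,q+2-\ell$ let $\alpha_r:=\frac{\xi_{i_0}-\xi_{i_0-q-2+r}}{\xi_{i_0-1+r}-\xi_{i_0-q-2+r}}$ and $e_r:=\big(\frac{\xi_{i_0-1+r}-\xi_{i_0-q-2+r}}{q+1}\big)^{1/2}$. $A_{\rm loc}\in\mathbb{R}^{(q+2-\ell)\times(q+1-\ell)}$ has entries $(A_{\rm loc})_{r,r}=\alpha_r$, $(A_{\rm loc})_{r+1,r}=1-\alpha_{r+1}$ for $r=1,\dots,q+1-\ell$, zeros elsewhere; $E_{\rm loc}$ is the diagonal matrix with diagonal $(e_1,\dots,e_{q+2-\ell})$. $L^2$-adaptive knot removal (degree $q$). Input: $\tau>0$, control points $\mathbf{c}$, knot vector $\Xi$. Let $k_{\max}:=\#\Xi-2(q+1)$. Set $k=0$, $\mathbf{c}^{(0)}=\mathbf{c}$, $\Xi^{(0)}=\Xi$. For each $k$, $N^{(k)}$ is the number of breakpoints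 of $\Xi^{(k)}$, $s_k$ is the spline with control points $\mathbf{c}^{(k)}$ in the spline space of $\Xi^{(k)}$, $\varepsilon_j^{(k)}:=\mathbb{E}_{\Xi^{(k)},j}(s_k)$ for $2\le j\le N^{(k)}-1$, and $j_*$ is an index minimizing $\varepsilon^{(k)}_j$. While $k<k_{\max}$ and $\varepsilon_{j_*}^{(k)}<\tau$ (current $\tau$): replace $\tau$ by $\tau-\varepsilon_{j_*}^{(k)}$; let $i_*,\ell_*$ be the values of $i_0,\ell$ for breakpoint $j_*$ of $\Xi^{(k)}$ and $\mathbf{c}_{\rm loc}^{(k)}:=(c^{(k)}_{i_*-q-1},\dots,c^{(k)}_{i_*-\ell_*})^T$; let $\mathbf{c}_{\rm loc}^{(k+1)}\in\mathbb{R}^{q+1-\ell_*}$ be the least squares solution of $E_{\rm loc}A_{\rm loc}\mathbf{c}_{\rm loc}^{(k+1)}=E_{\rm loc}\mathbf{c}_{\rm loc}^{(k)}$ (matrices built from $\Xi^{(k)}$, $i_0=i_*$, $\ell=\ell_*$); form $\mathbf{c}^{(k+1)}$ by replacing in $\mathbf{c}^{(k)}$ the block $\mathbf{c}_{\rm loc}^{(k)}$ by $\mathbf{c}_{\rm loc}^{(k+1)}$; set $\Xi^{(k+1)}:=\Xi^{(k)}\setminus\{\xi^{(k)}_{i_*}\}$; increase $k$ by one. Output: $\mathbf{c}^{(k)}$, $\Xi^{(k)}$ for the final $k$. $H^1$-adaptive knot removal. Input: $\mathrm{TOL}>0$, control points $\mathbf{c}=(c_1,\dots,c_n)^T$ of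 $s\in S$, and the $(p+1)$-open knot vector $\Xi=\{\xi_i\}_{i=1}^{n+p+1}$. 1. Let $\Xi':=\{\xi_i\}_{i=2}^{n+p}$ (a $p$-open knot vector) and $\mathbf{c}'=(c'_2,\dots,c'_n)^T$ with $c'_i:=\frac{c_i-c_{i-1}}{\xi_i^*-\xi_{i-1}^*}$, where $\xi_i^*:=\frac{\xi_{i+1}+\dots+\xi_{i+p}}{p}$ is the $i$-th Greville abscissa. These are the control points of the right-derivative $s'$ in the B-spline basis of degree $p-1$ associated with $\Xi'$. 2. Let $\mathrm{TOL}':=\mathrm{TOL}/\sqrt{(b-a)^2+1}$. 3. Apply the $L^2$-adaptive knot removal with degree $q=p-1$ to $\mathrm{TOL}',\mathbf{c}',\Xi'$, obtaining $\hat{\mathbf{c}}'=(\hat c'_2,\dots,\hat c'_{\hat n})^T$ and $\hat\Xi'$. 4. Let $\hat\Xi$ be the $(p+1)$-open knot vector obtained from $\hat\Xi'$ by adding one more occurrence of the first and of the last knot. 5. Let $\hat c_1:=c_1$ and $\hat c_i:=\hat c'_i(\hat\xi_i^*-\hat\xi_{i-1}^* )+\hat c_{i-1}$ for $i=2,\dots,\hat n$, where $\hat\xi_i^*$ are the Greville abscissas (for degree $p$) associated with $\hat\Xi$. Output: $\hat{\mathbf{c}}=(\hat c_1,\dots,\hat c_{\hat n})^T$ and $\hat\Xi$. *)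

theory Defs
  imports "HOL-Analysis.Analysis" "HOL-Computational_Algebra.Polynomial"
begin

text \<open>Knot vectors and vectors of control points are lists, addressed with indices starting at 1.\<close>

abbreviation ith :: "real list \<Rightarrow> nat \<Rightarrow> real" where
  "ith xs i \<equiv> xs ! (i - 1)"


section \<open>Knot vectors\<close>

text \<open>
  A predicate indexed by the degree \<open>q\<close> describes the \<open>(q+1)\<close>-basic and \<open>(q+1)\<close>-open knot vectors.
  The breakpoints are \<open>a\<close>, the members of \<open>zs\<close>, and \<open>b\<close>; \<open>ms\<close> lists the multiplicities of the
  interior ones.
\<close>

definition basic_knot_vector :: "nat \<Rightarrow> real \<Rightarrow> real \<Rightarrow> real list \<Rightarrow> bool" where
  "basic_knot_vector q a b \<Xi> \<longleftrightarrow>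
     (\<exists>ls zs ms rs.
        \<Xi> = ls @ concat (map2 replicate ms zs) @ rs \<and>
        length ls = q + 1 \<and> sorted ls \<and> last ls = a \<and>
        length rs = q + 1 \<and> sorted rs \<and> hd rs = b \<and>
        sorted_wrt (<) (a # zs @ [b]) \<and>
        length ms = length zs \<and> (\<forall>m\<in>set ms. 1 \<le> m \<and> m \<le> q + 1))"

text \<open>The dimension \<open>n\<close> of the spline space, from \<open>length \<Xi> = n + q + 1\<close>.\<close>

definition spline_dim :: "nat \<Rightarrow> real list \<Rightarrow> nat" where
  "spline_dim q \<Xi> = length \<Xi> - (q + 1)"

definition open_knot_vector :: "nat \<Rightarrow> real \<Rightarrow> real \<Rightarrow> real list \<Rightarrow> bool" where
  "open_knot_vector q a b \<Xi> \<longleftrightarrow>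
     basic_knot_vector q a b \<Xi> \<and>
     set (take (q + 1) \<Xi>) = {a} \<and> set (drop (spline_dim q \<Xi>) \<Xi>) = {b}"

definition left_end :: "nat \<Rightarrow> real list \<Rightarrow> real" where
  "left_end q \<Xi> = ith \<Xi> (q + 1)"

definition right_end :: "nat \<Rightarrow> real list \<Rightarrow> real" where
  "right_end q \<Xi> = ith \<Xi> (spline_dim q \<Xi> + 1)"

text \<open>The distinct values among the knots number \<open>q+1, \<dots>, n+1\<close>, in increasing order.\<close>

definition breakpoints :: "nat \<Rightarrow> real list \<Rightarrow> real list" where
  "breakpoints q \<Xi> = remdups (take (length \<Xi> - 2 * q) (drop q \<Xi>))"

definition num_breakpoints :: "nat \<Rightarrow> real list \<Rightarrow> nat" where
  "num_breakpoints q \<Xi> = length (breakpoints q \<Xi>)"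

text \<open>The multiplicity \<open>m\<^sub>j\<close>; only meant for interior breakpoints \<open>2 \<le> j < N\<close>.\<close>

definition knot_mult :: "nat \<Rightarrow> real list \<Rightarrow> nat \<Rightarrow> nat" where
  "knot_mult q \<Xi> j = count_list \<Xi> (ith (breakpoints q \<Xi>) j)"

definition remove_knot :: "nat \<Rightarrow> real list \<Rightarrow> real list" where
  "remove_knot i \<Xi> = take (i - 1) \<Xi> @ drop i \<Xi>"


section \<open>Spline spaces, B-splines and control points\<close>

definition continuously_differentiable_at :: "nat \<Rightarrow> (real \<Rightarrow> real) \<Rightarrow> real \<Rightarrow> bool" where
  "continuously_differentiable_at k f x \<longleftrightarrow>
     (\<exists>e>0. \<exists>D :: nat \<Rightarrow> real \<Rightarrow> real.
        (\<forall>y\<in>ball x e. D 0 y = f y) \<and>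
        (\<forall>r<k. \<forall>y\<in>ball x e. (D r has_real_derivative D (Suc r) y) (at y)) \<and>
        isCont (D k) x)"

text \<open>
  Splines are functions on \<open>[a,b]\<close>: their values elsewhere are irrelevant.  At discontinuities
  they are taken to be continuous from the right, and at \<open>b\<close> continuous from the left.
\<close>

definition spline_space :: "nat \<Rightarrow> real list \<Rightarrow> (real \<Rightarrow> real) set" where
  "spline_space q \<Xi> =
     {f. (\<forall>j\<in>{1..<num_breakpoints q \<Xi>}. \<exists>P :: real poly. degree P \<le> q \<and>
            (\<forall>x. ith (breakpoints q \<Xi>) j \<le> x \<and>
                 (x < ith (breakpoints q \<Xi>) (j + 1) \<or>
                  x = right_end q \<Xi> \<and> j + 1 = num_breakpoints q \<Xi>) \<longrightarrow>
                 f x = poly P x)) \<and>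
         (\<forall>j\<in>{2..<num_breakpoints q \<Xi>}. knot_mult q \<Xi> j \<le> q \<longrightarrow>
            continuously_differentiable_at (q - knot_mult q \<Xi> j) f (ith (breakpoints q \<Xi>) j))}"

text \<open>
  The Cox--de Boor recursion, with the same one-sided continuity.  The convention that a term with
  vanishing denominator is \<open>0\<close> is that of Isabelle's division.
\<close>

fun bspline :: "real list \<Rightarrow> real \<Rightarrow> nat \<Rightarrow> nat \<Rightarrow> real \<Rightarrow> real" where
  "bspline \<Xi> b 0 i x =
     (if x = b then (if ith \<Xi> i < x \<and> x \<le> ith \<Xi> (i + 1) then 1 else 0)
      else (if ith \<Xi> i \<le> x \<and> x < ith \<Xi> (i + 1) then 1 else 0))"
| "bspline \<Xi> b (Suc q) i x =
     (x - ith \<Xi> i) / (ith \<Xi> (i + q + 1) - ith \<Xi> i) * bspline \<Xi> b q i x +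
     (ith \<Xi> (i + q + 2) - x) / (ith \<Xi> (i + q + 2) - ith \<Xi> (i + 1)) * bspline \<Xi> b q (i + 1) x"

definition spline_of :: "nat \<Rightarrow> real list \<Rightarrow> real list \<Rightarrow> real \<Rightarrow> real" where
  "spline_of q \<Xi> c x = (\<Sum>i=1..spline_dim q \<Xi>. ith c i * bspline \<Xi> (right_end q \<Xi>) q i x)"

definition control_points :: "nat \<Rightarrow> real list \<Rightarrow> (real \<Rightarrow> real) \<Rightarrow> real list" where
  "control_points q \<Xi> s =
     (THE c. length c = spline_dim q \<Xi> \<and>
             (\<forall>x\<in>{left_end q \<Xi>..right_end q \<Xi>}. s x = spline_of q \<Xi> c x))"

definition knot_norm :: "nat \<Rightarrow> real list \<Rightarrow> (real \<Rightarrow> real) \<Rightarrow> real" where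
  "knot_norm q \<Xi> s =
     sqrt (\<Sum>i=1..spline_dim q \<Xi>.
             (ith (control_points q \<Xi> s) i)\<^sup>2 * ((ith \<Xi> (i + q + 1) - ith \<Xi> i) / real (q + 1)))"


section \<open>Removal of a single knot\<close>

definition removal_index :: "nat \<Rightarrow> real list \<Rightarrow> nat \<Rightarrow> nat" where
  "removal_index q \<Xi> j = q + 1 + (\<Sum>r=2..j. knot_mult q \<Xi> r)"

definition removal_error :: "nat \<Rightarrow> real list \<Rightarrow> nat \<Rightarrow> (real \<Rightarrow> real) \<Rightarrow> real" where
  "removal_error q \<Xi> j s =
     (LEAST v. \<exists>g\<in>spline_space q (remove_knot (removal_index q \<Xi> j) \<Xi>).
                 v = knot_norm q \<Xi> (\<lambda>x. g x - s x))"

definition loc_alpha :: "nat \<Rightarrow> real list \<Rightarrow> nat \<Rightarrow> nat \<Rightarrow> real" where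
  "loc_alpha q \<Xi> i0 r =
     (ith \<Xi> i0 - ith \<Xi> (i0 + r - q - 2)) / (ith \<Xi> (i0 + r - 1) - ith \<Xi> (i0 + r - q - 2))"

definition loc_weight :: "nat \<Rightarrow> real list \<Rightarrow> nat \<Rightarrow> nat \<Rightarrow> real" where
  "loc_weight q \<Xi> i0 r = sqrt ((ith \<Xi> (i0 + r - 1) - ith \<Xi> (i0 + r - q - 2)) / real (q + 1))"

text \<open>Entries of \<open>A\<^sub>l\<^sub>o\<^sub>c\<close> and of \<open>E\<^sub>l\<^sub>o\<^sub>c A\<^sub>l\<^sub>o\<^sub>c\<close>, with rows and columns numbered from 1.\<close>

definition A_loc :: "nat \<Rightarrow> real list \<Rightarrow> nat \<Rightarrow> nat \<Rightarrow> nat \<Rightarrow> real" where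
  "A_loc q \<Xi> i0 r t =
     (if r = t then loc_alpha q \<Xi> i0 r
      else if r = t + 1 then 1 - loc_alpha q \<Xi> i0 r
      else 0)"

definition EA_loc :: "nat \<Rightarrow> real list \<Rightarrow> nat \<Rightarrow> nat \<Rightarrow> nat \<Rightarrow> real" where
  "EA_loc q \<Xi> i0 r t = loc_weight q \<Xi> i0 r * A_loc q \<Xi> i0 r t"

text \<open>
  For an \<open>m \<times> n\<close> matrix \<open>M\<close> and a right-hand side \<open>y \<in> \<real>\<^sup>m\<close>: \<open>x \<in> \<real>\<^sup>n\<close> minimizes the Euclidean
  norm of \<open>M x - y\<close>.
\<close>

definition lsq_residual ::
  "nat \<Rightarrow> nat \<Rightarrow> (nat \<Rightarrow> nat \<Rightarrow> real) \<Rightarrow> (nat \<Rightarrow> real) \<Rightarrow> real list \<Rightarrow> real" where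
  "lsq_residual m n M y x = sqrt (\<Sum>r=1..m. ((\<Sum>t=1..n. M r t * ith x t) - y r)\<^sup>2)"

definition least_squares_solution ::
  "nat \<Rightarrow> nat \<Rightarrow> (nat \<Rightarrow> nat \<Rightarrow> real) \<Rightarrow> (nat \<Rightarrow> real) \<Rightarrow> real list \<Rightarrow> bool" where
  "least_squares_solution m n M y x \<longleftrightarrow>
     length x = n \<and> (\<forall>z. length z = n \<longrightarrow> lsq_residual m n M y x \<le> lsq_residual m n M y z)"


section \<open>The \<open>L\<^sup>2\<close>-adaptive knot removal\<close>

text \<open>
  A state consists of the counter \<open>k\<close>, the current tolerance, control points and knot vector.
  The algorithm is a relation because the minimizing index need not be unique; a theorem about it
  has to cover every choice.
\<close>

type_synonym state = "nat \<times> real \<times> real list \<times> real list"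

definition best_removal :: "nat \<Rightarrow> real list \<Rightarrow> real list \<Rightarrow> nat \<Rightarrow> bool" where
  "best_removal q c \<Xi> j \<longleftrightarrow>
     is_arg_min (\<lambda>i. removal_error q \<Xi> i (spline_of q \<Xi> c))
       (\<lambda>i. 2 \<le> i \<and> i < num_breakpoints q \<Xi>) j"

inductive l2_step :: "nat \<Rightarrow> nat \<Rightarrow> state \<Rightarrow> state \<Rightarrow> bool" for q k_max :: nat where
  "\<lbrakk> k < k_max;
     best_removal q c \<Xi> j;
     \<epsilon> = removal_error q \<Xi> j (spline_of q \<Xi> c);
     \<epsilon> < \<tau>;
     i0 = removal_index q \<Xi> j;
     l = knot_mult q \<Xi> j - 1;
     least_squares_solution (q + 2 - l) (q + 1 - l) (EA_loc q \<Xi> i0)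
       (\<lambda>r. loc_weight q \<Xi> i0 r * ith c (i0 + r - q - 2)) d \<rbrakk>
   \<Longrightarrow> l2_step q k_max (k, \<tau>, c, \<Xi>)
         (Suc k, \<tau> - \<epsilon>, take (i0 - q - 2) c @ d @ drop (i0 - l) c, remove_knot i0 \<Xi>)"

definition l2_exit :: "nat \<Rightarrow> nat \<Rightarrow> state \<Rightarrow> bool" where
  "l2_exit q k_max st = (case st of (k, \<tau>, c, \<Xi>) \<Rightarrow>
     k_max \<le> k \<or> (\<exists>j. best_removal q c \<Xi> j \<and> \<tau> \<le> removal_error q \<Xi> j (spline_of q \<Xi> c)))"

definition l2_kmax :: "nat \<Rightarrow> real list \<Rightarrow> nat" where
  "l2_kmax q \<Xi> = length \<Xi> - 2 * (q + 1)"

text \<open>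
  Whatever choices are made, the loop is not executed infinitely often, and it never stops
  for any other reason than its exit condition.
\<close>

definition l2_removal_finishes :: "nat \<Rightarrow> real \<Rightarrow> real list \<Rightarrow> real list \<Rightarrow> bool" where
  "l2_removal_finishes q \<tau> c \<Xi> \<longleftrightarrow>
     (\<nexists>run. run 0 = (0, \<tau>, c, \<Xi>) \<and> (\<forall>i. l2_step q (l2_kmax q \<Xi>) (run i) (run (Suc i)))) \<and>
     (\<forall>st. (l2_step q (l2_kmax q \<Xi>))\<^sup>*\<^sup>* (0, \<tau>, c, \<Xi>) st \<and> (\<nexists>st'. l2_step q (l2_kmax q \<Xi>) st st')
            \<longrightarrow> l2_exit q (l2_kmax q \<Xi>) st)"

definition l2_removal_returns ::
  "nat \<Rightarrow> real \<Rightarrow> real list \<Rightarrow> real list \<Rightarrow> real list \<Rightarrow> real list \<Rightarrow> bool" where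
  "l2_removal_returns q \<tau> c \<Xi> c_hat \<Xi>_hat \<longleftrightarrow>
     (\<exists>k \<tau>'. (l2_step q (l2_kmax q \<Xi>))\<^sup>*\<^sup>* (0, \<tau>, c, \<Xi>) (k, \<tau>', c_hat, \<Xi>_hat) \<and>
             l2_exit q (l2_kmax q \<Xi>) (k, \<tau>', c_hat, \<Xi>_hat))"


section \<open>The \<open>H\<^sup>1\<close>-adaptive knot removal\<close>

definition greville :: "nat \<Rightarrow> real list \<Rightarrow> nat \<Rightarrow> real" where
  "greville p \<Xi> i = (\<Sum>r=1..p. ith \<Xi> (i + r)) / real p"

definition drop_end_knots :: "real list \<Rightarrow> real list" where
  "drop_end_knots \<Xi> = butlast (tl \<Xi>)"

definition add_end_knots :: "real list \<Rightarrow> real list" where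
  "add_end_knots \<Xi> = hd \<Xi> # \<Xi> @ [last \<Xi>]"

text \<open>The list \<open>c'\<^sub>2, \<dots>, c'\<^sub>n\<close>, so that \<open>c'\<^sub>i\<close> is its member number \<open>i - 1\<close>.\<close>

definition derivative_points :: "nat \<Rightarrow> real list \<Rightarrow> real list \<Rightarrow> real list" where
  "derivative_points p \<Xi> c =
     map (\<lambda>i. (ith c i - ith c (i - 1)) / (greville p \<Xi> i - greville p \<Xi> (i - 1)))
       [2..<spline_dim p \<Xi> + 1]"

text \<open>With \<open>d\<close> the list of the \<open>c'\<^sub>i\<close> as above, \<open>antiderivative_point p \<Xi> c1 d i\<close> is the control
  point number \<open>i + 1\<close>.\<close>

primrec antiderivative_point :: "nat \<Rightarrow> real list \<Rightarrow> real \<Rightarrow> real list \<Rightarrow> nat \<Rightarrow> real" where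
  "antiderivative_point p \<Xi> c1 d 0 = c1"
| "antiderivative_point p \<Xi> c1 d (Suc i) =
     ith d (i + 1) * (greville p \<Xi> (i + 2) - greville p \<Xi> (i + 1)) + antiderivative_point p \<Xi> c1 d i"

definition antiderivative_points ::
  "nat \<Rightarrow> real list \<Rightarrow> real \<Rightarrow> real list \<Rightarrow> real list" where
  "antiderivative_points p \<Xi> c1 d = map (antiderivative_point p \<Xi> c1 d) [0..<length d + 1]"

definition reduced_tol :: "nat \<Rightarrow> real \<Rightarrow> real list \<Rightarrow> real" where
  "reduced_tol p TOL \<Xi> = TOL / sqrt ((right_end p \<Xi> - left_end p \<Xi>)\<^sup>2 + 1)"

definition h1_removal_finishes :: "nat \<Rightarrow> real \<Rightarrow> real list \<Rightarrow> real list \<Rightarrow> bool" where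
  "h1_removal_finishes p TOL c \<Xi> \<longleftrightarrow>
     l2_removal_finishes (p - 1) (reduced_tol p TOL \<Xi>) (derivative_points p \<Xi> c) (drop_end_knots \<Xi>)"

definition h1_removal_returns ::
  "nat \<Rightarrow> real \<Rightarrow> real list \<Rightarrow> real list \<Rightarrow> real list \<Rightarrow> real list \<Rightarrow> bool" where
  "h1_removal_returns p TOL c \<Xi> c_hat \<Xi>_hat \<longleftrightarrow>
     (\<exists>d \<Xi>'. l2_removal_returns (p - 1) (reduced_tol p TOL \<Xi>)
                (derivative_points p \<Xi> c) (drop_end_knots \<Xi>) d \<Xi>' \<and>
              \<Xi>_hat = add_end_knots \<Xi>' \<and>
              c_hat = antiderivative_points p \<Xi>_hat (ith c 1) d)"


section \<open>The norm of \<open>H\<^sup>1(a,b)\<close>\<close>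

definition l2_norm_on :: "real \<Rightarrow> real \<Rightarrow> (real \<Rightarrow> real) \<Rightarrow> real" where
  "l2_norm_on a b f = sqrt (LINT x:{a..b}|lebesgue. (f x)\<^sup>2)"

text \<open>
  On an interval, \<open>H\<^sup>1\<close> consists of the absolutely continuous functions whose derivative, which
  exists almost everywhere, is square-integrable; the weak derivative is then \<open>deriv f\<close>, and the
  arbitrary values of \<open>deriv f\<close> where \<open>f\<close> is not differentiable do not matter.
\<close>

definition h1_space :: "real \<Rightarrow> real \<Rightarrow> (real \<Rightarrow> real) set" where
  "h1_space a b =
     {f. deriv f absolutely_integrable_on {a..b} \<and>
         (\<lambda>x. (deriv f x)\<^sup>2) absolutely_integrable_on {a..b} \<and>
         (\<forall>x\<in>{a..b}. f x = f a + (LINT t:{a..x}|lebesgue. deriv f t))}"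

definition h1_norm_on :: "real \<Rightarrow> real \<Rightarrow> (real \<Rightarrow> real) \<Rightarrow> real" where
  "h1_norm_on a b f = sqrt ((l2_norm_on a b f)\<^sup>2 + (l2_norm_on a b (deriv f))\<^sup>2)"

end

theory Submission
  imports Defs
begin

text \<open>
  The spline theory rests on blossoms: on each nonempty knot interval the control points
  \<open>c\<^sub>i\<close> of a spline are the values at \<open>(\<xi>\<^sub>i\<^sub>+\<^sub>1, \<dots>, \<xi>\<^sub>i\<^sub>+\<^sub>q)\<close> of the symmetric multiaffine form of the
  polynomial piece.  This yields existence and uniqueness of control points, smoothness at the
  knots, knot insertion and the differentiation formula without any dimension count.  Knot insertion
  shows that the least squares problem of a removal step is the minimization over the coarse spline
  space, all components outside the local block being fitted exactly.  So each step changes the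
  spline by exactly \<open>\<epsilon>\<close> in the knot norm, hence by at most \<open>\<epsilon>\<close> in \<open>L\<^sup>2\<close>, because the
  B-splines are a partition of unity and \<open>B\<^sub>i\<close> has integral \<open>(\<xi>\<^sub>i\<^sub>+\<^sub>q\<^sub>+\<^sub>1 - \<xi>\<^sub>i) / (q + 1)\<close>.  As the
  tolerance is decreased by \<open>\<epsilon>\<close> and stays positive, the derivatives differ by less than the reduced
  tolerance.  The splines agree at \<open>a\<close>, and the inequality
  \<open>\<parallel>f\<parallel> \<le> (b - a) \<parallel>f'\<parallel>\<close> for \<open>f a = 0\<close> gives the bound in \<open>H\<^sup>1\<close>.
\<close>

section \<open>Blossoms of polynomials\<close>

text \<open>\<open>control_points\<close> is a definite description and \<open>removal_error\<close>
  a least element of a set of reals, so neither means anything before coefficients are known to be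
  unique and the minimum to be attained. The spline space, on the other hand, is defined by
  smoothness. The bridge is that two polynomial pieces join at x with k continuous derivatives
  exactly when (y - x)^(k+1) divides their difference. At a knot of multiplicity m and in degree q
  this is order q + 1 - m, just what makes the blossoms of both pieces agree on every window that
  contains all m copies of the knot. The derivative of s may jump (for p = 1 it is piecewise
  constant), hence integrals are taken for bounded measurable functions. For the difference e of s
  and the output, the chain of bounds ends in |e|^2 + |e'|^2 \<le> ((b - a)^2 + 1) |e'|^2, which is
  where the factor in the reduced tolerance comes from.\<close>

definition polar :: "nat \<Rightarrow> real \<Rightarrow> real poly \<Rightarrow> real poly" where
  "polar q u P = P + smult (1 / real q) ([:u, -1:] * pderiv P)"

text \<open>The polynomial is read with formal degree the length of the list, which must not be smaller
  than its degree for \<open>blossom\<close> to be its polar form.\<close>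

fun blossom :: "real poly \<Rightarrow> real list \<Rightarrow> real" where
  "blossom P [] = coeff P 0"
| "blossom P (u # us) = blossom (polar (Suc (length us)) u P) us"

lemma polar_0 [simp]: "polar q u 0 = 0"
  by (simp add: polar_def)

lemma polar_add: "polar q u (P + Q) = polar q u P + polar q u Q"
  by (simp add: polar_def pderiv_add distrib_left smult_add_right del: mult_pCons_left)

lemma polar_smult: "polar q u (smult c P) = smult c (polar q u P)"
  by (simp add: polar_def pderiv_smult algebra_simps smult_add_right)

lemma blossom_add: "blossom (P + Q) us = blossom P us + blossom Q us"
  by (induction us arbitrary: P Q) (auto simp: polar_add)

lemma blossom_smult: "blossom (smult c P) us = c * blossom P us"
  by (induction us arbitrary: P) (auto simp: polar_smult)

lemma blossom_0 [simp]: "blossom 0 us = 0"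
  by (induction us) auto

lemma blossom_diff: "blossom (P - Q) us = blossom P us - blossom Q us"
  using blossom_add[of P "smult (-1) Q" us] blossom_smult[of "-1" Q us] by simp

text \<open>\<open>polar (Suc q) u P\<close> is the polar form of P with one argument u and the
  others equal to x. One degree is lost because the leading coefficient of x P' is q + 1 times that
  of P for degree q + 1, and the division by q + 1 makes the two cancel.\<close>

lemma degree_polar:
  assumes "degree P \<le> Suc q"
  shows "degree (polar (Suc q) u P) \<le> q"
proof (rule degree_le, intro allI impI)
  fix i assume "q < i"
  show "coeff (polar (Suc q) u P) i = 0"
  proof (cases "i = Suc q")
    case True
    have "coeff P (Suc (Suc q)) = 0" using assms by (intro coeff_eq_0) simp
    then show ?thesis using True
      by (simp add: polar_def coeff_pderiv)
  next
    case False
    with \<open>q < i\<close> have "coeff P i = 0" "coeff P (Suc i) = 0"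
      using assms by (auto intro!: coeff_eq_0)
    then show ?thesis using \<open>q < i\<close>
      by (cases i) (simp_all add: polar_def coeff_pderiv)
  qed
qed

lemma poly_polar_same [simp]: "poly (polar q x P) x = poly P x"
  by (simp add: polar_def)

text \<open>This is the symmetry of the blossom in two adjacent arguments. Both sides are expanded
  in the values of P, P' and P'' at x; \<open>*\<close> is the rational identity that remains when
  these values are free variables.\<close>

lemma polar_commute:
  "polar (Suc q) u (polar (Suc (Suc q)) v P) = polar (Suc q) v (polar (Suc (Suc q)) u P)"
proof -
  have *: "y + (v - x) * d / (n + 1) + (u - x) * (d + ((v - x) * e - d) / (n + 1)) / n
      = y + (u - x) * d / (n + 1) + (v - x) * (d + ((u - x) * e - d) / (n + 1)) / n"
    if "n > 0" for y x d e n :: real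
    using that by (simp add: divide_simps) algebra
  have **: "poly (polar (Suc q) u (polar (Suc (Suc q)) v P)) x
      = poly P x + (v - x) * poly (pderiv P) x / (real (Suc q) + 1)
        + (u - x) * (poly (pderiv P) x + ((v - x) * poly (pderiv (pderiv P)) x - poly (pderiv P) x)
            / (real (Suc q) + 1)) / real (Suc q)" for x u v
    by (simp add: polar_def pderiv_add pderiv_minus pderiv_mult pderiv_smult pderiv_pCons
        algebra_simps add_divide_distrib diff_divide_distrib)
  have "poly (polar (Suc q) u (polar (Suc (Suc q)) v P)) x
      = poly (polar (Suc q) v (polar (Suc (Suc q)) u P)) x" for x
    unfolding ** by (rule *) simp
  then show ?thesis by (simp add: poly_eq_poly_eq_iff[symmetric] fun_eq_iff)
qed

lemma blossom_move: "blossom P (us @ v # ws) = blossom P (v # us @ ws)"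
proof (induction us arbitrary: P)
  case (Cons u us)
  have "blossom P ((u # us) @ v # ws) = blossom (polar (Suc (Suc (length us + length ws))) u P) (v # us @ ws)"
    using Cons[of "polar (Suc (Suc (length us + length ws))) u P"] by simp
  also have "\<dots> = blossom P (v # (u # us) @ ws)"
    by (simp add: polar_commute)
  finally show ?case .
qed simp

lemma blossom_perm:
  assumes "mset us = mset vs"
  shows "blossom P us = blossom P vs"
  using assms
proof (induction us arbitrary: P vs)
  case (Cons u us)
  then have "u \<in> set vs" by (metis list.set_intros(1) set_mset_mset)
  then obtain xs ys where vs: "vs = xs @ u # ys" by (meson split_list)
  have "mset us = mset (xs @ ys)" using Cons.prems vs by simp
  then have "blossom (polar (Suc (length us)) u P) us = blossom (polar (Suc (length us)) u P) (xs @ ys)"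
    and "length us = length (xs @ ys)"
    using Cons.IH by (blast, metis mset_eq_length)
  then show ?case unfolding vs blossom_move by simp
qed simp

lemma blossom_diag:
  assumes "degree P \<le> q"
  shows "blossom P (replicate q x) = poly P x"
  using assms
proof (induction q arbitrary: P)
  case 0
  then obtain c where "P = [:c:]" by (metis degree_0_id le_0_eq)
  then show ?case by simp
next
  case (Suc q)
  then show ?case using degree_polar[of P q x] by simp
qed

text \<open>P cancels in the difference of two polars and leaves a multiple of P'. Blossoms are
  therefore affine in each argument, and their slopes are blossoms of the derivative; the
  differentiation formula for splines rests on the latter.\<close>

lemma blossom_slope:
  "blossom P (u # us) - blossom P (v # us) = (u - v) / real (Suc (length us)) * blossom (pderiv P) us"
proof -
  have "polar (Suc (length us)) u P - polar (Suc (length us)) v P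
      = smult ((u - v) / real (Suc (length us))) (pderiv P)"
    unfolding polar_def by (rule poly_eqI)
      (simp add: algebra_simps add_divide_distrib diff_divide_distrib flip: poly_eq_poly_eq_iff)
  then show ?thesis
    by (simp add: blossom_smult flip: blossom_diff)
qed

lemma blossom_affine:
  assumes "u \<noteq> v"
  shows "blossom P (x # us) = (x - u) / (v - u) * blossom P (v # us) + (v - x) / (v - u) * blossom P (u # us)"
proof -
  define B where "B = blossom (pderiv P) us / real (Suc (length us))"
  have "blossom P (x # us) = blossom P (u # us) + (x - u) * B"
    and "blossom P (v # us) = blossom P (u # us) + (v - u) * B"
    using blossom_slope[of P x us u] blossom_slope[of P v us u]
    unfolding B_def by (simp_all del: blossom.simps add: algebra_simps)
  then show ?thesis using assms by (simp del: blossom.simps add: divide_simps) (simp del: blossom.simps add: algebra_simps)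
qed

text \<open>Differentiation lowers the order of the zero at z by one, and the factor z - x in the
  polar restores it.\<close>

lemma dvd_polar:
  assumes "[:-z, 1:] ^ k dvd P"
  shows "[:-z, 1:] ^ k dvd polar q z P"
proof (cases k)
  case (Suc j)
  obtain R where R: "P = [:-z, 1:] ^ Suc j * R" using assms Suc by auto
  have "[:-z, 1:] * pderiv P = [:-z, 1:] ^ Suc j * ([:-z, 1:] * pderiv R)
      + [:-z, 1:] ^ Suc j * smult (of_nat (Suc j)) R"
    unfolding R lemma_order_pderiv1 by (simp only: distrib_left power_Suc mult_smult_left mult_smult_right mult_ac)
  then have "[:-z, 1:] ^ k dvd - ([:-z, 1:] * pderiv P)"
    using Suc by (metis dvd_add dvd_minus_iff dvd_triv_left)
  moreover have "[:z, -1:] * pderiv P = - ([:-z, 1:] * pderiv P)" by simp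
  ultimately have "[:-z, 1:] ^ k dvd [:z, -1:] * pderiv P" by (simp only:)
  then show ?thesis using assms unfolding polar_def by (intro dvd_add dvd_smult)
qed simp

text \<open>Each argument z keeps the divisor of order k and lowers the degree by one. After all m
  of them the degree is at most \<open>length us\<close> < k, so the remaining polynomial is
  0.\<close>

lemma blossom_vanish:
  assumes "degree P \<le> m + length us" "[:-z, 1:] ^ k dvd P" "m + length us < m + k" "0 < k"
  shows "blossom P (replicate m z @ us) = 0"
  using assms
proof (induction m arbitrary: P)
  case 0
  have "P = 0"
  proof (rule ccontr)
    assume "P \<noteq> 0"
    then have "degree ([:-z, 1:] ^ k) \<le> degree P" using 0 by (intro dvd_imp_degree_le) auto
    then show False using 0 by (simp add: degree_linear_power)
  qed
  then show ?case by simp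
next
  case (Suc m)
  have "degree (polar (Suc (m + length us)) z P) \<le> m + length us"
    using Suc.prems by (intro degree_polar) simp
  then show ?case using Suc.IH[of "polar (Suc (m + length us)) z P"] Suc.prems dvd_polar by simp
qed

lemma pderiv_surj:
  fixes Q :: "real poly"
  shows "\<exists>R. pderiv R = Q \<and> degree R \<le> Suc (degree Q)"
proof -
  define R where "R = pCons 0 (Abs_poly (\<lambda>k. coeff Q k / real (Suc k)))"
  have c: "coeff (Abs_poly (\<lambda>k. coeff Q k / real (Suc k))) = (\<lambda>k. coeff Q k / real (Suc k))"
    by (intro Abs_poly_inverse) (auto intro: MOST_mono[OF MOST_coeff_eq_0[of Q]])
  have "pderiv R = Q" by (rule poly_eqI) (simp add: R_def coeff_pderiv c del: of_nat_Suc)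
  moreover have "degree R \<le> Suc (degree Q)"
    by (rule degree_le) (auto simp: R_def c coeff_pCons coeff_eq_0 split: nat.split simp del: of_nat_Suc)
  ultimately show ?thesis by blast
qed

section \<open>B-splines on a single knot interval\<close>

text \<open>\<open>bpoly t \<mu> q i\<close> is the polynomial piece of the \<open>i\<close>-th B-spline between the knots \<open>t \<mu>\<close> and
  \<open>t (\<mu> + 1)\<close>.\<close>

fun bpoly :: "(nat \<Rightarrow> real) \<Rightarrow> nat \<Rightarrow> nat \<Rightarrow> nat \<Rightarrow> real poly" where
  "bpoly t \<mu> 0 i = (if i = \<mu> then 1 else 0)"
| "bpoly t \<mu> (Suc q) i =
     smult (1 / (t (i + q + 1) - t i)) ([:- t i, 1:] * bpoly t \<mu> q i) +
     smult (1 / (t (i + q + 2) - t (i + 1))) ([:t (i + q + 2), -1:] * bpoly t \<mu> q (i + 1))"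

definition window :: "(nat \<Rightarrow> real) \<Rightarrow> nat \<Rightarrow> nat \<Rightarrow> real list" where
  "window t q i = map t [i + 1..<i + q + 1]"

definition local_poly :: "(nat \<Rightarrow> real) \<Rightarrow> nat \<Rightarrow> nat \<Rightarrow> (nat \<Rightarrow> real) \<Rightarrow> real poly" where
  "local_poly t \<mu> q c = (\<Sum>i=\<mu>-q..\<mu>. smult (c i) (bpoly t \<mu> q i))"

lemma length_window [simp]: "length (window t q i) = q"
  by (simp add: window_def)

lemma window_snoc: "window t (Suc q) i = window t q i @ [t (i + q + 1)]"
  by (simp add: window_def)

lemma window_Cons: "window t (Suc q) i = t (i + 1) # window t q (i + 1)"
  by (simp add: window_def upt_conv_Cons del: upt_Suc)

lemma degree_bpoly: "degree (bpoly t \<mu> q i) \<le> q"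
proof (induction q arbitrary: i)
  case (Suc q)
  have "degree ([:u, v:] * bpoly t \<mu> q j) \<le> Suc q" for u v j
    using degree_mult_le[of "[:u, v:]" "bpoly t \<mu> q j"] Suc[of j] degree_pCons_le[of u "[:v:]"]
    by simp
  then show ?case
    unfolding bpoly.simps by (intro degree_add_le order_trans[OF degree_smult_le])
qed simp

lemma bpoly_eq_0: "\<mu> < i \<or> i + q < \<mu> \<Longrightarrow> bpoly t \<mu> q i = 0"
  by (induction q arbitrary: i) auto

lemma degree_local_poly: "degree (local_poly t \<mu> q c) \<le> q"
  unfolding local_poly_def
  by (intro degree_sum_le order_trans[OF degree_smult_le degree_bpoly]) simp

text \<open>Evaluation by the de Boor algorithm: each degree step puts one argument x into the
  blossom. In the Cox--de Boor sum the two terms with the same B-spline of lower degree are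
  collected, and their coefficients form the affine combination that moves one argument to
  x.\<close>

lemma de_Boor:
  assumes "mono t" "t \<mu> < t (Suc \<mu>)" "q \<le> \<mu>" "degree P \<le> q"
  shows "poly P x = (\<Sum>i=\<mu>-q..\<mu>. blossom P (window t q i) * poly (bpoly t \<mu> q i) x)"
  using assms(3,4)
proof (induction q arbitrary: P)
  case 0
  then obtain k where "P = [:k:]" by (metis degree_0_id le_0_eq)
  then show ?case by (simp add: window_def)
next
  case (Suc q)
  obtain m where m: "\<mu> = Suc (m + q)" using Suc.prems(1) by (metis add.commute add_Suc_right le_iff_add)
  let ?f = "\<lambda>i. blossom P (window t (Suc q) i)"
  let ?d = "\<lambda>i. t (i + q + 1) - t i"
  let ?b = "\<lambda>i. poly (bpoly t \<mu> q i) x"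
  define X where "X i = (x - t i) / ?d i * ?b i" for i
  define Y where "Y i = (t (i + q + 1) - x) / ?d i * ?b i" for i
  \<comment> \<open>The two terms left over by the index shift belong to B-splines of degree q that
    vanish on this interval.\<close>
  have X0: "X m = 0" and Y0: "Y (Suc \<mu>) = 0"
    by (auto simp: X_def Y_def m bpoly_eq_0)
  have "(\<Sum>i=\<mu>-Suc q..\<mu>. ?f i * poly (bpoly t \<mu> (Suc q) i) x)
      = (\<Sum>i=m..Suc (m + q). ?f i * X i) + (\<Sum>i=m..Suc (m + q). ?f i * Y (Suc i))"
    unfolding sum.distrib[symmetric]
    by (intro sum.cong) (auto simp: m X_def Y_def algebra_simps add_divide_distrib diff_divide_distrib)
  also have "(\<Sum>i=m..Suc (m + q). ?f i * X i) = (\<Sum>i=Suc m..Suc (m + q). ?f i * X i)"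
    using X0 by (subst sum.atLeast_Suc_atMost) auto
  also have "(\<Sum>i=m..Suc (m + q). ?f i * Y (Suc i)) = (\<Sum>i=m..m + q. ?f i * Y (Suc i))"
    using Y0 by (simp add: m)
  also have "\<dots> = (\<Sum>i=Suc m..Suc (m + q). ?f (i - 1) * Y i)"
    by (simp only: sum.shift_bounds_cl_Suc_ivl diff_Suc_1)
  also have "(\<Sum>i=Suc m..Suc (m + q). ?f i * X i) + (\<Sum>i=Suc m..Suc (m + q). ?f (i - 1) * Y i)
      = (\<Sum>i=Suc m..Suc (m + q). blossom (polar (Suc q) x P) (window t q i) * ?b i)"
    unfolding sum.distrib[symmetric]
  proof (intro sum.cong refl)
    fix i assume i: "i \<in> {Suc m..Suc (m + q)}"
    have "t i \<le> t \<mu>" "t (Suc \<mu>) \<le> t (i + q + 1)"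
      using i by (auto simp: m intro!: monoD[OF assms(1)])
    then have ne: "t i \<noteq> t (i + q + 1)" using assms(2) by simp
    have "?f i = blossom P (t (i + q + 1) # window t q i)"
      unfolding window_snoc by (rule blossom_perm) simp
    moreover have "?f (i - 1) = blossom P (t i # window t q i)"
      using i by (simp add: window_Cons)
    ultimately show "?f i * X i + ?f (i - 1) * Y i = blossom (polar (Suc q) x P) (window t q i) * ?b i"
      using blossom_affine[OF ne, of P x "window t q i"]
      by (simp add: X_def Y_def algebra_simps)
  qed
  also have "\<dots> = poly P x"
    using Suc.IH[of "polar (Suc q) x P"] Suc.prems degree_polar[of P q x] by (simp add: m)
  finally show ?case by simp
qed

lemma de_Boor_poly:
  assumes "mono t" "t \<mu> < t (Suc \<mu>)" "q \<le> \<mu>" "degree P \<le> q"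
  shows "P = local_poly t \<mu> q (\<lambda>i. blossom P (window t q i))"
  using de_Boor[OF assms]
  by (simp add: poly_eq_poly_eq_iff[symmetric] fun_eq_iff local_poly_def poly_sum)

lemma blossom_const [simp]: "blossom [:k:] us = k"
  by (induction us) (auto simp: polar_def)

text \<open>Differences of consecutive prescribed values are blossom values of P', up to knot
  distances. So P' comes from the induction hypothesis, P is an antiderivative, and its constant is
  fixed by the first value.\<close>

lemma blossom_interpolation:
  assumes "mono t" "t \<mu> < t (Suc \<mu>)" "q \<le> \<mu>"
  shows "\<exists>P. degree P \<le> q \<and> (\<forall>i\<in>{\<mu>-q..\<mu>}. blossom P (window t q i) = c i)"
  using assms(3)
proof (induction q arbitrary: c)
  case 0
  show ?case by (intro exI[of _ "[:c \<mu>:]"]) (simp add: window_def)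
next
  case (Suc q)
  obtain m where m: "\<mu> = Suc (m + q)" using Suc.prems(1) by (metis add.commute add_Suc_right le_iff_add)
  let ?w = "window t (Suc q)"
  obtain Q where Q: "degree Q \<le> q" "\<And>i. i \<in> {Suc m..\<mu>} \<Longrightarrow>
      blossom Q (window t q i) = real (Suc q) * (c i - c (i - 1)) / (t (i + q + 1) - t i)"
    using Suc.IH[of "\<lambda>i. real (Suc q) * (c i - c (i - 1)) / (t (i + q + 1) - t i)"] Suc.prems
    by (auto simp: m)
  obtain R where R: "pderiv R = Q" "degree R \<le> Suc (degree Q)" using pderiv_surj by blast
  define P where "P = R + [:c m - blossom R (?w m):]"
  have "degree P \<le> Suc q" unfolding P_def using R Q by (intro degree_add_le) auto
  moreover have "blossom P (?w i) = c i" if "m \<le> i" "i \<le> \<mu>" for i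
    using that
  proof (induction i rule: dec_induct)
    case base
    show ?case by (simp add: P_def blossom_add del: blossom.simps)
  next
    case (step i)
    have "t (Suc i) \<le> t \<mu>" "t (Suc \<mu>) \<le> t (Suc i + q + 1)"
      using step by (auto simp: m intro!: monoD[OF assms(1)])
    then have ne: "t (Suc i + q + 1) - t (Suc i) \<noteq> 0" using assms(2) by simp
    have "blossom P (?w (Suc i)) - blossom P (?w i)
        = blossom P (t (Suc i + q + 1) # window t q (Suc i)) - blossom P (t (Suc i) # window t q (Suc i))"
      by (intro arg_cong2[where f = minus] blossom_perm)
        (simp_all add: window_snoc[of t q "Suc i"] window_Cons[of t q i])
    also have "\<dots> = (t (Suc i + q + 1) - t (Suc i)) / real (Suc q) * blossom Q (window t q (Suc i))"
      unfolding blossom_slope by (simp add: P_def pderiv_add pderiv_pCons R)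
    also have "\<dots> = c (Suc i) - c i"
      using Q(2)[of "Suc i"] step ne by (simp del: of_nat_Suc)
    finally show ?case using step by simp
  qed
  ultimately show ?case by (intro exI[of _ P]) (auto simp: m)
qed

lemma local_poly_unique:
  assumes "mono t" "t \<mu> < t (Suc \<mu>)" "q \<le> \<mu>" "degree P \<le> q"
    and "\<And>i. \<mu> - q \<le> i \<Longrightarrow> i \<le> \<mu> \<Longrightarrow> blossom P (window t q i) = c i"
  shows "P = local_poly t \<mu> q c"
proof -
  have "local_poly t \<mu> q (\<lambda>i. blossom P (window t q i)) = local_poly t \<mu> q c"
    unfolding local_poly_def using assms(5) by (intro sum.cong) auto
  then show ?thesis using de_Boor_poly[OF assms(1-4)] by simp
qed

text \<open>An interpolating polynomial for c exists, and \<open>local_poly_unique\<close>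
  identifies it with \<open>local_poly\<close>. Coefficients can thus be read off a single piece,
  which takes the place of linear independence of the B-splines.\<close>

lemma blossom_local_poly:
  assumes "mono t" "t \<mu> < t (Suc \<mu>)" "q \<le> \<mu>" "\<mu> - q \<le> i" "i \<le> \<mu>"
  shows "blossom (local_poly t \<mu> q c) (window t q i) = c i"
  using blossom_interpolation[OF assms(1-3), of c] local_poly_unique[OF assms(1-3)] assms(4,5)
  by (metis atLeastAtMost_iff)

lemma local_poly_const:
  assumes "mono t" "t \<mu> < t (Suc \<mu>)" "q \<le> \<mu>"
  shows "local_poly t \<mu> q (\<lambda>i. k) = [:k:]"
  using local_poly_unique[OF assms, of "[:k:]" "\<lambda>i. k"] by simp

lemma bpoly_nonneg:
  assumes "mono t" "t \<mu> \<le> x" "x \<le> t (Suc \<mu>)"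
  shows "0 \<le> poly (bpoly t \<mu> q i) x"
proof (induction q arbitrary: i)
  case (Suc q)
  have 1: "0 \<le> (x - t i) * poly (bpoly t \<mu> q i) x"
  proof (cases "i \<le> \<mu>")
    case True
    then show ?thesis using Suc monoD[OF assms(1), of i \<mu>] assms by simp
  qed (simp add: bpoly_eq_0)
  have 2: "0 \<le> (t (i + q + 2) - x) * poly (bpoly t \<mu> q (i + 1)) x"
  proof (cases "\<mu> \<le> i + 1 + q")
    case True
    then show ?thesis using Suc[of "i + 1"] monoD[OF assms(1), of "Suc \<mu>" "i + q + 2"] assms by simp
  qed (simp add: bpoly_eq_0)
  have "0 \<le> t (i + q + 1) - t i" "0 \<le> t (i + q + 2) - t (i + 1)"
    using monoD[OF assms(1), of i "i + q + 1"] monoD[OF assms(1), of "i + 1" "i + q + 2"] by simp_all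
  with 1 2 have "0 \<le> 1 / (t (i + q + 1) - t i) * ((x - t i) * poly (bpoly t \<mu> q i) x)
      + 1 / (t (i + q + 2) - t (i + 1)) * ((t (i + q + 2) - x) * poly (bpoly t \<mu> q (i + 1)) x)"
    by (intro add_nonneg_nonneg mult_nonneg_nonneg[of "1 / _"]) auto
  then show ?case by (simp add: algebra_simps)
qed simp

text \<open>In the recursion the first term gains the factor x - t i = x - z, and the second starts
  one knot later. The exponent is a truncated subtraction and is 0 when i + q \<le> \<mu>.\<close>

lemma bpoly_dvd:
  assumes "\<And>j. i \<le> j \<Longrightarrow> j \<le> \<mu> \<Longrightarrow> t j = z"
  shows "[:-z, 1:] ^ (i + q - \<mu>) dvd bpoly t \<mu> q i"
  using assms
proof (induction q arbitrary: i)
  case 0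
  then show ?case by (cases "i \<le> \<mu>") auto
next
  case (Suc q)
  have "[:-z, 1:] ^ (i + Suc q - \<mu>) dvd [:- t i, 1:] * bpoly t \<mu> q i"
  proof (cases "i \<le> \<mu>")
    case True
    have "[:-z, 1:] ^ Suc (i + q - \<mu>) dvd [:- t i, 1:] * bpoly t \<mu> q i"
      using mult_dvd_mono[OF dvd_refl[of "[:-z, 1:]"] Suc.IH[OF Suc.prems]] Suc.prems[of i] True
      by (simp only: power_Suc order_refl)
    then show ?thesis by (rule power_le_dvd) simp
  qed (simp add: bpoly_eq_0)
  moreover have "[:-z, 1:] ^ (i + Suc q - \<mu>) dvd bpoly t \<mu> q (i + 1)"
    using Suc.IH[of "i + 1"] Suc.prems by simp
  ultimately show ?case
    unfolding bpoly.simps by (intro dvd_add dvd_smult dvd_mult[of _ "bpoly t \<mu> q (i + 1)"])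
qed

text \<open>Here \<nu> - \<mu> is the multiplicity of the knot between the two intervals. Expanded
  on the right interval, the difference has coefficient 0 at every index that both intervals share,
  and the other B-splines begin at the knot, where \<open>bpoly_dvd\<close> gives the order of their
  zeros.\<close>

lemma local_poly_join:
  assumes "mono t" "\<mu> < \<nu>" "t \<mu> < t (Suc \<mu>)" "t (Suc \<mu>) = t \<nu>" "t \<nu> < t (Suc \<nu>)" "q \<le> \<mu>"
  shows "[:- t \<nu>, 1:] ^ (q + 1 - (\<nu> - \<mu>)) dvd local_poly t \<nu> q c - local_poly t \<mu> q c"
proof -
  define D where "D = local_poly t \<nu> q c - local_poly t \<mu> q c"
  have "degree D \<le> q" unfolding D_def by (intro degree_diff_le degree_local_poly)
  then have D: "D = (\<Sum>i=\<nu>-q..\<nu>. smult (blossom D (window t q i)) (bpoly t \<nu> q i))"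
    using de_Boor_poly[of t \<nu> q D] assms by (simp add: local_poly_def)
  have "[:- t \<nu>, 1:] ^ (q + 1 - (\<nu> - \<mu>)) dvd smult (blossom D (window t q i)) (bpoly t \<nu> q i)"
    if i: "i \<in> {\<nu>-q..\<nu>}" for i
  proof (cases "i \<le> \<mu>")
    case True
    then have "blossom D (window t q i) = 0"
      unfolding D_def blossom_diff using i assms by (simp add: blossom_local_poly)
    then show ?thesis by simp
  next
    case False
    have "t j = t \<nu>" if "i \<le> j" "j \<le> \<nu>" for j
      using monoD[OF assms(1), of "Suc \<mu>" j] monoD[OF assms(1), of j \<nu>] that False assms(4) by simp
    then have "[:- t \<nu>, 1:] ^ (i + q - \<nu>) dvd bpoly t \<nu> q i" by (rule bpoly_dvd)
    then have "[:- t \<nu>, 1:] ^ (q + 1 - (\<nu> - \<mu>)) dvd bpoly t \<nu> q i"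
      by (rule power_le_dvd) (use False assms in simp)
    then show ?thesis by (rule dvd_smult)
  qed
  then show ?thesis using D unfolding D_def[symmetric] by (subst D) (intro dvd_sum)
qed

lemma upt_split: "i \<le> j \<Longrightarrow> j \<le> k \<Longrightarrow> [i..<k] = [i..<j] @ [j..<k]"
  by (metis le_add_diff_inverse upt_add_eq_append)

text \<open>The window contains all \<nu> - \<mu> copies of the knot. Only q - (\<nu> - \<mu>)
  arguments remain, fewer than the order of the zero, so \<open>blossom_vanish\<close>
  applies.\<close>

lemma blossom_window_join:
  assumes "mono t" "\<mu> < \<nu>" "t (Suc \<mu>) = t \<nu>" "degree D \<le> q"
    and "[:- t \<nu>, 1:] ^ (q + 1 - (\<nu> - \<mu>)) dvd D" "\<nu> \<le> i + q" "i \<le> \<mu>"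
  shows "blossom D (window t q i) = 0"
proof -
  have "t j = t \<nu>" if "Suc \<mu> \<le> j" "j \<le> \<nu>" for j
    using monoD[OF assms(1), of "Suc \<mu>" j] monoD[OF assms(1), of j \<nu>] that assms(3) by simp
  then have "map t [Suc \<mu>..<Suc \<nu>] = map (\<lambda>_. t \<nu>) [Suc \<mu>..<Suc \<nu>]"
    by (intro map_cong refl) (simp only: atLeastLessThan_iff set_upt less_Suc_eq_le)
  then have rep: "map t [Suc \<mu>..<Suc \<nu>] = replicate (\<nu> - \<mu>) (t \<nu>)"
    by (simp only: map_replicate_const length_upt diff_Suc_Suc)
  have "[i + 1..<i + q + 1] = [i + 1..<Suc \<mu>] @ [Suc \<mu>..<Suc \<nu>] @ [Suc \<nu>..<i + q + 1]"
  proof -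
    have "i + 1 \<le> Suc \<mu>" "Suc \<mu> \<le> i + q + 1" "Suc \<mu> \<le> Suc \<nu>" "Suc \<nu> \<le> i + q + 1"
      using assms by simp_all
    then show ?thesis by (metis upt_split)
  qed
  then have "blossom D (window t q i)
      = blossom D (replicate (\<nu> - \<mu>) (t \<nu>) @ map t [i + 1..<Suc \<mu>] @ map t [Suc \<nu>..<i + q + 1])"
    unfolding window_def rep[symmetric]
    by (intro blossom_perm) (simp only: map_append mset_append add_ac)
  also have "\<dots> = 0"
    using assms by (intro blossom_vanish) auto
  finally show ?thesis .
qed

section \<open>Open knot vectors\<close>

text \<open>Indices start at 1 and are clamped, so that \<open>knot \<Xi>\<close> is monotone on all of \<open>nat\<close>.\<close>

definition knot :: "real list \<Rightarrow> nat \<Rightarrow> real" where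
  "knot \<Xi> i = \<Xi> ! (min (i - 1) (length \<Xi> - 1))"

text \<open>For a \<le> z < b this is the index \<mu> of the knot interval with t \<mu> \<le> z < t
  (\<mu> + 1); at a breakpoint it is the index of its last copy.\<close>

definition knots_upto :: "real list \<Rightarrow> real \<Rightarrow> nat" where
  "knots_upto \<Xi> z = length (filter (\<lambda>x. x \<le> z) \<Xi>)"

text \<open>List positions count from 0 here. \<open>knots_less\<close> bounds every multiplicity by
  q + 1 without counting: it makes the weights of the knot norm positive, and it is easy to check
  after a knot has been removed or added.\<close>

locale open_knots =
  fixes q :: nat and a b :: real and \<Xi> :: "real list"
  assumes sorted_knots: "sorted \<Xi>"
    and length_knots: "2 * (q + 1) \<le> length \<Xi>"
    and first_knots: "\<And>i. i \<le> q \<Longrightarrow> \<Xi> ! i = a"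
    and last_knots: "\<And>i. length \<Xi> - (q + 1) \<le> i \<Longrightarrow> i < length \<Xi> \<Longrightarrow> \<Xi> ! i = b"
    and knots_less: "\<And>i. i + q + 1 < length \<Xi> \<Longrightarrow> \<Xi> ! i < \<Xi> ! (i + q + 1)"

lemma knot_ith: "i \<le> length \<Xi> \<Longrightarrow> knot \<Xi> i = ith \<Xi> i"
  by (simp add: knot_def min_def)

lemma mono_knot:
  assumes "sorted \<Xi>" "\<Xi> \<noteq> []"
  shows "mono (knot \<Xi>)"
proof (rule monoI)
  fix i j :: nat assume "i \<le> j"
  moreover have "length \<Xi> > 0" using assms by simp
  ultimately show "knot \<Xi> i \<le> knot \<Xi> j"
    unfolding knot_def by (intro sorted_nth_mono assms) linarith+
qed

lemma nth_le_iff_less_knots_upto: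
  assumes "sorted \<Xi>" "i < length \<Xi>"
  shows "\<Xi> ! i \<le> z \<longleftrightarrow> i < knots_upto \<Xi> z"
  using assms
proof (induction \<Xi> arbitrary: i)
  case (Cons x xs)
  show ?case
  proof (cases "x \<le> z")
    case True
    then show ?thesis using Cons by (cases i) (auto simp: knots_upto_def)
  next
    case False
    then have "filter (\<lambda>y. y \<le> z) (x # xs) = []" using Cons.prems by (auto simp: filter_empty_conv)
    moreover have "\<not> (x # xs) ! i \<le> z" using False Cons.prems by (cases i) (auto dest!: nth_mem)
    ultimately show ?thesis by (simp add: knots_upto_def)
  qed
qed simp

lemma length_filter_less_count:
  "length (filter (\<lambda>x. x \<le> z) xs) = length (filter (\<lambda>x. x < z) xs) + count_list xs (z :: real)"
  by (induction xs) auto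

context open_knots
begin

abbreviation t :: "nat \<Rightarrow> real" where "t \<equiv> knot \<Xi>"
abbreviation n :: nat where "n \<equiv> spline_dim q \<Xi>"

lemma length_eq: "length \<Xi> = n + q + 1"
  using length_knots by (simp add: spline_dim_def)

lemma dim_ge: "q + 1 \<le> n"
  using length_knots by (simp add: spline_dim_def)

lemma mono_t: "mono t"
  using length_knots by (intro mono_knot sorted_knots) auto

lemma t_le: "i \<le> j \<Longrightarrow> t i \<le> t j"
  using mono_t by (rule monoD)

lemma t_ith: "i \<le> n + q + 1 \<Longrightarrow> t i = ith \<Xi> i"
  by (intro knot_ith) (simp add: length_eq)

lemma t_first: "i \<le> q + 1 \<Longrightarrow> t i = a"
  using first_knots[of "i - 1"] dim_ge by (simp add: t_ith)

lemma t_last: "n + 1 \<le> i \<Longrightarrow> t i = b"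
  unfolding knot_def by (intro last_knots) (auto simp: length_eq)

lemma t_less: "1 \<le> i \<Longrightarrow> i \<le> n \<Longrightarrow> t i < t (i + q + 1)"
  using knots_less[of "i - 1"] by (simp add: t_ith length_eq)

lemma a_le_t: "a \<le> t i"
  using t_first[of 0] t_le[of 0 i] by simp

lemma t_le_b: "t i \<le> b"
  using t_last[of "max i (n + 1)"] t_le[of i "max i (n + 1)"] by simp

lemma a_less_t: "q + 2 \<le> i \<Longrightarrow> a < t i"
  using t_less[of 1] t_first[of 1] dim_ge t_le[of "q + 2" i] by simp

lemma t_less_b: "i \<le> n \<Longrightarrow> t i < b"
  using t_less[of n] t_last[of "n + q + 1"] dim_ge t_le[of i n] by simp

lemma a_less_b: "a < b"
  using t_less_b[of n] a_le_t[of n] by simp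

lemma left_end_eq: "left_end q \<Xi> = a"
  using t_first[of "q + 1"] dim_ge t_ith[of "q + 1"] by (simp add: left_end_def)

lemma right_end_eq: "right_end q \<Xi> = b"
  using t_last[of "n + 1"] t_ith[of "n + 1"] by (simp add: right_end_def)

text \<open>Half-open intervals, closed at b, in agreement with the one-sided values of
  \<open>bspline\<close>. Knot intervals of length 0 have no points.\<close>

definition piece :: "nat \<Rightarrow> real \<Rightarrow> bool" where
  "piece \<mu> x \<longleftrightarrow> q + 1 \<le> \<mu> \<and> \<mu> \<le> n \<and> t \<mu> < t (Suc \<mu>) \<and> t \<mu> \<le> x \<and>
     (x < t (Suc \<mu>) \<or> x = b \<and> t (Suc \<mu>) = b)"

lemma t_le_iff: "1 \<le> i \<Longrightarrow> i \<le> n + q + 1 \<Longrightarrow> t i \<le> z \<longleftrightarrow> i \<le> knots_upto \<Xi> z"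
  using nth_le_iff_less_knots_upto[OF sorted_knots, of "i - 1" z] by (simp add: t_ith length_eq) linarith

lemma knots_upto_bounds:
  assumes "a \<le> z" "z < b"
  shows "q + 1 \<le> knots_upto \<Xi> z" "knots_upto \<Xi> z \<le> n"
    "t (knots_upto \<Xi> z) \<le> z" "z < t (Suc (knots_upto \<Xi> z))"
proof -
  show 1: "q + 1 \<le> knots_upto \<Xi> z"
    using t_le_iff[of "q + 1" z] t_first[of "q + 1"] assms by simp
  show 2: "knots_upto \<Xi> z \<le> n"
    using t_le_iff[of "n + 1" z] t_last[of "n + 1"] assms by simp
  show "t (knots_upto \<Xi> z) \<le> z" using t_le_iff[of "knots_upto \<Xi> z" z] 1 2 by simp
  show "z < t (Suc (knots_upto \<Xi> z))" using t_le_iff[of "Suc (knots_upto \<Xi> z)" z] 1 2 by simp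
qed

lemma ex_piece:
  assumes "a \<le> x" "x \<le> b"
  shows "\<exists>\<mu>. piece \<mu> x"
proof (cases "x < b")
  case True
  then show ?thesis using knots_upto_bounds[of x] assms unfolding piece_def
    by (intro exI[of _ "knots_upto \<Xi> x"]) linarith
next
  case False
  then have "piece n x" using assms t_less_b[of n] t_last[of "Suc n"] dim_ge by (simp add: piece_def)
  then show ?thesis ..
qed

lemma piece_bounds: "piece \<mu> x \<Longrightarrow> a \<le> x \<and> x \<le> b"
  using a_le_t[of \<mu>] t_le_b[of "Suc \<mu>"] by (auto simp: piece_def)

text \<open>The bound on i + d keeps all knots that occur inside the list, where the clamped
  \<open>knot\<close> agrees with \<open>ith\<close>.\<close>

lemma bspline_eq_bpoly:
  assumes "piece \<mu> x" "1 \<le> i" "i + d \<le> n + q"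
  shows "bspline \<Xi> b d i x = poly (bpoly t \<mu> d i) x"
  using assms(2,3)
proof (induction d arbitrary: i)
  case 0
  have *: "ith \<Xi> i = t i" "ith \<Xi> (i + 1) = t (Suc i)" using 0 by (auto simp: t_ith)
  have "i < \<mu> \<Longrightarrow> t (Suc i) \<le> t \<mu>" "\<mu> < i \<Longrightarrow> t (Suc \<mu>) \<le> t i" by (auto intro: t_le)
  moreover have "t (Suc \<mu>) \<le> b" by (rule t_le_b)
  ultimately show ?case
    using assms(1) unfolding piece_def bspline.simps bpoly.simps *
    by (cases i \<mu> rule: linorder_cases) auto
next
  case (Suc d)
  have *: "ith \<Xi> i = t i" "ith \<Xi> (i + 1) = t (i + 1)" "ith \<Xi> (i + d + 1) = t (i + d + 1)"
    "ith \<Xi> (i + d + 2) = t (i + d + 2)"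
    using Suc.prems by (auto simp: t_ith)
  have "bspline \<Xi> b d i x = poly (bpoly t \<mu> d i) x"
    and "bspline \<Xi> b d (i + 1) x = poly (bpoly t \<mu> d (i + 1)) x"
    using Suc.IH[of i] Suc.IH[of "i + 1"] Suc.prems by auto
  then show ?case
    unfolding bspline.simps bpoly.simps * by (simp add: left_diff_distrib right_diff_distrib diff_divide_distrib)
qed

lemma spline_of_piece:
  assumes "piece \<mu> x"
  shows "spline_of q \<Xi> c x = poly (local_poly t \<mu> q (ith c)) x"
proof -
  have "spline_of q \<Xi> c x = (\<Sum>i=1..n. ith c i * poly (bpoly t \<mu> q i) x)"
    unfolding spline_of_def right_end_eq
    by (intro sum.cong refl) (use bspline_eq_bpoly[OF assms] in auto)
  also have "\<dots> = (\<Sum>i=\<mu>-q..\<mu>. ith c i * poly (bpoly t \<mu> q i) x)"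
  proof (rule sum.mono_neutral_right)
    show "\<forall>i\<in>{1..n} - {\<mu>-q..\<mu>}. ith c i * poly (bpoly t \<mu> q i) x = 0"
    proof
      fix i assume "i \<in> {1..n} - {\<mu>-q..\<mu>}"
      then have "\<mu> < i \<or> i + q < \<mu>" by auto
      then show "ith c i * poly (bpoly t \<mu> q i) x = 0" by (simp add: bpoly_eq_0)
    qed
  qed (use assms in \<open>auto simp: piece_def\<close>)
  also have "\<dots> = poly (local_poly t \<mu> q (ith c)) x"
    by (simp add: local_poly_def poly_sum)
  finally show ?thesis .
qed

text \<open>Cutting q knots off each end loses no value, since a copy of a and a copy of b
  remain.\<close>

lemma breakpoints_eq: "breakpoints q \<Xi> = sorted_list_of_set (set \<Xi>)"
proof -
  let ?xs = "take (length \<Xi> - 2 * q) (drop q \<Xi>)"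
  have "set \<Xi> \<subseteq> set ?xs"
  proof
    fix x assume "x \<in> set \<Xi>"
    then obtain i where i: "i < length \<Xi>" "x = \<Xi> ! i" by (auto simp: in_set_conv_nth)
    consider "i < q" | "q \<le> i" "i < length \<Xi> - q" | "length \<Xi> - q \<le> i" by linarith
    then have "\<exists>k. q \<le> k \<and> k < length \<Xi> - q \<and> \<Xi> ! k = x"
    proof cases
      case 1
      then show ?thesis using i first_knots[of i] first_knots[of q] length_knots by (intro exI[of _ q]) auto
    next
      case 3
      then show ?thesis using i last_knots[of i] last_knots[of "length \<Xi> - (q + 1)"] length_knots
        by (intro exI[of _ "length \<Xi> - (q + 1)"]) auto
    qed (use i in auto)
    then obtain k where "q \<le> k" "k < length \<Xi> - q" "\<Xi> ! k = x" by blast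
    then show "x \<in> set ?xs"
      by (auto simp: in_set_conv_nth intro!: exI[of _ "k - q"])
  qed
  then have "set ?xs = set \<Xi>" by (auto dest: in_set_takeD in_set_dropD)
  moreover have "sorted ?xs" by (intro sorted_wrt_take sorted_wrt_drop sorted_knots)
  ultimately show ?thesis unfolding breakpoints_def
    by (intro sorted_distinct_set_unique) (auto intro: sorted_remdups)
qed

abbreviation z :: "nat \<Rightarrow> real" where "z \<equiv> ith (breakpoints q \<Xi>)"
abbreviation N :: nat where "N \<equiv> num_breakpoints q \<Xi>"

lemma set_breakpoints: "set (breakpoints q \<Xi>) = set \<Xi>"
  by (simp add: breakpoints_eq)

lemma z_in_knots: "1 \<le> j \<Longrightarrow> j \<le> N \<Longrightarrow> z j \<in> set \<Xi>"
  using set_breakpoints nth_mem[of "j - 1" "breakpoints q \<Xi>"] by (simp add: num_breakpoints_def)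

lemma z_less: "1 \<le> i \<Longrightarrow> i < j \<Longrightarrow> j \<le> N \<Longrightarrow> z i < z j"
  using sorted_wrt_nth_less[of "(<)" "breakpoints q \<Xi>" "i - 1" "j - 1"]
  by (simp add: breakpoints_eq num_breakpoints_def)

lemma knot_is_z: "x \<in> set \<Xi> \<Longrightarrow> \<exists>j. 1 \<le> j \<and> j \<le> N \<and> z j = x"
proof -
  assume "x \<in> set \<Xi>"
  then obtain i where "i < N" "x = breakpoints q \<Xi> ! i"
    unfolding set_breakpoints[symmetric] by (auto simp: in_set_conv_nth num_breakpoints_def)
  then show ?thesis by (intro exI[of _ "Suc i"]) simp
qed

lemma z_inj: "1 \<le> i \<Longrightarrow> i \<le> N \<Longrightarrow> 1 \<le> j \<Longrightarrow> j \<le> N \<Longrightarrow> z i = z j \<Longrightarrow> i = j"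
  using z_less[of i j] z_less[of j i] by (cases i j rule: linorder_cases) auto

lemma t_in_knots: "t i \<in> set \<Xi>"
  unfolding knot_def using length_knots by (intro nth_mem) auto

lemma knots_between: "x \<in> set \<Xi> \<Longrightarrow> a \<le> x \<and> x \<le> b"
proof -
  assume "x \<in> set \<Xi>"
  then obtain i where "i < length \<Xi>" "x = \<Xi> ! i" by (auto simp: in_set_conv_nth)
  then have "x = t (Suc i)" using t_ith[of "Suc i"] by (simp add: length_eq)
  then show ?thesis using a_le_t t_le_b by simp
qed

lemma z_adjacent: "1 \<le> j \<Longrightarrow> j < N \<Longrightarrow> x \<in> set \<Xi> \<Longrightarrow> x \<le> z j \<or> z (Suc j) \<le> x"
proof -
  assume *: "1 \<le> j" "j < N" "x \<in> set \<Xi>"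
  then obtain i where i: "1 \<le> i" "i \<le> N" "z i = x" using knot_is_z by blast
  consider "i < j" | "i = j" | "i = Suc j" | "Suc j < i" by linarith
  then show ?thesis using z_less[of i j] z_less[of "Suc j" i] * i by cases auto
qed

lemma z_ends: "z 1 = a" "z N = b" "2 \<le> N"
proof -
  obtain i where i: "1 \<le> i" "i \<le> N" "z i = a" using knot_is_z[OF t_in_knots[of 1]] t_first[of 1] by auto
  obtain j where j: "1 \<le> j" "j \<le> N" "z j = b" using knot_is_z[OF t_in_knots[of "n + 1"]] t_last[of "n + 1"] by auto
  have "i = 1" using z_less[of 1 i] i knots_between[OF z_in_knots[of 1]] by (cases "1 < i") auto
  moreover have "j = N" using z_less[of j N] j knots_between[OF z_in_knots[of N]] by (cases "j < N") auto
  ultimately show "z 1 = a" "z N = b" using i j by auto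
  then show "2 \<le> N" using a_less_b i by (cases "N = 1") auto
qed

lemma z_bounds: "1 \<le> j \<Longrightarrow> j < N \<Longrightarrow> a \<le> z j \<and> z j < b"
  using z_less[of j N] z_ends knots_between[OF z_in_knots[of j]] by auto

lemma knot_eq_t: "x \<in> set \<Xi> \<Longrightarrow> \<exists>i. 1 \<le> i \<and> i \<le> n + q + 1 \<and> x = t i"
proof -
  assume "x \<in> set \<Xi>"
  then obtain i where "i < length \<Xi>" "x = \<Xi> ! i" by (auto simp: in_set_conv_nth)
  then show ?thesis using t_ith[of "Suc i"] by (intro exI[of _ "Suc i"]) (simp add: length_eq)
qed

text \<open>Translates from breakpoints, which define the spline space, to nonempty knot intervals,
  on which the blossoms live; \<open>interval_is_z\<close> is the way back.\<close>

lemma z_knots_upto: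
  assumes "1 \<le> j" "j < N"
  defines "\<mu> \<equiv> knots_upto \<Xi> (z j)"
  shows "q + 1 \<le> \<mu>" "\<mu> \<le> n" "t \<mu> = z j" "t (Suc \<mu>) = z (Suc j)"
proof -
  note B = knots_upto_bounds[OF conjunct1[OF z_bounds[OF assms(1,2)]] conjunct2[OF z_bounds[OF assms(1,2)]]]
  show \<mu>: "q + 1 \<le> \<mu>" "\<mu> \<le> n" using B unfolding \<mu>_def by auto
  obtain i where i: "1 \<le> i" "i \<le> n + q + 1" "z j = t i" using knot_eq_t[OF z_in_knots[of j]] assms by auto
  then have "i \<le> \<mu>" using t_le_iff[of i "z j"] unfolding \<mu>_def by simp
  then show "t \<mu> = z j" using t_le[of i \<mu>] i B unfolding \<mu>_def by simp
  obtain k where k: "1 \<le> k" "k \<le> n + q + 1" "z (Suc j) = t k"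
    using knot_eq_t[OF z_in_knots[of "Suc j"]] assms by auto
  then have "\<not> k \<le> \<mu>" using t_le_iff[of k "z j"] z_less[of j "Suc j"] assms by (simp add: \<mu>_def)
  then have "t (Suc \<mu>) \<le> z (Suc j)" using t_le[of "Suc \<mu>" k] k by simp
  moreover have "z (Suc j) \<le> t (Suc \<mu>)"
    using z_adjacent[OF assms(1,2) t_in_knots[of "Suc \<mu>"]] B unfolding \<mu>_def by simp
  ultimately show "t (Suc \<mu>) = z (Suc j)" by simp
qed

lemma interval_is_z:
  assumes "q + 1 \<le> \<mu>" "\<mu> \<le> n" "t \<mu> < t (Suc \<mu>)"
  shows "\<exists>j. 1 \<le> j \<and> j < N \<and> knots_upto \<Xi> (z j) = \<mu>"
proof -
  obtain j where j: "1 \<le> j" "j \<le> N" "z j = t \<mu>" using knot_is_z[OF t_in_knots[of \<mu>]] by auto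
  have "j \<noteq> N" using j z_ends t_less_b[of \<mu>] assms by auto
  moreover have "knots_upto \<Xi> (t \<mu>) = \<mu>"
    using t_le_iff[of \<mu> "t \<mu>"] t_le_iff[of "Suc \<mu>" "t \<mu>"] assms by simp
  ultimately show ?thesis using j by (intro exI[of _ j]) auto
qed

lemma knots_upto_Suc:
  assumes "1 \<le> j" "Suc j < N"
  shows "knots_upto \<Xi> (z (Suc j)) = knots_upto \<Xi> (z j) + knot_mult q \<Xi> (Suc j)"
proof -
  have "filter (\<lambda>x. x < z (Suc j)) \<Xi> = filter (\<lambda>x. x \<le> z j) \<Xi>"
    using z_adjacent[of j] z_less[of j "Suc j"] assms by (intro filter_cong) force+
  then show ?thesis unfolding knots_upto_def knot_mult_def length_filter_less_count[of "z (Suc j)"] by simp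
qed

text \<open>Adding up the copies of all breakpoints up to number j counts the knots \<le> z j. The
  removed knot is therefore the last copy of its breakpoint.\<close>

lemma removal_index_eq:
  assumes "1 \<le> j" "j < N"
  shows "removal_index q \<Xi> j = knots_upto \<Xi> (z j)"
  using assms
proof (induction j rule: dec_induct)
  case base
  have "knots_upto \<Xi> a = q + 1"
    using t_le_iff[of "q + 1" a] t_le_iff[of "q + 2" a] t_first[of "q + 1"] a_less_t[of "q + 2"] dim_ge by simp
  then show ?case using z_ends(1) by (simp add: removal_index_def)
next
  case (step j)
  then show ?case using knots_upto_Suc[of j] by (simp add: removal_index_def)
qed

text \<open>For the upper bound: with more than q + 1 copies, the first copy and the knot q + 1
  positions after it would coincide, against \<open>knots_less\<close>.\<close>

lemma knot_mult_bounds: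
  assumes "2 \<le> j" "j < N"
  shows "1 \<le> knot_mult q \<Xi> j" "knot_mult q \<Xi> j \<le> q + 1"
proof -
  obtain k where k: "j = Suc k" "1 \<le> k" using assms by (cases j) auto
  let ?\<mu> = "knots_upto \<Xi> (z k)" and ?\<nu> = "knots_upto \<Xi> (z j)"
  have eq: "?\<nu> = ?\<mu> + knot_mult q \<Xi> j" using knots_upto_Suc[of k] k assms by simp
  have \<mu>: "q + 1 \<le> ?\<mu>" "?\<mu> \<le> n" "t ?\<mu> = z k" "t (Suc ?\<mu>) = z j" using z_knots_upto[of k] k assms by auto
  have \<nu>: "?\<nu> \<le> n" "t ?\<nu> = z j" using z_knots_upto[of j] assms by auto
  show "1 \<le> knot_mult q \<Xi> j"
    using eq \<mu>(3) \<nu>(2) z_less[of k j] k assms by (cases "knot_mult q \<Xi> j") auto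
  show "knot_mult q \<Xi> j \<le> q + 1"
  proof (rule ccontr)
    assume *: "\<not> ?thesis"
    then have "t (Suc ?\<mu> + q + 1) \<le> t ?\<nu>" using eq by (intro t_le) simp
    moreover have "t (Suc ?\<mu>) < t (Suc ?\<mu> + q + 1)" using t_less[of "Suc ?\<mu>"] eq \<nu>(1) * by simp
    ultimately show False using \<mu> \<nu> by simp
  qed
qed

end

section \<open>Open knot vectors by index inequalities and by multiplicities\<close>

lemma nth_eq_knot: "i < length \<Xi> \<Longrightarrow> \<Xi> ! i = knot \<Xi> (Suc i)"
  by (simp add: knot_def)

lemma open_knotsI:
  assumes "mono (knot \<Xi>)" "2 * (q + 1) \<le> length \<Xi>"
    and "\<And>i. 1 \<le> i \<Longrightarrow> i \<le> q + 1 \<Longrightarrow> knot \<Xi> i = a"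
    and "\<And>i. length \<Xi> - q \<le> i \<Longrightarrow> i \<le> length \<Xi> \<Longrightarrow> knot \<Xi> i = b"
    and "\<And>i. 1 \<le> i \<Longrightarrow> i + q + 1 \<le> length \<Xi> \<Longrightarrow> knot \<Xi> i < knot \<Xi> (i + q + 1)"
  shows "open_knots q a b \<Xi>"
proof
  show "sorted \<Xi>" unfolding sorted_iff_nth_mono
    using assms(1) by (auto simp: nth_eq_knot intro: monoD)
  show "\<Xi> ! i = a" if "i \<le> q" for i using that assms(2) assms(3)[of "Suc i"] by (simp add: nth_eq_knot)
  show "\<Xi> ! i = b" if "length \<Xi> - (q + 1) \<le> i" "i < length \<Xi>" for i
    using that assms(2) assms(4)[of "Suc i"] by (simp add: nth_eq_knot)
  show "\<Xi> ! i < \<Xi> ! (i + q + 1)" if "i + q + 1 < length \<Xi>" for i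
    using that assms(5)[of "Suc i"] by (simp add: nth_eq_knot)
qed (rule assms(2))

text \<open>\<open>remdups\<close> keeps the last of equal entries, so in a sorted list a repeated
  head x is also the head of the list without duplicates; this is the second case of the
  induction.\<close>

lemma concat_replicate_remdups:
  assumes "sorted xs"
  shows "concat (map (\<lambda>z. replicate (count_list xs z) z) (remdups xs)) = xs"
  using assms
proof (induction xs)
  case (Cons x xs)
  have sorted: "sorted xs" using Cons.prems by simp
  show ?case
  proof (cases "x \<in> set xs")
    case False
    then have "map (\<lambda>z. replicate (count_list (x # xs) z) z) (remdups xs)
        = map (\<lambda>z. replicate (count_list xs z) z) (remdups xs)"
      by (intro map_cong) auto
    moreover have "count_list xs x = 0" using False by (simp add: count_list_0_iff)
    ultimately have "concat (map (\<lambda>z. replicate (count_list (x # xs) z) z) (x # remdups xs)) = x # xs"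
      using Cons.IH[OF sorted] by (simp only: list.map concat.simps) simp
    then show ?thesis using False by (simp del: count_list.simps list.map)
  next
    case True
    then obtain y ys where ys: "remdups xs = y # ys" by (cases "remdups xs") auto
    have "sorted (y # ys)" "distinct (y # ys)" and set: "set (y # ys) = set xs"
      using sorted_remdups[OF sorted] distinct_remdups[of xs] ys by (metis set_remdups)+
    then have "y \<le> x" using True by auto
    moreover have "x \<le> y" using Cons.prems set by auto
    ultimately have [simp]: "y = x" by simp
    have "x \<notin> set ys" using \<open>distinct (y # ys)\<close> by simp
    then have "map (\<lambda>z. replicate (count_list (x # xs) z) z) ys
        = map (\<lambda>z. replicate (count_list xs z) z) ys"
      by (intro map_cong) auto
    then have "concat (map (\<lambda>z. replicate (count_list (x # xs) z) z) (y # ys)) = x # xs"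
      using Cons.IH[OF sorted] ys by (simp only: list.map concat.simps) simp
    then show ?thesis using True ys by (simp del: count_list.simps list.map)
  qed
qed simp

lemma count_list_replicate: "count_list (replicate m x) z = (if x = z then m else 0)"
  by (induction m) auto

lemma concat_replicate_props:
  fixes zs :: "real list"
  assumes "length ms = length zs" "sorted_wrt (<) zs" "\<forall>m\<in>set ms. m \<le> k"
  defines "xs \<equiv> concat (map2 replicate ms zs)"
  shows "sorted xs \<and> set xs \<subseteq> set zs \<and> (\<forall>z. count_list xs z \<le> k)"
  using assms(1-3) unfolding xs_def
proof (induction ms zs rule: list_induct2)
  case (Cons m ms z zs)
  let ?xs = "concat (map2 replicate ms zs)"
  have IH: "sorted ?xs" "set ?xs \<subseteq> set zs" "\<And>z. count_list ?xs z \<le> k"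
    using Cons by auto
  have zs: "\<forall>x\<in>set zs. z < x" using Cons.prems by simp
  then have z: "z \<notin> set ?xs" "\<forall>x\<in>set ?xs. z \<le> x"
    using subsetD[OF IH(2)] by (blast, meson less_imp_le)
  have "count_list (replicate m z @ ?xs) y \<le> k" for y
    using IH(3)[of y] z(1) Cons.prems by (cases "y = z") (auto simp: count_list_0_iff count_list_replicate)
  moreover have "sorted (replicate m z @ ?xs)" "set (replicate m z @ ?xs) \<subseteq> set (z # zs)"
    using IH(1,2) z(2) unfolding sorted_append set_append by auto
  ultimately show ?case by simp
qed simp

lemma count_list_run:
  assumes "sorted xs" "i + k < length xs" "xs ! i = z" "xs ! (i + k) = (z :: real)"
  shows "k < count_list xs z"
proof -
  have "xs ! j = z" if "i \<le> j" "j \<le> i + k" for j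
    using sorted_nth_mono[OF assms(1), of i j] sorted_nth_mono[OF assms(1), of j "i + k"] that assms(2-)
    by simp
  then have "{i..i + k} \<subseteq> {j. j < length xs \<and> z = xs ! j}" using assms(2) by auto
  then have "card {i..i + k} \<le> card {j. j < length xs \<and> z = xs ! j}" by (intro card_mono) auto
  then show ?thesis by (simp add: count_list_eq_length_filter length_filter_conv_card)
qed

lemma open_knot_vector_imp_open_knots:
  assumes "open_knot_vector q a b \<Xi>"
  shows "open_knots q a b \<Xi>"
proof -
  obtain ls zs ms rs where \<Xi>: "\<Xi> = ls @ concat (map2 replicate ms zs) @ rs"
    and len: "length ls = q + 1" "length rs = q + 1" "length ms = length zs"
    and lt: "sorted_wrt (<) (a # zs @ [b])" and ms: "\<forall>m\<in>set ms. 1 \<le> m \<and> m \<le> q + 1"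
    using assms by (auto simp: open_knot_vector_def basic_knot_vector_def)
  let ?xs = "concat (map2 replicate ms zs)"
  have ends: "set ls = {a}" "set rs = {b}"
    using assms len by (auto simp: open_knot_vector_def \<Xi> spline_dim_def)
  then have ls: "ls = replicate (q + 1) a" and rs: "rs = replicate (q + 1) b"
    using len by (metis replicate_length_same singletonD)+
  have xs: "sorted ?xs" "set ?xs \<subseteq> set zs" "\<And>z. count_list ?xs z \<le> q + 1"
    using concat_replicate_props[of ms zs "q + 1"] len lt ms by (auto simp: sorted_wrt_append)
  have ab: "a < b" "\<forall>x\<in>set ?xs. a < x \<and> x < b" using lt xs(2) by (auto simp: sorted_wrt_append)
  then have ends_xs: "a \<notin> set ?xs" "b \<notin> set ?xs" by auto
  have sorted: "sorted \<Xi>" unfolding \<Xi> using xs(1) ab ends by (auto simp: ls rs sorted_append)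
  have count: "count_list \<Xi> z \<le> q + 1" for z
  proof -
    have "count_list ?xs a = 0" "count_list ?xs b = 0" using ends_xs by (simp_all only: count_list_0_iff not_False_eq_True)
    then show ?thesis using xs(3)[of z] ab(1) unfolding \<Xi> ls rs count_list_append count_list_replicate
      by (cases "z = a"; cases "z = b") auto
  qed
  show ?thesis
  proof
    show "2 * (q + 1) \<le> length \<Xi>" using len by (simp add: \<Xi>)
    show "\<Xi> ! i = a" if "i \<le> q" for i using that by (simp add: \<Xi> ls nth_append del: replicate.simps)
    show "\<Xi> ! i = b" if "length \<Xi> - (q + 1) \<le> i" "i < length \<Xi>" for i
      using that by (simp add: \<Xi> ls rs nth_append del: replicate.simps) auto
    show "\<Xi> ! i < \<Xi> ! (i + q + 1)" if i: "i + q + 1 < length \<Xi>" for i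
    proof (rule ccontr)
      assume "\<not> \<Xi> ! i < \<Xi> ! (i + q + 1)"
      then have "\<Xi> ! (i + (q + 1)) = \<Xi> ! i" using sorted_nth_mono[OF sorted, of i "i + q + 1"] i by simp
      then show False using count_list_run[OF sorted, of i "q + 1" "\<Xi> ! i"] count[of "\<Xi> ! i"] i by simp
    qed
  qed (rule sorted)
qed

lemma (in open_knots) interior_knot_is_z:
  assumes "x \<in> set \<Xi>" "a < x" "x < b"
  shows "\<exists>j. 2 \<le> j \<and> j < N \<and> z j = x"
proof -
  obtain j where j: "1 \<le> j" "j \<le> N" "z j = x" using knot_is_z[OF assms(1)] by blast
  moreover have "j \<noteq> 1" "j \<noteq> N" using j z_ends assms by auto
  ultimately show ?thesis by (intro exI[of _ j]) simp
qed

text \<open>The way back to the definition by multiplicities, needed because the returned knot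
  vector is claimed to be open in that sense. The witnesses are recovered by removing duplicates
  from the middle block and counting in it.\<close>

lemma (in open_knots) open_knot_vector: "open_knot_vector q a b \<Xi>"
proof -
  define xs where "xs = take (n - (q + 1)) (drop (q + 1) \<Xi>)"
  define zs where "zs = remdups xs"
  define ms where "ms = map (count_list xs) zs"
  have first: "take (q + 1) \<Xi> = replicate (q + 1) a"
    using first_knots length_eq by (intro nth_equalityI) (auto simp del: replicate.simps)
  have last: "drop n \<Xi> = replicate (q + 1) b"
    using last_knots length_eq by (intro nth_equalityI) (auto simp del: replicate.simps)
  have "take (q + 1) \<Xi> @ xs @ drop n \<Xi> = \<Xi>"
    using append_take_drop_id[of "q + 1" \<Xi>] append_take_drop_id[of "n - (q + 1)" "drop (q + 1) \<Xi>"] dim_ge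
    by (simp add: xs_def)
  then have split: "\<Xi> = replicate (q + 1) a @ xs @ replicate (q + 1) b" unfolding first last ..
  have sorted: "sorted xs" unfolding xs_def by (intro sorted_wrt_take sorted_wrt_drop sorted_knots)
  have "map2 replicate ms zs = map (\<lambda>z. replicate (count_list xs z) z) zs"
    unfolding ms_def by (induction zs) auto
  then have xs: "xs = concat (map2 replicate ms zs)"
    using concat_replicate_remdups[OF sorted] by (simp add: zs_def)
  have inner: "x \<in> set \<Xi> \<and> a < x \<and> x < b" if "x \<in> set xs" for x
  proof -
    obtain i where i: "i < n - (q + 1)" "x = \<Xi> ! (q + 1 + i)"
    proof -
      obtain i where "i < length xs" "x = xs ! i" using \<open>x \<in> set xs\<close> by (auto simp: in_set_conv_nth)
      then show ?thesis using length_eq by (intro that[of i]) (simp_all add: xs_def)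
    qed
    then have "x = t (q + 2 + i)" using length_eq by (simp add: nth_eq_knot)
    then show ?thesis using a_less_t[of "q + 2 + i"] t_less_b[of "q + 2 + i"] t_in_knots i by simp
  qed
  have "sorted_wrt (<) zs" using sorted unfolding zs_def
    by (simp add: strict_sorted_iff sorted_remdups)
  then have lt: "sorted_wrt (<) (a # zs @ [b])"
    using inner a_less_b by (auto simp: sorted_wrt_append zs_def)
  have "1 \<le> count_list xs y \<and> count_list xs y \<le> q + 1" if y: "y \<in> set xs" for y
  proof -
    obtain j where j: "2 \<le> j" "j < N" "z j = y" using interior_knot_is_z inner[OF y] by blast
    have "count_list xs y \<le> count_list \<Xi> y" unfolding split count_list_append by simp
    also have "\<dots> \<le> q + 1" using knot_mult_bounds[OF j(1,2)] j by (simp add: knot_mult_def)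
    finally show ?thesis using y count_list_0_iff[of xs y] by linarith
  qed
  then have ms: "\<forall>m\<in>set ms. 1 \<le> m \<and> m \<le> q + 1" unfolding ms_def zs_def by auto
  have "basic_knot_vector q a b \<Xi>" unfolding basic_knot_vector_def
  proof (intro exI conjI)
    show "\<Xi> = replicate (q + 1) a @ concat (map2 replicate ms zs) @ replicate (q + 1) b"
      unfolding xs[symmetric] by (rule split)
    show "length ms = length zs" by (simp add: ms_def)
  qed (use lt ms in \<open>auto simp del: replicate.simps\<close>)
  then show ?thesis unfolding open_knot_vector_def first last by auto
qed

section \<open>Removing a knot and changing the multiplicity of the end knots\<close>

lemma knot_remove_knot:
  assumes "1 < i0" "i0 < length \<Xi>"
  shows "knot (remove_knot i0 \<Xi>) i = (if i < i0 then knot \<Xi> i else knot \<Xi> (Suc i))"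
proof -
  consider "i < i0" | "i0 \<le> i" "i < length \<Xi>" | "length \<Xi> \<le> i" by linarith
  then show ?thesis
  proof cases
    case 3
    have "remove_knot i0 \<Xi> ! (length \<Xi> - 2) = \<Xi> ! (length \<Xi> - 1)"
      using assms by (auto simp: remove_knot_def nth_append intro!: arg_cong[where f = "(!) \<Xi>"])
    moreover have "min (i - 1) (length (remove_knot i0 \<Xi>) - 1) = length \<Xi> - 2"
      "min (Suc i - 1) (length \<Xi> - 1) = length \<Xi> - 1" "\<not> i < i0"
      using 3 assms by (auto simp: remove_knot_def)
    ultimately show ?thesis unfolding knot_def by simp
  qed (use assms in \<open>auto simp: knot_def remove_knot_def nth_append min_def\<close>)
qed

lemma length_remove_knot:
  assumes "1 \<le> i0" "i0 \<le> length \<Xi>"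
  shows "length (remove_knot i0 \<Xi>) = length \<Xi> - 1"
  using assms by (simp add: remove_knot_def min_def)

lemma (in open_knots) open_knots_remove_knot:
  assumes "q + 2 \<le> i0" "i0 \<le> n"
  shows "open_knots q a b (remove_knot i0 \<Xi>)"
proof (rule open_knotsI)
  have len: "length (remove_knot i0 \<Xi>) = n + q"
    using length_remove_knot[of i0 \<Xi>] assms by (simp add: length_eq)
  have *: "knot (remove_knot i0 \<Xi>) i = (if i < i0 then t i else t (Suc i))" for i
    using assms length_eq by (intro knot_remove_knot) auto
  show "mono (knot (remove_knot i0 \<Xi>))" by (rule monoI) (auto simp: * intro!: t_le)
  show "2 * (q + 1) \<le> length (remove_knot i0 \<Xi>)" using assms by (simp add: len)
  show "knot (remove_knot i0 \<Xi>) i = a" if "1 \<le> i" "i \<le> q + 1" for i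
    using that assms t_first[of i] by (simp add: *)
  show "knot (remove_knot i0 \<Xi>) i = b" if "length (remove_knot i0 \<Xi>) - q \<le> i" for i
    using that assms t_last[of "Suc i"] by (auto simp: * len)
  show "knot (remove_knot i0 \<Xi>) i < knot (remove_knot i0 \<Xi>) (i + q + 1)"
    if "1 \<le> i" "i + q + 1 \<le> length (remove_knot i0 \<Xi>)" for i
  proof -
    have i: "i \<le> n - 1" using that len by simp
    \<comment> \<open>A distance of q + 1 positions after the removal is q + 1 or q + 2 before it,
      depending on whether the removed knot lies between.\<close>
    then have "t i < t (i + q + 1)" "t (Suc i) < t (i + q + 2)" "t (i + q + 1) \<le> t (i + q + 2)"
      using t_less[of i] t_less[of "Suc i"] that assms by (auto intro!: t_le)
    then show ?thesis by (simp add: *)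
  qed
qed

lemma knot_add_end_knots:
  assumes "\<Xi> \<noteq> []"
  shows "knot (add_end_knots \<Xi>) i = knot \<Xi> (i - 1)"
proof -
  have "length \<Xi> > 0" using assms by simp
  consider "i \<le> 1" | "2 \<le> i" "i \<le> length \<Xi> + 1" | "length \<Xi> + 1 < i" by linarith
  then show ?thesis
  proof cases
    case 1
    then show ?thesis using assms by (auto simp: knot_def add_end_knots_def hd_conv_nth)
  next
    case 2
    then obtain k where "i = Suc (Suc k)" "k < length \<Xi>" by (intro that[of "i - 2"]) auto
    then show ?thesis by (simp add: knot_def add_end_knots_def nth_append)
  next
    case 3
    then show ?thesis using \<open>length \<Xi> > 0\<close>
      by (simp add: knot_def add_end_knots_def nth_append min_def last_conv_nth)
  qed
qed

lemma length_add_end_knots [simp]: "length (add_end_knots \<Xi>) = length \<Xi> + 2"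
  by (simp add: add_end_knots_def)

lemma (in open_knots) open_knots_add_end_knots: "open_knots (Suc q) a b (add_end_knots \<Xi>)"
proof (rule open_knotsI)
  have *: "knot (add_end_knots \<Xi>) i = t (i - 1)" for i
    using length_eq by (intro knot_add_end_knots) auto
  show "mono (knot (add_end_knots \<Xi>))" by (rule monoI) (auto simp: * intro!: t_le)
  show "2 * (Suc q + 1) \<le> length (add_end_knots \<Xi>)" using length_knots by simp
  show "knot (add_end_knots \<Xi>) i = a" if "1 \<le> i" "i \<le> Suc q + 1" for i
    using that t_first[of "i - 1"] by (simp add: *)
  show "knot (add_end_knots \<Xi>) i = b" if "length (add_end_knots \<Xi>) - Suc q \<le> i" for i
    using that t_last[of "i - 1"] length_eq by (simp add: *)
  show "knot (add_end_knots \<Xi>) i < knot (add_end_knots \<Xi>) (i + Suc q + 1)"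
    if i: "1 \<le> i" "i + Suc q + 1 \<le> length (add_end_knots \<Xi>)" for i
  proof -
    have "t (i - 1) \<le> t i" "t i \<le> t (i + q + 1)" by (auto intro: t_le)
    moreover have "t (i - 1) < t (i + q)" if "1 < i"
      using t_less[of "i - 1"] i length_eq that by simp
    moreover have "t (i + q) \<le> t (i + q + 1)" by (auto intro: t_le)
    \<comment> \<open>Index 1 is separate: its knot is the added copy of a, the clamped
      \<open>t 0\<close>.\<close>
    moreover have "t 0 < t (q + 2)" using t_first[of 0] a_less_t[of "q + 2"] by simp
    ultimately show ?thesis using i by (cases "i = 1") (simp_all add: *)
  qed
qed

lemma add_drop_end_knots:
  assumes "open_knots (Suc q) a b \<Xi>"
  shows "add_end_knots (drop_end_knots \<Xi>) = \<Xi>"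
proof -
  interpret open_knots "Suc q" a b \<Xi> by fact
  have len: "4 \<le> length \<Xi>" using length_knots by simp
  let ?Y = "butlast (tl \<Xi>)"
  have "\<Xi> \<noteq> []" "tl \<Xi> \<noteq> []" "?Y \<noteq> []" using len by (auto simp flip: length_0_conv)
  then have "\<Xi> = hd \<Xi> # ?Y @ [last \<Xi>]"
    by (metis append_butlast_last_id last_tl list.collapse)
  moreover have "hd \<Xi> = a" "hd ?Y = a"
    using first_knots[of 0] first_knots[of 1] \<open>\<Xi> \<noteq> []\<close> \<open>?Y \<noteq> []\<close> len
    by (simp_all add: hd_conv_nth nth_butlast nth_tl)
  moreover have "last \<Xi> = b" "last ?Y = b"
    using last_knots[of "length \<Xi> - 1"] last_knots[of "length \<Xi> - 2"] \<open>\<Xi> \<noteq> []\<close> \<open>?Y \<noteq> []\<close> len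
    by (simp_all add: last_conv_nth nth_butlast nth_tl numeral_2_eq_2 Suc_diff_Suc)
  ultimately show ?thesis by (simp add: drop_end_knots_def add_end_knots_def)
qed

text \<open>Equality would produce m + 1 copies of a breakpoint, at the positions i to i + m. The
  bounds on i and m make sure that this breakpoint is interior.\<close>

lemma (in open_knots) t_less_of_mult:
  assumes "\<forall>j\<in>{2..<N}. knot_mult q \<Xi> j \<le> m" "2 \<le> i" "i \<le> n" "q \<le> m"
  shows "t i < t (i + m)"
proof (rule ccontr)
  assume "\<not> t i < t (i + m)"
  then have eq: "t i = t (i + m)" using t_le[of i "i + m"] by simp
  have "a < t i" using a_less_t[of "i + m"] assms eq by simp
  moreover have b: "t i < b" using t_less_b assms by simp
  ultimately obtain j where j: "2 \<le> j" "j < N" "z j = t i" using interior_knot_is_z[OF t_in_knots] by blast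
  define k where "k = j - 1"
  have k: "j = Suc k" "1 \<le> k" "k < N" using j by (auto simp: k_def)
  have im: "i + m \<le> n" using t_last[of "i + m"] b eq by (cases "i + m \<le> n") auto
  have "i + m \<le> knots_upto \<Xi> (z j)" using t_le_iff[of "i + m" "z j"] im eq j assms by simp
  moreover have "\<not> i \<le> knots_upto \<Xi> (z k)"
    using t_le_iff[of i "z k"] z_less[of k j] im j k assms by simp
  moreover have "knot_mult q \<Xi> j \<le> m" using assms(1) j by auto
  ultimately show False using knots_upto_Suc[of k] j k by simp
qed

text \<open>The point where the bound p on interior multiplicities is used: p = q + 1 is the largest
  multiplicity that degree q admits.\<close>

lemma open_knots_drop_end_knots:
  assumes "open_knots (Suc q) a b \<Xi>"
    and "\<forall>j\<in>{2..<num_breakpoints (Suc q) \<Xi>}. knot_mult (Suc q) \<Xi> j \<le> Suc q"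
  shows "open_knots q a b (drop_end_knots \<Xi>)"
proof -
  interpret open_knots "Suc q" a b \<Xi> by fact
  let ?Y = "drop_end_knots \<Xi>"
  have len: "length \<Xi> = length ?Y + 2"
    using arg_cong[OF add_drop_end_knots[OF assms(1)], of length] by simp
  have "?Y \<noteq> []" using len length_knots by auto
  then have "t (Suc i) = knot ?Y i" for i
    using knot_add_end_knots[of ?Y "Suc i"] add_drop_end_knots[OF assms(1)] by simp
  then have *: "knot ?Y i = t (Suc i)" for i by simp
  show ?thesis
  proof (rule open_knotsI)
    show "mono (knot ?Y)" by (rule monoI) (auto simp: * intro!: t_le)
    show "2 * (q + 1) \<le> length ?Y" using len length_knots by simp
    show "knot ?Y i = a" if "i \<le> q + 1" for i using that t_first[of "Suc i"] by (simp add: *)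
    show "knot ?Y i = b" if "length ?Y - q \<le> i" for i
      using that t_last[of "Suc i"] len length_eq by (simp add: *)
    show "knot ?Y i < knot ?Y (i + q + 1)" if "1 \<le> i" "i + q + 1 \<le> length ?Y" for i
      using that t_less_of_mult[OF assms(2), of "Suc i"] len length_eq by (simp add: *)
  qed
qed

text \<open>Converse of \<open>t_less_of_mult\<close>; it supplies the continuity of antiderivatives
  at interior knots.\<close>

lemma (in open_knots) knot_mult_le:
  assumes "\<And>i. 2 \<le> i \<Longrightarrow> i \<le> n \<Longrightarrow> t i < t (i + m)" "2 \<le> j" "j < N"
  shows "knot_mult q \<Xi> j \<le> m"
proof (rule ccontr)
  assume *: "\<not> knot_mult q \<Xi> j \<le> m"
  define k where "k = j - 1"
  have k: "j = Suc k" "1 \<le> k" "k < N" using assms by (auto simp: k_def)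
  define i where "i = Suc (knots_upto \<Xi> (z k))"
  have 1: "q + 2 \<le> i" "t i = z j" using z_knots_upto[of k] k by (auto simp: i_def)
  have 2: "knots_upto \<Xi> (z j) \<le> n" "t (knots_upto \<Xi> (z j)) = z j" using z_knots_upto[of j] assms by auto
  have le: "i + m \<le> knots_upto \<Xi> (z j)" using knots_upto_Suc[of k] k assms * by (simp add: i_def)
  show False using assms(1)[of i] t_le[OF le] 1 2 le by simp
qed

section \<open>The B-splines span the spline space\<close>

lemma dvd_of_pderiv_zeros:
  fixes R :: "real poly"
  assumes "\<And>r. r \<le> k \<Longrightarrow> poly ((pderiv ^^ r) R) x = 0"
  shows "[:-x, 1:] ^ Suc k dvd R"
  using assms
proof (induction k arbitrary: R)
  case 0
  then show ?case using 0[of 0] by (simp add: poly_eq_0_iff_dvd)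
next
  case (Suc k)
  show ?case
  proof (cases "R = 0")
    case False
    have 0: "poly R x = 0" using Suc.prems[of 0] by simp
    have "poly ((pderiv ^^ r) (pderiv R)) x = 0" if "r \<le> k" for r
      using Suc.prems[of "Suc r"] that by (simp add: funpow_swap1)
    then have dvd: "[:-x, 1:] ^ Suc k dvd pderiv R" by (rule Suc.IH)
    have "pderiv R \<noteq> 0"
    proof
      assume "pderiv R = 0"
      then have "degree R = 0" by (simp add: pderiv_eq_0_iff)
      then obtain c where "R = [:c:]" by (metis degree_0_id)
      then show False using 0 False by simp
    qed
    then have "Suc k \<le> order x (pderiv R)" using dvd by (simp add: order_divides del: power_Suc)
    then have "Suc (Suc k) \<le> order x R" using order_pderiv[OF False 0] by simp
    then show ?thesis by (simp add: order_divides del: power_Suc)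
  qed simp
qed

lemma pderiv_dvd:
  fixes R :: "real poly"
  assumes "[:-x, 1:] ^ k dvd R"
  shows "[:-x, 1:] ^ (k - r) dvd (pderiv ^^ r) R"
proof (induction r)
  case (Suc r)
  show ?case
  proof (cases "k - r")
    case (Suc j)
    then obtain S where S: "(pderiv ^^ r) R = [:-x, 1:] ^ Suc j * S" using Suc.IH by (auto elim: dvdE)
    have "[:-x, 1:] ^ j dvd pderiv ((pderiv ^^ r) R)"
      unfolding S lemma_order_pderiv1
      by (intro dvd_add dvd_smult dvd_mult[OF dvd_refl] dvd_mult2) (simp add: le_imp_power_dvd del: power_Suc)
    then show ?thesis using Suc by (simp add: diff_Suc)
  qed simp
qed (use assms in simp)

lemma isCont_half:
  fixes S :: "real poly"
  assumes "poly S x = 0"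
  shows "isCont (\<lambda>y. if y < x then 0 else poly S y) y"
proof -
  have "(\<lambda>y. if y < x then 0 else poly S y) = (\<lambda>y. poly S (max y x))"
    using assms by (auto simp: max_def fun_eq_iff)
  moreover have "isCont (\<lambda>y. poly S (max y x)) y" by (intro continuous_intros)
  ultimately show ?thesis by simp
qed

text \<open>Only y = x needs an argument. There R y = (y - x) S y with S x = 0, and the truncation
  of S is a continuous difference quotient, so Caratheodory's criterion gives the derivative
  0.\<close>

lemma DERIV_half:
  fixes R :: "real poly"
  assumes "[:-x, 1:] ^ 2 dvd R"
  shows "((\<lambda>y. if y < x then 0 else poly R y) has_real_derivative
    (if y < x then 0 else poly (pderiv R) y)) (at y)"
proof (cases y x rule: linorder_cases)
  case less
  have "((\<lambda>y. 0) has_real_derivative 0) (at y)" by simp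
  then have "((\<lambda>y. if y < x then 0 else poly R y) has_real_derivative 0) (at y)"
    by (rule has_field_derivative_transform_within_open[where S = "{..<x}"]) (use less in auto)
  then show ?thesis using less by simp
next
  case greater
  have "(poly R has_real_derivative poly (pderiv R) y) (at y)" by (rule poly_DERIV)
  then have "((\<lambda>y. if y < x then 0 else poly R y) has_real_derivative poly (pderiv R) y) (at y)"
    by (rule has_field_derivative_transform_within_open[where S = "{x<..}"]) (use greater in auto)
  then show ?thesis using greater by simp
next
  case equal
  obtain T where T: "R = [:-x, 1:] ^ 2 * T" using assms by (auto elim: dvdE)
  define S where "S = [:-x, 1:] * T"
  have R: "R = [:-x, 1:] * S" by (simp only: T S_def power2_eq_square mult.assoc)
  have S: "poly S x = 0" by (simp add: S_def)
  have "poly (pderiv R) x = 0" unfolding R pderiv_mult by (simp add: S)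
  moreover have "((\<lambda>y. if y < x then 0 else poly R y) has_real_derivative 0) (at x)"
    unfolding CARAT_DERIV using isCont_half[OF S, of x] S
    by (intro exI[of _ "\<lambda>y. if y < x then 0 else poly S y"]) (auto simp: R algebra_simps)
  ultimately show ?thesis using equal by simp
qed

text \<open>Near x, f is P plus the truncation of R = Q - P to the right of x. The truncation can be
  differentiated as long as a double zero is left, and the last derivative is continuous because a
  simple zero is left.\<close>

lemma dvd_imp_continuously_differentiable:
  assumes "[:-x, 1:] ^ Suc k dvd Q - P" "e > 0"
    and "\<And>y. x - e < y \<Longrightarrow> y < x \<Longrightarrow> f y = poly P y"
    and "\<And>y. x \<le> y \<Longrightarrow> y < x + e \<Longrightarrow> f y = poly Q y"
  shows "continuously_differentiable_at k f x"
proof -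
  define R where "R = Q - P"
  define D where "D r y = poly ((pderiv ^^ r) P) y + (if y < x then 0 else poly ((pderiv ^^ r) R) y)" for r y
  have dvd: "[:-x, 1:] ^ (Suc k - r) dvd (pderiv ^^ r) R" for r
    using pderiv_dvd[of x "Suc k" R r] assms(1) by (simp add: R_def)
  have "D 0 y = f y" if "y \<in> ball x e" for y
    using that assms(3,4)[of y] by (auto simp: D_def R_def dist_real_def)
  moreover have "(D r has_real_derivative D (Suc r) y) (at y)" if "r < k" for r y
  proof -
    have "[:-x, 1:] ^ 2 dvd (pderiv ^^ r) R" by (rule power_le_dvd[OF dvd]) (use that in simp)
    then show ?thesis unfolding D_def funpow.simps o_apply
      by (intro DERIV_add poly_DERIV DERIV_half)
  qed
  moreover have "isCont (D k) x"
  proof -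
    have "poly ((pderiv ^^ k) R) x = 0" using dvd[of k] by (simp add: poly_eq_0_iff_dvd)
    then show ?thesis unfolding D_def by (intro continuous_intros isCont_half) auto
  qed
  ultimately show ?thesis unfolding continuously_differentiable_at_def using assms(2) by blast
qed

text \<open>The functions D r coincide with derivatives of P on the left of x and of Q on the right.
  Continuity of D r at x makes both one-sided limits equal, so every derivative of Q - P up to order
  k vanishes there.\<close>

lemma continuously_differentiable_imp_dvd:
  assumes "continuously_differentiable_at k f x" "e > 0"
    and P: "\<And>y. x - e < y \<Longrightarrow> y < x \<Longrightarrow> f y = poly P y"
    and Q: "\<And>y. x \<le> y \<Longrightarrow> y < x + e \<Longrightarrow> f y = poly Q y"
  shows "[:-x, 1:] ^ Suc k dvd Q - P"
proof -
  obtain d D where d: "d > 0" and D0: "\<And>y. y \<in> ball x d \<Longrightarrow> D 0 y = f y"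
    and D: "\<And>r y. r < k \<Longrightarrow> y \<in> ball x d \<Longrightarrow> (D r has_real_derivative D (Suc r) y) (at y)"
    and cont: "isCont (D k) x"
    using assms(1) unfolding continuously_differentiable_at_def by metis
  define h where "h = min d e"
  have h: "h > 0" using d assms(2) by (simp add: h_def)
  have in_ball: "y \<in> ball x d" if "x - h < y" "y < x + h" for y
    using that by (auto simp: dist_real_def h_def)
  have left: "D r y = poly ((pderiv ^^ r) P) y" if "r \<le> k" "y \<in> {x - h<..<x}" for r y
    using that
  proof (induction r arbitrary: y)
    case 0
    then show ?case using D0[of y] in_ball[of y] P[of y] by (auto simp: h_def min_def split: if_splits)
  next
    case (Suc r)
    have 1: "(D r has_real_derivative D (Suc r) y) (at y)" using Suc.prems in_ball[of y] by (intro D) auto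
    have "(D r has_real_derivative poly (pderiv ((pderiv ^^ r) P)) y) (at y)"
      using poly_DERIV
      by (rule has_field_derivative_transform_within_open[where S = "{x - h<..<x}"])
        (use Suc in auto)
    then show ?case using DERIV_unique[OF 1] by simp
  qed
  have right: "D r y = poly ((pderiv ^^ r) Q) y" if "r \<le> k" "y \<in> {x<..<x + h}" for r y
    using that
  proof (induction r arbitrary: y)
    case 0
    then show ?case using D0[of y] in_ball[of y] Q[of y] by (auto simp: h_def min_def split: if_splits)
  next
    case (Suc r)
    have 1: "(D r has_real_derivative D (Suc r) y) (at y)" using Suc.prems in_ball[of y] by (intro D) auto
    have "(D r has_real_derivative poly (pderiv ((pderiv ^^ r) Q)) y) (at y)"
      using poly_DERIV
      by (rule has_field_derivative_transform_within_open[where S = "{x<..<x + h}"])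
        (use Suc in auto)
    then show ?case using DERIV_unique[OF 1] by simp
  qed
  have higher: "(pderiv ^^ r) (Q - P) = (pderiv ^^ r) Q - (pderiv ^^ r) P" for r
    by (induction r) (simp_all add: pderiv_diff)
  have "poly ((pderiv ^^ r) (Q - P)) x = 0" if r: "r \<le> k" for r
  proof -
    have "isCont (D r) x"
      using cont D[of r x] d r by (cases "r = k") (auto intro: DERIV_isCont)
    then have lim: "(D r \<longlongrightarrow> D r x) (at_left x)" "(D r \<longlongrightarrow> D r x) (at_right x)"
      unfolding isCont_def by (auto intro: tendsto_within_subset)
    have "(poly ((pderiv ^^ r) P) \<longlongrightarrow> D r x) (at_left x)"
      by (rule Lim_transform_eventually[OF lim(1)], rule eventually_at_leftI[of "x - h"])
        (use left r h in auto)
    moreover have "(poly ((pderiv ^^ r) P) \<longlongrightarrow> poly ((pderiv ^^ r) P) x) (at_left x)"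
      by (intro tendsto_intros)
    ultimately have l: "D r x = poly ((pderiv ^^ r) P) x" by (rule tendsto_unique[rotated]) simp
    have "(poly ((pderiv ^^ r) Q) \<longlongrightarrow> D r x) (at_right x)"
      by (rule Lim_transform_eventually[OF lim(2)], rule eventually_at_rightI[of _ "x + h"])
        (use right r h in auto)
    moreover have "(poly ((pderiv ^^ r) Q) \<longlongrightarrow> poly ((pderiv ^^ r) Q) x) (at_right x)"
      by (intro tendsto_intros)
    ultimately have "D r x = poly ((pderiv ^^ r) Q) x" by (rule tendsto_unique[rotated]) simp
    then show ?thesis using l by (simp add: higher)
  qed
  then show ?thesis by (rule dvd_of_pderiv_zeros)
qed

section \<open>The spline space as families of joined polynomial pieces\<close>

context open_knots
begin

definition piecewise :: "(real \<Rightarrow> real) \<Rightarrow> (nat \<Rightarrow> real poly) \<Rightarrow> bool" where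
  "piecewise f P \<longleftrightarrow> (\<forall>\<mu>. degree (P \<mu>) \<le> q) \<and> (\<forall>\<mu> x. piece \<mu> x \<longrightarrow> f x = poly (P \<mu>) x)"

text \<open>The order of contact is q + 1 minus the multiplicity \<nu> - \<mu> of the common knot;
  for multiplicity q + 1 the condition is void.\<close>

definition joined :: "(nat \<Rightarrow> real poly) \<Rightarrow> bool" where
  "joined P \<longleftrightarrow> (\<forall>\<mu> \<nu>. q + 1 \<le> \<mu> \<and> \<mu> < \<nu> \<and> \<nu> \<le> n \<and> t \<mu> < t (Suc \<mu>) \<and> t (Suc \<mu>) = t \<nu> \<and> t \<nu> < t (Suc \<nu>)
     \<longrightarrow> [:- t \<nu>, 1:] ^ (q + 1 - (\<nu> - \<mu>)) dvd P \<nu> - P \<mu>)"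

lemma piecewise_spline_of: "piecewise (spline_of q \<Xi> c) (\<lambda>\<mu>. local_poly t \<mu> q (ith c))"
  unfolding piecewise_def by (simp add: degree_local_poly spline_of_piece)

lemma joined_local_poly: "joined (\<lambda>\<mu>. local_poly t \<mu> q c)"
  unfolding joined_def by (intro allI impI local_poly_join[OF mono_t]) auto

text \<open>Both intervals lie in the support of the i-th B-spline, so every knot passed on the way
  from one to the other is in the window with all its copies. Going left one nonempty interval at a
  time, \<open>blossom_window_join\<close> keeps the value.\<close>

lemma joined_blossom:
  assumes "joined P" "\<And>\<mu>. degree (P \<mu>) \<le> q"
    and "q + 1 \<le> \<mu>" "t \<mu> < t (Suc \<mu>)" "i \<le> \<mu>" "\<mu> \<le> \<nu>" "\<nu> \<le> n" "t \<nu> < t (Suc \<nu>)" "\<nu> \<le> i + q"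
  shows "blossom (P \<nu>) (window t q i) = blossom (P \<mu>) (window t q i)"
  using assms(6-9)
proof (induction \<nu> rule: less_induct)
  case (less \<nu>)
  show ?case
  proof (cases "\<mu> = \<nu>")
    case False
    \<comment> \<open>The largest index in K starts the nearest nonempty interval to the left of
      \<nu>.\<close>
    define K where "K = {k. k < \<nu> \<and> t k < t \<nu>}"
    define \<kappa> where "\<kappa> = Max K"
    have K: "finite K" "\<mu> \<in> K"
      using False less.prems assms(4) t_le[of "Suc \<mu>" \<nu>] by (auto simp: K_def)
    then have "\<kappa> \<in> K" "\<mu> \<le> \<kappa>" unfolding \<kappa>_def by (blast intro: Max_in, simp)
    then have \<kappa>: "\<kappa> < \<nu>" "t \<kappa> < t \<nu>" "\<mu> \<le> \<kappa>" by (auto simp: K_def)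
    have "Suc \<kappa> \<notin> K" using Max_ge[OF K(1), of "Suc \<kappa>"] by (auto simp: \<kappa>_def)
    then have Suc: "t (Suc \<kappa>) = t \<nu>"
      using \<kappa> t_le[of "Suc \<kappa>" \<nu>] by (cases "Suc \<kappa> = \<nu>") (auto simp: K_def)
    have "blossom (P \<nu> - P \<kappa>) (window t q i) = 0"
    proof (rule blossom_window_join[OF mono_t \<kappa>(1) Suc])
      show "[:- t \<nu>, 1:] ^ (q + 1 - (\<nu> - \<kappa>)) dvd P \<nu> - P \<kappa>"
        using assms(1,3) \<kappa> Suc less.prems unfolding joined_def by auto
    qed (use assms less.prems \<kappa> in \<open>auto intro: degree_diff_le\<close>)
    moreover have "blossom (P \<kappa>) (window t q i) = blossom (P \<mu>) (window t q i)"
      using less.prems \<kappa> Suc by (intro less.IH) auto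
    ultimately show ?thesis by (simp add: blossom_diff)
  qed simp
qed

lemma spline_of_exists:
  assumes "piecewise f P" "joined P"
  shows "\<exists>c. length c = n \<and> (\<forall>x\<in>{a..b}. f x = spline_of q \<Xi> c x)"
proof -
  \<comment> \<open>Coefficient i is read off the nonempty interval that begins at the value t i; by
    \<open>joined_blossom\<close> any other interval in the support gives the same.\<close>
  define c where "c i = blossom (P (knots_upto \<Xi> (t i))) (window t q i)" for i
  define cs where "cs = map c [1..<Suc n]"
  have ith: "ith cs i = c i" if "1 \<le> i" "i \<le> n" for i
    using that by (simp add: cs_def del: upt_Suc)
  have coeff: "blossom (P \<nu>) (window t q i) = c i"
    if "q + 1 \<le> \<nu>" "\<nu> \<le> n" "t \<nu> < t (Suc \<nu>)" "\<nu> - q \<le> i" "i \<le> \<nu>" for \<nu> i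
  proof -
    have i: "1 \<le> i" "i \<le> n" using that by auto
    then have ti: "a \<le> t i" "t i < b" using a_le_t t_less_b by auto
    define \<mu> where "\<mu> = knots_upto \<Xi> (t i)"
    have \<mu>: "q + 1 \<le> \<mu>" "\<mu> \<le> n" "t \<mu> \<le> t i" "t i < t (Suc \<mu>)"
      using knots_upto_bounds[OF ti] by (auto simp: \<mu>_def)
    have "i \<le> \<mu>" using t_le_iff[of i "t i"] i by (simp add: \<mu>_def)
    moreover have "\<mu> \<le> \<nu>" using \<mu> that t_le[of i \<nu>] t_le[of "Suc \<nu>" \<mu>] by (cases "\<mu> \<le> \<nu>") auto
    ultimately have "blossom (P \<nu>) (window t q i) = blossom (P \<mu>) (window t q i)"
      using assms that \<mu> by (intro joined_blossom) (auto simp: piecewise_def)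
    then show ?thesis by (simp add: c_def \<mu>_def)
  qed
  have "f x = spline_of q \<Xi> cs x" if x: "x \<in> {a..b}" for x
  proof -
    obtain \<nu> where \<nu>: "piece \<nu> x" using ex_piece x by auto
    then have *: "q + 1 \<le> \<nu>" "\<nu> \<le> n" "t \<nu> < t (Suc \<nu>)" by (auto simp: piece_def)
    have "P \<nu> = local_poly t \<nu> q (ith cs)"
    proof (rule local_poly_unique[OF mono_t *(3)])
      show "blossom (P \<nu>) (window t q i) = ith cs i" if "\<nu> - q \<le> i" "i \<le> \<nu>" for i
        using coeff[OF *, of i] ith[of i] that * by simp
    qed (use * assms(1) in \<open>auto simp: piecewise_def\<close>)
    then show ?thesis using assms(1) \<nu> by (simp add: piecewise_def spline_of_piece)
  qed
  moreover have "length cs = n" by (simp add: cs_def)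
  ultimately show ?thesis by blast
qed

lemma valid_interval:
  assumes "q + 1 \<le> \<mu>" "\<mu> \<le> n" "t \<mu> < t (Suc \<mu>)"
  obtains j where "1 \<le> j" "j < N" "knots_upto \<Xi> (z j) = \<mu>" "z j = t \<mu>" "z (Suc j) = t (Suc \<mu>)"
  using interval_is_z[OF assms] z_knots_upto by metis

lemma piece_iff:
  assumes "1 \<le> j" "j < N"
  shows "piece (knots_upto \<Xi> (z j)) x \<longleftrightarrow> z j \<le> x \<and> (x < z (j + 1) \<or> x = right_end q \<Xi> \<and> j + 1 = N)"
proof -
  have "z (Suc j) = b \<longleftrightarrow> j + 1 = N"
    using z_ends z_less[of "Suc j" N] assms by (cases "Suc j = N") auto
  then show ?thesis
    unfolding piece_def using z_knots_upto[OF assms] z_less[of j "Suc j"] assms by (simp add: right_end_eq)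
qed

lemma adjacent_interval:
  assumes "2 \<le> j" "j < N"
  defines "\<mu> \<equiv> knots_upto \<Xi> (z (j - 1))" and "\<nu> \<equiv> knots_upto \<Xi> (z j)"
  shows "q + 1 \<le> \<mu>" "\<mu> < \<nu>" "\<nu> \<le> n" "t \<mu> < t (Suc \<mu>)" "t (Suc \<mu>) = t \<nu>" "t \<nu> < t (Suc \<nu>)"
    "t \<nu> = z j" "\<nu> - \<mu> = knot_mult q \<Xi> j"
proof -
  define k where "k = j - 1"
  have k: "j = Suc k" "1 \<le> k" "k < N" using assms(1,2) by (auto simp: k_def)
  note \<mu> = z_knots_upto[OF k(2,3), folded k(1)] and \<nu> = z_knots_upto[of j]
  have lt: "z k < z j" "z j < z (Suc j)" using z_less[of k j] z_less[of j "Suc j"] k assms(1,2) by auto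
  show "q + 1 \<le> \<mu>" "\<nu> \<le> n" "t \<mu> < t (Suc \<mu>)" "t (Suc \<mu>) = t \<nu>" "t \<nu> < t (Suc \<nu>)" "t \<nu> = z j"
    using \<mu> \<nu> lt assms(1,2) unfolding \<mu>_def \<nu>_def k_def[symmetric] by auto
  have "\<nu> = \<mu> + knot_mult q \<Xi> j"
    using knots_upto_Suc[of k] k assms(2) unfolding \<mu>_def \<nu>_def k_def[symmetric] by simp
  then show "\<mu> < \<nu>" "\<nu> - \<mu> = knot_mult q \<Xi> j" using knot_mult_bounds[OF assms(1,2)] by auto
qed

lemma spline_spaceI:
  assumes "piecewise f P" "joined P"
  shows "f \<in> spline_space q \<Xi>"
  unfolding spline_space_def
proof (intro CollectI conjI ballI impI)
  fix j assume j: "j \<in> {1..<N}"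
  show "\<exists>P. degree P \<le> q \<and> (\<forall>x. z j \<le> x \<and> (x < z (j + 1) \<or> x = right_end q \<Xi> \<and> j + 1 = N) \<longrightarrow> f x = poly P x)"
    using assms(1) j piece_iff[of j] unfolding piecewise_def
    by (intro exI[of _ "P (knots_upto \<Xi> (z j))"] conjI allI impI) simp_all
next
  fix j assume "j \<in> {2..<N}" and mult: "knot_mult q \<Xi> j \<le> q"
  then have j: "2 \<le> j" "j < N" by auto
  define \<mu> \<nu> where "\<mu> = knots_upto \<Xi> (z (j - 1))" and "\<nu> = knots_upto \<Xi> (z j)"
  note A = adjacent_interval[OF j, folded \<mu>_def \<nu>_def]
  define e where "e = min (t (Suc \<mu>) - t \<mu>) (t (Suc \<nu>) - t \<nu>)"
  have e: "e \<le> t (Suc \<mu>) - t \<mu>" "e \<le> t (Suc \<nu>) - t \<nu>" by (simp_all add: e_def)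
  have "continuously_differentiable_at (q - knot_mult q \<Xi> j) f (t \<nu>)"
  proof (rule dvd_imp_continuously_differentiable)
    have "Suc (q - knot_mult q \<Xi> j) = q + 1 - (\<nu> - \<mu>)" using A mult by simp
    moreover have "[:- t \<nu>, 1:] ^ (q + 1 - (\<nu> - \<mu>)) dvd P \<nu> - P \<mu>"
      using assms(2) A unfolding joined_def by blast
    ultimately show "[:- t \<nu>, 1:] ^ Suc (q - knot_mult q \<Xi> j) dvd P \<nu> - P \<mu>" by simp
    show "e > 0" using A by (simp add: e_def)
    show "f y = poly (P \<mu>) y" if "t \<nu> - e < y" "y < t \<nu>" for y
    proof -
      have "piece \<mu> y" unfolding piece_def using that A(1-6) e by linarith
      then show ?thesis using assms(1) by (simp add: piecewise_def)
    qed
    show "f y = poly (P \<nu>) y" if "t \<nu> \<le> y" "y < t \<nu> + e" for y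
    proof -
      have "piece \<nu> y" unfolding piece_def using that A(1-6) e by linarith
      then show ?thesis using assms(1) by (simp add: piecewise_def)
    qed
  qed
  then show "continuously_differentiable_at (q - knot_mult q \<Xi> j) f (z j)" using A by simp
qed

lemma spline_spaceD:
  assumes "f \<in> spline_space q \<Xi>"
  shows "\<exists>P. piecewise f P \<and> joined P"
proof -
  have "\<exists>P. degree P \<le> q \<and> (\<forall>x. piece \<mu> x \<longrightarrow> f x = poly P x)" for \<mu>
  proof (cases "q + 1 \<le> \<mu> \<and> \<mu> \<le> n \<and> t \<mu> < t (Suc \<mu>)")
    case True
    then obtain j where j: "1 \<le> j" "j < N" "knots_upto \<Xi> (z j) = \<mu>" using valid_interval[of \<mu>] by blast
    then have "j \<in> {1..<N}" by simp
    then obtain P where "degree P \<le> q"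
        "\<forall>x. z j \<le> x \<and> (x < z (j + 1) \<or> x = right_end q \<Xi> \<and> j + 1 = N) \<longrightarrow> f x = poly P x"
      using assms unfolding spline_space_def mem_Collect_eq by blast
    then show ?thesis using piece_iff[OF j(1,2)] j(3) by blast
  qed (auto simp: piece_def intro!: exI[of _ 0])
  then obtain P where P: "\<And>\<mu>. degree (P \<mu>) \<le> q" "\<And>\<mu> x. piece \<mu> x \<Longrightarrow> f x = poly (P \<mu>) x" by metis
  have "joined P" unfolding joined_def
  proof (intro allI impI)
    fix \<mu> \<nu>
    assume H: "q + 1 \<le> \<mu> \<and> \<mu> < \<nu> \<and> \<nu> \<le> n \<and> t \<mu> < t (Suc \<mu>) \<and> t (Suc \<mu>) = t \<nu> \<and> t \<nu> < t (Suc \<nu>)"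
    obtain i where i: "1 \<le> i" "i < N" "knots_upto \<Xi> (z i) = \<mu>" "z i = t \<mu>" "z (Suc i) = t (Suc \<mu>)"
      using valid_interval[of \<mu>] H by auto
    obtain j where j: "1 \<le> j" "j < N" "knots_upto \<Xi> (z j) = \<nu>" "z j = t \<nu>"
      using valid_interval[of \<nu>] H by auto
    have "j = Suc i" using z_inj[of j "Suc i"] i j H by simp
    then have j2: "2 \<le> j" "i = j - 1" using i by auto
    have m: "\<nu> - \<mu> = knot_mult q \<Xi> j"
      using adjacent_interval(8)[OF j2(1) j(2)] i(3) j(3) j2(2) by simp
    show "[:- t \<nu>, 1:] ^ (q + 1 - (\<nu> - \<mu>)) dvd P \<nu> - P \<mu>"
    proof (cases "knot_mult q \<Xi> j \<le> q")
      case True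
      define e where "e = min (t (Suc \<mu>) - t \<mu>) (t (Suc \<nu>) - t \<nu>)"
  have e: "e \<le> t (Suc \<mu>) - t \<mu>" "e \<le> t (Suc \<nu>) - t \<nu>" by (simp_all add: e_def)
      have "[:- t \<nu>, 1:] ^ Suc (q - knot_mult q \<Xi> j) dvd P \<nu> - P \<mu>"
      proof (rule continuously_differentiable_imp_dvd)
        show "continuously_differentiable_at (q - knot_mult q \<Xi> j) f (t \<nu>)"
          using assms True j2(1) j(2) unfolding j(4)[symmetric] spline_space_def by auto
        show "e > 0" using H by (simp add: e_def)
        show "f y = poly (P \<mu>) y" if "t \<nu> - e < y" "y < t \<nu>" for y
        proof (rule P)
          show "piece \<mu> y" unfolding piece_def using that H e by linarith
        qed
        show "f y = poly (P \<nu>) y" if "t \<nu> \<le> y" "y < t \<nu> + e" for y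
        proof (rule P)
          show "piece \<nu> y" unfolding piece_def using that H e by linarith
        qed
      qed
      moreover have "Suc (q - knot_mult q \<Xi> j) = q + 1 - (\<nu> - \<mu>)" using m True by simp
      ultimately show ?thesis by simp
    next
      case False
      \<comment> \<open>Multiplicity q + 1 demands no smoothness, and the divisor is the constant
        1.\<close>
      then have "q + 1 - (\<nu> - \<mu>) = 0" using m False by simp
      then show ?thesis by simp
    qed
  qed
  then show ?thesis using P unfolding piecewise_def by blast
qed

lemma spline_of_in_spline_space: "spline_of q \<Xi> c \<in> spline_space q \<Xi>"
  by (rule spline_spaceI[OF piecewise_spline_of joined_local_poly])

lemma spline_space_eq_spline_of:
  assumes "f \<in> spline_space q \<Xi>"
  shows "\<exists>c. length c = n \<and> (\<forall>x\<in>{a..b}. f x = spline_of q \<Xi> c x)"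
  using spline_spaceD[OF assms] spline_of_exists by blast

end

section \<open>Control points and knot insertion\<close>

lemma poly_eq_on_interval:
  fixes P Q :: "real poly"
  assumes "u < v" "\<And>x. u < x \<Longrightarrow> x < v \<Longrightarrow> poly P x = poly Q x"
  shows "P = Q"
proof (rule ccontr)
  assume "P \<noteq> Q"
  then have "finite {x. poly (P - Q) x = 0}" by (intro poly_roots_finite) simp
  moreover have "{u<..<v} \<subseteq> {x. poly (P - Q) x = 0}" using assms(2) by auto
  ultimately show False using finite_subset infinite_Ioo[OF assms(1)] by blast
qed

section \<open>Uniqueness of control points and the knot norm\<close>

context open_knots
begin

lemma index_interval:
  assumes "1 \<le> i" "i \<le> n"
  obtains \<mu> where "q + 1 \<le> \<mu>" "\<mu> \<le> n" "t \<mu> < t (Suc \<mu>)" "\<mu> - q \<le> i" "i \<le> \<mu>"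
proof -
  have ti: "a \<le> t i" "t i < b" using a_le_t t_less_b assms by auto
  define \<mu> where "\<mu> = knots_upto \<Xi> (t i)"
  have \<mu>: "q + 1 \<le> \<mu>" "\<mu> \<le> n" "t \<mu> \<le> t i" "t i < t (Suc \<mu>)"
    using knots_upto_bounds[OF ti] by (auto simp: \<mu>_def)
  have "i \<le> \<mu>" using t_le_iff[of i "t i"] assms by (simp add: \<mu>_def)
  moreover have "\<mu> \<le> i + q" using t_le[of "i + q + 1" \<mu>] t_less[of i] \<mu> assms by (cases "\<mu> \<le> i + q") auto
  ultimately show ?thesis using that[of \<mu>] \<mu> by simp
qed

lemma spline_of_diff:
  "spline_of q \<Xi> c x - spline_of q \<Xi> d x = spline_of q \<Xi> (map (\<lambda>i. ith c i - ith d i) [1..<Suc n]) x"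
  unfolding spline_of_def sum_subtractf[symmetric]
  by (intro sum.cong) (auto simp: algebra_simps simp del: upt_Suc)

lemma spline_of_inj:
  assumes "\<And>x. x \<in> {a..b} \<Longrightarrow> spline_of q \<Xi> c x = spline_of q \<Xi> d x" "1 \<le> i" "i \<le> n"
  shows "ith c i = ith d i"
proof -
  obtain \<mu> where \<mu>: "q + 1 \<le> \<mu>" "\<mu> \<le> n" "t \<mu> < t (Suc \<mu>)" "\<mu> - q \<le> i" "i \<le> \<mu>"
    using index_interval[OF assms(2,3)] .
  have "local_poly t \<mu> q (ith c) = local_poly t \<mu> q (ith d)"
  proof (rule poly_eq_on_interval[OF \<mu>(3)])
    fix x assume "t \<mu> < x" "x < t (Suc \<mu>)"
    then have *: "piece \<mu> x" using \<mu> by (simp add: piece_def)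
    show "poly (local_poly t \<mu> q (ith c)) x = poly (local_poly t \<mu> q (ith d)) x"
      using assms(1)[of x] piece_bounds[OF *] by (simp add: spline_of_piece[OF *])
  qed
  moreover have "q \<le> \<mu>" using \<mu>(1) by simp
  ultimately show ?thesis
    using blossom_local_poly[OF mono_t \<mu>(3) _ \<mu>(4,5), of "ith c"]
      blossom_local_poly[OF mono_t \<mu>(3) _ \<mu>(4,5), of "ith d"] by simp
qed

lemma control_points_eq:
  assumes "length c = n" "\<And>x. x \<in> {a..b} \<Longrightarrow> s x = spline_of q \<Xi> c x"
  shows "control_points q \<Xi> s = c"
  unfolding control_points_def left_end_eq right_end_eq
proof (rule the_equality)
  fix d assume d: "length d = n \<and> (\<forall>x\<in>{a..b}. s x = spline_of q \<Xi> d x)"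
  have "ith d (Suc i) = ith c (Suc i)" if "i < n" for i
    using that d assms by (intro spline_of_inj) auto
  then show "d = c" using d assms(1) by (intro nth_equalityI) auto
qed (use assms in simp)

text \<open>One quantity in three roles: the square of a \<open>loc_weight\<close>, the integral of
  a B-spline, and the difference of Greville abscissas one degree higher.\<close>

definition weight :: "nat \<Rightarrow> real" where
  "weight i = (t (i + q + 1) - t i) / real (q + 1)"

lemma weight_pos: "1 \<le> i \<Longrightarrow> i \<le> n \<Longrightarrow> 0 < weight i"
  using t_less[of i] by (simp add: weight_def)

lemma weight_nonneg: "0 \<le> weight i"
  using t_le[of i "i + q + 1"] by (simp add: weight_def)

lemma knot_norm_eq:
  assumes "length c = n" "\<And>x. x \<in> {a..b} \<Longrightarrow> s x = spline_of q \<Xi> c x"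
  shows "knot_norm q \<Xi> s = sqrt (\<Sum>i=1..n. (ith c i)\<^sup>2 * weight i)"
proof -
  have "control_points q \<Xi> s = c" using assms by (rule control_points_eq)
  then show ?thesis unfolding knot_norm_def weight_def
    by (intro arg_cong[where f = sqrt] sum.cong) (auto simp: t_ith)
qed

section \<open>Knot insertion\<close>

definition insertion_factor :: "nat \<Rightarrow> nat \<Rightarrow> real" where
  "insertion_factor i0 i = (if i + q < i0 then 1 else if i0 \<le> i then 0
     else (t i0 - t i) / (t (i + q + 1) - t i))"

text \<open>Boehm's rule: \<open>c\<close> belongs to the knots without number i0, the result to all
  of \<Xi>. For i0 \<le> i the index i - 1 undoes the shift caused by the removal.\<close>

definition refine :: "nat \<Rightarrow> real list \<Rightarrow> nat \<Rightarrow> real" where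
  "refine i0 c i = insertion_factor i0 i * ith c i + (1 - insertion_factor i0 i) * ith c (i - 1)"

text \<open>The polynomial pieces stay the same, only the windows change. A window of \<Xi> without
  position i0 is also a window of the coarser vector. One that contains it differs from two coarse
  windows in that argument alone, and t i0 is an affine combination of t i and t (i + q +
  1).\<close>

lemma spline_of_remove_knot:
  assumes i0: "q + 2 \<le> i0" "i0 \<le> n" and x: "x \<in> {a..b}"
  shows "spline_of q (remove_knot i0 \<Xi>) c x = spline_of q \<Xi> (map (refine i0 c) [1..<Suc n]) x"
proof -
  let ?Y = "remove_knot i0 \<Xi>"
  interpret Y: open_knots q a b ?Y by (rule open_knots_remove_knot[OF i0])
  have nY: "Y.n = n - 1"
    using length_remove_knot[of i0 \<Xi>] i0 by (simp add: spline_dim_def)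
  have tY: "Y.t i = (if i < i0 then t i else t (Suc i))" for i
    using i0 length_eq by (intro knot_remove_knot) auto
  obtain \<mu> where \<mu>: "piece \<mu> x" using ex_piece x by auto
  then have \<mu>': "q + 1 \<le> \<mu>" "\<mu> \<le> n" "t \<mu> < t (Suc \<mu>)" by (auto simp: piece_def)
  \<comment> \<open>Removal merges the intervals i0 - 1 and i0, so both are sent to i0 - 1.\<close>
  define \<kappa> where "\<kappa> = (if \<mu> < i0 then \<mu> else \<mu> - 1)"
  have 1: "Y.t \<kappa> \<le> t \<mu>"
    using i0 by (auto simp: \<kappa>_def tY intro: t_le)
  have 2: "t (Suc \<mu>) \<le> Y.t (Suc \<kappa>)"
    using i0 by (auto simp: \<kappa>_def tY intro: t_le)
  have 3: "Y.t (Suc \<kappa>) \<le> b" by (rule Y.t_le_b)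
  have \<kappa>: "q + 1 \<le> \<kappa>" "\<kappa> \<le> Y.n" using \<mu>' i0 by (auto simp: \<kappa>_def nY)
  have piece: "Y.piece \<kappa> x"
    using \<mu> 1 2 3 \<kappa> unfolding Y.piece_def piece_def by linarith
  define P where "P = local_poly Y.t \<kappa> q (ith c)"
  have B: "blossom P (window Y.t q i) = ith c i" if "\<kappa> - q \<le> i" "i \<le> \<kappa>" for i
    unfolding P_def using piece that Y.mono_t by (intro blossom_local_poly) (auto simp: Y.piece_def)
  have "P = local_poly t \<mu> q (refine i0 c)"
  proof (rule local_poly_unique[OF mono_t \<mu>'(3)])
    show "q \<le> \<mu>" using \<mu>' by simp
    show "degree P \<le> q" unfolding P_def by (rule degree_local_poly)
    fix i assume i: "\<mu> - q \<le> i" "i \<le> \<mu>"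
    consider "i + q < i0" | "i0 \<le> i" | "i < i0" "i0 \<le> i + q" by linarith
    then show "blossom P (window t q i) = refine i0 c i"
    proof cases
      case 1
      have "window Y.t q i = window t q i"
        unfolding window_def using 1 by (intro map_cong) (auto simp: tY)
      moreover have "\<kappa> - q \<le> i" "i \<le> \<kappa>" using 1 i \<mu>' by (auto simp: \<kappa>_def)
      ultimately show ?thesis using B[of i] 1 by (simp add: refine_def insertion_factor_def)
    next
      case 2
      have "window Y.t q (i - 1) = map (\<lambda>k. t (Suc k)) [i..<i + q]"
        unfolding window_def using 2 i0 by (intro map_cong) (auto simp: tY)
      also have "\<dots> = map t (map Suc [i..<i + q])" by simp
      also have "\<dots> = window t q i" unfolding map_Suc_upt window_def by simp
      finally have "window Y.t q (i - 1) = window t q i" .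
      moreover have "\<kappa> - q \<le> i - 1" "i - 1 \<le> \<kappa>" using 2 i \<mu>' i0 by (auto simp: \<kappa>_def)
      ultimately show ?thesis using B[of "i - 1"] 2 i0 by (simp add: refine_def insertion_factor_def)
    next
      case 3
      \<comment> \<open>L and R are the arguments that the three windows have in common, before and
        after position i0.\<close>
      define L where "L = map t [i + 1..<i0]"
      define R where "R = map t [Suc i0..<i + q + 1]"
      have L: "map Y.t [i + 1..<i0] = L" unfolding L_def by (intro map_cong) (auto simp: tY)
      have R: "map Y.t [i0..<m] = map t [Suc i0..<Suc m]" for m
      proof -
        have "map Y.t [i0..<m] = map (\<lambda>k. t (Suc k)) [i0..<m]" by (intro map_cong) (auto simp: tY)
        also have "\<dots> = map t (map Suc [i0..<m])" by simp
        finally show ?thesis unfolding map_Suc_upt .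
      qed
      have i1: "1 \<le> i" "i \<le> n" using i \<mu>' by auto
      have "window t q i = L @ t i0 # R"
        unfolding window_def L_def R_def using 3 upt_split[of "i + 1" i0 "i + q + 1"]
          upt_rec[of i0 "i + q + 1"] by (simp del: upt_Suc)
      then have w: "blossom P (window t q i) = blossom P (t i0 # L @ R)"
        by (simp only: blossom_move)
      have "window Y.t q i = L @ map Y.t [i0..<i + q + 1]"
        unfolding window_def L[symmetric] map_append[symmetric]
        using 3 upt_split[of "i + 1" i0 "i + q + 1"] by (simp del: upt_Suc)
      also have "map Y.t [i0..<i + q + 1] = R @ [t (i + q + 1)]"
        unfolding R R_def using 3 by simp
      finally have "blossom P (window Y.t q i) = blossom P (t (i + q + 1) # L @ R)"
        using blossom_move[of P "L @ R" "t (i + q + 1)" "[]"] by simp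
      moreover have "\<kappa> - q \<le> i" "i \<le> \<kappa>" using 3 i \<mu>' i0 by (auto simp: \<kappa>_def)
      ultimately have w1: "blossom P (t (i + q + 1) # L @ R) = ith c i" using B by metis
      have "window Y.t q (i - 1) = map Y.t [i..<i0] @ map Y.t [i0..<i + q]"
        unfolding window_def map_append[symmetric]
        using 3 i1 upt_split[of i i0 "i + q"] by (simp del: upt_Suc)
      also have "map Y.t [i..<i0] = t i # L"
        using 3 L by (simp add: upt_rec[of i i0] tY del: upt_Suc)
      also have "map Y.t [i0..<i + q] = R" unfolding R R_def by simp
      finally have "window Y.t q (i - 1) = t i # L @ R" by simp
      moreover have "\<kappa> - q \<le> i - 1" "i - 1 \<le> \<kappa>" using 3 i \<mu>' i0 by (auto simp: \<kappa>_def)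
      ultimately have w2: "blossom P (t i # L @ R) = ith c (i - 1)" using B by metis
      have lt: "t i < t (i + q + 1)" using t_less i1 by simp
      then have ne: "t i \<noteq> t (i + q + 1)" by simp
      have f: "insertion_factor i0 i = (t i0 - t i) / (t (i + q + 1) - t i)"
        using 3 by (simp add: insertion_factor_def)
      then have "1 - insertion_factor i0 i = (t (i + q + 1) - t i0) / (t (i + q + 1) - t i)"
        using lt by (simp add: field_simps)
      then show ?thesis unfolding w blossom_affine[OF ne, of P "t i0" "L @ R"] w1 w2 refine_def f by simp
    qed
  qed
  also have "local_poly t \<mu> q (refine i0 c) = local_poly t \<mu> q (ith (map (refine i0 c) [1..<Suc n]))"
    unfolding local_poly_def using \<mu>' by (intro sum.cong) (auto simp del: upt_Suc)
  finally show ?thesis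
    unfolding Y.spline_of_piece[OF piece] spline_of_piece[OF \<mu>] P_def by simp
qed

end

section \<open>Removal of a single knot\<close>

text \<open>Gram--Schmidt on the columns of \<open>M\<close>: the residual of the last column against the previous
  ones is the only new direction.\<close>

lemma normal_equations_solvable:
  fixes M :: "nat \<Rightarrow> nat \<Rightarrow> real"
  shows "\<exists>x. \<forall>s\<in>{1..n}. (\<Sum>r=1..m. ((\<Sum>t=1..n. M r t * x t) - y r) * M r s) = 0"
proof (induction n arbitrary: y)
  case (Suc n)
  obtain x where x: "\<And>s. s \<in> {1..n} \<Longrightarrow> (\<Sum>r=1..m. ((\<Sum>t=1..n. M r t * x t) - y r) * M r s) = 0"
    using Suc by blast
  obtain z where z: "\<And>s. s \<in> {1..n} \<Longrightarrow>
      (\<Sum>r=1..m. ((\<Sum>t=1..n. M r t * z t) - M r (Suc n)) * M r s) = 0"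
    using Suc[of "\<lambda>r. M r (Suc n)"] by blast
  define e where "e r = (\<Sum>t=1..n. M r t * x t) - y r" for r
  define u where "u r = (\<Sum>t=1..n. M r t * z t) - M r (Suc n)" for r
  \<comment> \<open>With this k the residual e + k u is orthogonal to u. If u = 0, any value would
    do.\<close>
  define k where "k = - (\<Sum>r=1..m. e r * u r) / (\<Sum>r=1..m. u r * u r)"
  have k: "(\<Sum>r=1..m. e r * u r) + k * (\<Sum>r=1..m. u r * u r) = 0"
  proof (cases "(\<Sum>r=1..m. u r * u r) = 0")
    case True
    then have "\<forall>r\<in>{1..m}. u r = 0" by (subst (asm) sum_nonneg_eq_0_iff) auto
    then show ?thesis by simp
  next
    case False
    then show ?thesis by (simp add: k_def)
  qed
  \<comment> \<open>The last coordinate is -k because u contains the last column with the sign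
    -1.\<close>
  define x' where "x' t = (if t = Suc n then - k else x t + k * z t)" for t
  have "(\<Sum>t=1..n. M r t * x' t) = (\<Sum>t=1..n. M r t * x t) + k * (\<Sum>t=1..n. M r t * z t)" for r
    unfolding sum_distrib_left sum.distrib[symmetric]
    by (intro sum.cong) (auto simp: x'_def algebra_simps)
  then have res: "(\<Sum>t=1..Suc n. M r t * x' t) - y r = e r + k * u r" for r
    by (simp add: x'_def e_def u_def algebra_simps)
  have old: "(\<Sum>r=1..m. (e r + k * u r) * M r s) = 0" if "s \<in> {1..n}" for s
  proof -
    have "(\<Sum>r=1..m. (e r + k * u r) * M r s) = (\<Sum>r=1..m. e r * M r s) + k * (\<Sum>r=1..m. u r * M r s)"
      by (simp add: sum.distrib sum_distrib_left algebra_simps)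
    then show ?thesis using x[OF that] z[OF that] by (simp add: e_def u_def)
  qed
  have "(\<Sum>r=1..m. (e r + k * u r) * (\<Sum>t=1..n. M r t * z t))
      = (\<Sum>r=1..m. \<Sum>t=1..n. z t * ((e r + k * u r) * M r t))"
    by (simp add: sum_distrib_left algebra_simps)
  also have "\<dots> = (\<Sum>t=1..n. z t * (\<Sum>r=1..m. (e r + k * u r) * M r t))"
    by (subst sum.swap) (simp only: sum_distrib_left)
  also have "\<dots> = 0" using old by (intro sum.neutral) auto
  finally have "(\<Sum>r=1..m. (e r + k * u r) * (\<Sum>t=1..n. M r t * z t)) = 0" .
  moreover have "(\<Sum>r=1..m. (e r + k * u r) * M r (Suc n))
      = (\<Sum>r=1..m. (e r + k * u r) * (\<Sum>t=1..n. M r t * z t)) - (\<Sum>r=1..m. (e r + k * u r) * u r)"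
    unfolding sum_subtractf[symmetric] by (intro sum.cong) (auto simp: u_def algebra_simps)
  moreover have "(\<Sum>r=1..m. (e r + k * u r) * u r) = 0"
    using k by (simp add: sum.distrib sum_distrib_left algebra_simps)
  ultimately have "(\<Sum>r=1..m. (e r + k * u r) * M r (Suc n)) = 0" by simp
  then show ?case using old res
    by (intro exI[of _ x']) (auto simp: le_Suc_eq)
qed simp

text \<open>Pythagoras: the residual at z is the residual e of a solution of the normal equations
  plus a vector in the column space, and e is orthogonal to that space.\<close>

lemma least_squares_solution_exists: "\<exists>x. least_squares_solution m n M y x"
proof -
  obtain x where x: "\<And>s. s \<in> {1..n} \<Longrightarrow> (\<Sum>r=1..m. ((\<Sum>t=1..n. M r t * x t) - y r) * M r s) = 0"
    using normal_equations_solvable by blast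
  define e where "e r = (\<Sum>t=1..n. M r t * x t) - y r" for r
  define xs where "xs = map x [1..<Suc n]"
  have xs: "(\<Sum>t=1..n. M r t * ith xs t) = (\<Sum>t=1..n. M r t * x t)" for r
    by (intro sum.cong) (auto simp: xs_def simp del: upt_Suc)
  have "lsq_residual m n M y xs \<le> lsq_residual m n M y z" for z
  proof -
    define v where "v r = (\<Sum>t=1..n. M r t * (ith z t - x t))" for r
    have v: "(\<Sum>t=1..n. M r t * ith z t) - y r = e r + v r" for r
      by (simp add: v_def e_def sum_subtractf right_diff_distrib)
    have "(\<Sum>r=1..m. e r * v r) = (\<Sum>r=1..m. \<Sum>t=1..n. (ith z t - x t) * (e r * M r t))"
      unfolding v_def by (simp add: sum_distrib_left algebra_simps)
    also have "\<dots> = (\<Sum>t=1..n. (ith z t - x t) * (\<Sum>r=1..m. e r * M r t))"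
      by (subst sum.swap) (simp only: sum_distrib_left)
    also have "\<dots> = 0" using x by (intro sum.neutral) (auto simp: e_def)
    finally have "(\<Sum>r=1..m. (e r + v r)\<^sup>2) = (\<Sum>r=1..m. (e r)\<^sup>2) + (\<Sum>r=1..m. (v r)\<^sup>2)"
      by (simp add: power2_sum sum.distrib mult.assoc flip: sum_distrib_left)
    then have "(\<Sum>r=1..m. (e r)\<^sup>2) \<le> (\<Sum>r=1..m. (e r + v r)\<^sup>2)"
      by (simp add: sum_nonneg)
    then show ?thesis unfolding lsq_residual_def xs v by (simp add: e_def)
  qed
  moreover have "length xs = n" by (simp add: xs_def)
  ultimately show ?thesis unfolding least_squares_solution_def by blast
qed

text \<open>Abstracts i0 and l from the breakpoint number; \<open>knot_removal_index\<close>
  supplies the instance that the algorithm uses.\<close>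

locale knot_removal = open_knots +
  fixes i0 l :: nat
  assumes i0_ge: "q + 2 \<le> i0" and i0_le: "i0 \<le> n" and l_le: "l \<le> q"
    and repeated: "t (i0 - l) = t i0"
begin

lemma refine_left: "i + q < i0 \<Longrightarrow> refine i0 c i = ith c i"
  by (simp add: refine_def insertion_factor_def)

text \<open>At the other copies of the removed knot the numerator t i0 - t i is 0. This is why the
  local block ends at i0 - l and not at i0.\<close>

lemma factor_right:
  assumes "i0 - l \<le> i"
  shows "insertion_factor i0 i = 0"
proof (cases "i0 \<le> i")
  case False
  then have "t i = t i0" using t_le[of "i0 - l" i] t_le[of i i0] repeated assms by simp
  then show ?thesis using assms l_le i0_ge by (auto simp: insertion_factor_def)
qed (use i0_ge in \<open>simp add: insertion_factor_def\<close>)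

lemma refine_right: "i0 - l \<le> i \<Longrightarrow> refine i0 c i = ith c (i - 1)"
  by (simp add: refine_def factor_right)

text \<open>The two extreme indices fit the fraction as well: it is 1 at i0 - q - 1 and 0 at i0. So
  \<open>loc_alpha\<close> and Boehm's factor coincide on the block.\<close>

lemma factor_eq:
  assumes "i0 - q - 1 \<le> i" "i \<le> i0"
  shows "insertion_factor i0 i = (t i0 - t i) / (t (i + q + 1) - t i)"
proof -
  have "t i < t (i + q + 1)" using t_less[of i] assms i0_ge i0_le by simp
  moreover have "i + q + 1 = i0" if "i + q < i0" using that assms by simp
  ultimately show ?thesis using assms by (auto simp: insertion_factor_def)
qed

section \<open>The local least squares problem\<close>

definition local_system :: "real list \<Rightarrow> real list \<Rightarrow> real" where
  "local_system c = lsq_residual (q + 2 - l) (q + 1 - l) (EA_loc q \<Xi> i0)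
     (\<lambda>r. loc_weight q \<Xi> i0 r * ith c (i0 + r - q - 2))"

definition defect :: "real list \<Rightarrow> real list \<Rightarrow> nat \<Rightarrow> real" where
  "defect c d i = (refine i0 d i - ith c i)\<^sup>2 * weight i"

text \<open>Row r stands for the control point with index i0 - q - 2 + r. Columns 0 and q + 2 - l do
  not exist in the matrix; in the first and in the last row they would have coefficient 0, since the
  factor is 1 and 0 there.\<close>

lemma local_system_eq:
  assumes x: "\<And>r. 1 \<le> r \<Longrightarrow> r \<le> q + 1 - l \<Longrightarrow> ith x r = ith d (i0 - q - 2 + r)"
  shows "local_system c x = sqrt (\<Sum>i=i0-q-1..i0-l. defect c d i)"
proof -
  define s where "s = i0 - q - 2"
  have i0: "i0 = s + q + 2" using i0_ge by (simp add: s_def)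
  have "((\<Sum>k=1..q+1-l. EA_loc q \<Xi> i0 r k * ith x k) - loc_weight q \<Xi> i0 r * ith c (i0 + r - q - 2))\<^sup>2
      = defect c d (r + s)" if r: "r \<in> {1..q+2-l}" for r
  proof -
    define i where "i = r + s"
    have idx: "i0 + r - q - 2 = i" "i0 + r - 1 = i + q + 1" using i0 r by (auto simp: i_def)
    have i: "1 \<le> i" "i \<le> n" "i0 - q - 1 \<le> i" "i \<le> i0" using r i0 i0_le l_le by (auto simp: i_def)
    have w: "(loc_weight q \<Xi> i0 r)\<^sup>2 = weight i"
      using i weight_nonneg[of i] unfolding loc_weight_def idx by (simp add: weight_def t_ith)
    have \<alpha>: "loc_alpha q \<Xi> i0 r = insertion_factor i0 i"
      using i i0_le unfolding loc_alpha_def idx factor_eq[OF i(3,4)] by (simp add: t_ith)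
    have "(\<Sum>k=1..q+1-l. A_loc q \<Xi> i0 r k * ith x k)
        = (\<Sum>k=1..q+1-l. (if r = k then insertion_factor i0 i * ith x k else 0)
            + (if r - 1 = k then (1 - insertion_factor i0 i) * ith x k else 0))"
      by (intro sum.cong refl) (simp only: A_loc_def \<alpha>, auto)
    also have "\<dots> = (if r \<le> q + 1 - l then insertion_factor i0 i * ith x r else 0)
        + (if 2 \<le> r then (1 - insertion_factor i0 i) * ith x (r - 1) else 0)"
      using r by (auto simp: sum.distrib sum.delta)
    also have "\<dots> = refine i0 d i"
    proof -
      have "r \<le> q + 1 - l \<Longrightarrow> ith x r = ith d i"
        using x[of r] r i0 by (simp add: i_def add.commute)
      moreover have "2 \<le> r \<Longrightarrow> ith x (r - 1) = ith d (i - 1)"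
        using x[of "r - 1"] r i0 by (simp add: i_def add.commute)
      moreover have "\<not> r \<le> q + 1 - l \<Longrightarrow> insertion_factor i0 i = 0"
        using r i0 l_le by (intro factor_right) (simp add: i_def)
      moreover have "\<not> 2 \<le> r \<Longrightarrow> insertion_factor i0 i = 1"
        using r i0 by (simp add: i_def insertion_factor_def)
      ultimately show ?thesis by (auto simp: refine_def)
    qed
    finally have A: "(\<Sum>k=1..q+1-l. A_loc q \<Xi> i0 r k * ith x k) = refine i0 d i" .
    have "(\<Sum>k=1..q+1-l. EA_loc q \<Xi> i0 r k * ith x k) = loc_weight q \<Xi> i0 r * refine i0 d i"
      unfolding A[symmetric] sum_distrib_left by (intro sum.cong) (auto simp: EA_loc_def)
    then show ?thesis
      unfolding idx defect_def i_def[symmetric]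
      by (simp add: w flip: right_diff_distrib add: power_mult_distrib)
  qed
  then have "(\<Sum>r=1..q+2-l. ((\<Sum>k=1..q+1-l. EA_loc q \<Xi> i0 r k * ith x k)
        - loc_weight q \<Xi> i0 r * ith c (i0 + r - q - 2))\<^sup>2)
      = (\<Sum>r=1..q+2-l. defect c d (r + s))"
    by (intro sum.cong) auto
  also have "\<dots> = (\<Sum>i=1+s..q+2-l+s. defect c d i)"
    by (rule sum.shift_bounds_cl_nat_ivl[symmetric])
  also have "{1+s..q+2-l+s} = {i0-q-1..i0-l}" using i0 l_le by auto
  finally show ?thesis unfolding local_system_def lsq_residual_def by simp
qed

definition merged :: "real list \<Rightarrow> real list \<Rightarrow> real list" where
  "merged c x = take (i0 - q - 2) c @ x @ drop (i0 - l) c"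

lemma length_merged: "length c = n \<Longrightarrow> length x = q + 1 - l \<Longrightarrow> length (merged c x) = n - 1"
  using i0_ge i0_le l_le by (simp add: merged_def)

text \<open>Left of the block refinement leaves indices alone; right of it, it shifts them by one,
  which matches the shift caused by the shorter middle part of \<open>merged\<close>.\<close>

lemma defect_merged:
  assumes "length c = n" "length x = q + 1 - l"
  shows "(\<Sum>i=1..n. defect c (merged c x) i) = (local_system c x)\<^sup>2"
proof -
  have left: "ith (merged c x) i = ith c i" if "1 \<le> i" "i + q + 1 < i0" for i
    using that assms i0_ge i0_le by (simp add: merged_def nth_append)
  have mid: "ith (merged c x) (i0 - q - 2 + r) = ith x r" if "1 \<le> r" "r \<le> q + 1 - l" for r
  proof -
    have "length (take (i0 - q - 2) c) = i0 - q - 2" using assms i0_le by simp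
    then have "merged c x ! (i0 - q - 2 + (r - 1)) = (x @ drop (i0 - l) c) ! (r - 1)"
      unfolding merged_def by (metis nth_append_length_plus)
    moreover have "r - 1 < length x" using that assms(2) by linarith
    ultimately show ?thesis using that by (simp add: nth_append)
  qed
  have right: "ith (merged c x) (i - 1) = ith c i" if "i0 - l < i" "i \<le> n" for i
    using that assms i0_ge i0_le l_le by (auto simp: merged_def nth_append intro!: arg_cong[where f = "(!) c"])
  have "(\<Sum>i=i0-q-1..i0-l. defect c (merged c x) i) = (\<Sum>i=1..n. defect c (merged c x) i)"
  proof (rule sum.mono_neutral_left)
    show "{i0-q-1..i0-l} \<subseteq> {1..n}" using i0_ge i0_le by auto
    show "\<forall>i\<in>{1..n} - {i0-q-1..i0-l}. defect c (merged c x) i = 0"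
    proof
      fix i assume i: "i \<in> {1..n} - {i0-q-1..i0-l}"
      then consider "i + q + 1 < i0" | "i0 - l < i" using i0_ge by fastforce
      then have "refine i0 (merged c x) i = ith c i"
      proof cases
        case 1
        then show ?thesis using left[of i] i by (simp add: refine_left)
      next
        case 2
        then show ?thesis using right[of i] i by (simp add: refine_right)
      qed
      then show "defect c (merged c x) i = 0" by (simp add: defect_def)
    qed
  qed simp
  moreover have "local_system c x = sqrt (\<Sum>i=i0-q-1..i0-l. defect c (merged c x) i)"
    by (rule local_system_eq) (rule mid[symmetric])
  moreover have "0 \<le> (\<Sum>i=1..n. defect c (merged c x) i)"
    by (intro sum_nonneg) (simp add: defect_def weight_nonneg)
  ultimately show ?thesis by simp
qed

text \<open>The entries of d in the block compete in the local problem, and what d contributes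
  outside the block can only increase the sum.\<close>

lemma local_system_le:
  assumes "least_squares_solution (q + 2 - l) (q + 1 - l) (EA_loc q \<Xi> i0)
     (\<lambda>r. loc_weight q \<Xi> i0 r * ith c (i0 + r - q - 2)) x"
  shows "local_system c x \<le> sqrt (\<Sum>i=1..n. defect c d i)"
proof -
  define w where "w = map (\<lambda>r. ith d (i0 - q - 2 + r)) [1..<Suc (q + 1 - l)]"
  have len: "length w = q + 1 - l" by (simp add: w_def del: upt_Suc)
  then have "local_system c x \<le> local_system c w"
    using assms unfolding local_system_def least_squares_solution_def by blast
  also have "\<dots> = sqrt (\<Sum>i=i0-q-1..i0-l. defect c d i)"
  proof (rule local_system_eq)
    fix r assume r: "1 \<le> r" "r \<le> q + 1 - l"
    then have "[1..<Suc (q + 1 - l)] ! (r - 1) = r" by (subst nth_upt) auto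
    then show "ith w r = ith d (i0 - q - 2 + r)"
      using r by (simp add: w_def del: upt_Suc)
  qed
  also have "\<dots> \<le> sqrt (\<Sum>i=1..n. defect c d i)"
    using i0_ge i0_le by (intro real_sqrt_le_mono sum_mono2) (auto simp: defect_def weight_nonneg)
  finally show ?thesis .
qed

lemma knot_norm_defect:
  assumes "length c = n" "\<And>x. x \<in> {a..b} \<Longrightarrow> g x = spline_of q (remove_knot i0 \<Xi>) d x"
  shows "knot_norm q \<Xi> (\<lambda>x. g x - spline_of q \<Xi> c x) = sqrt (\<Sum>i=1..n. defect c d i)"
proof -
  define r where "r = map (\<lambda>i. ith (map (refine i0 d) [1..<Suc n]) i - ith c i) [1..<Suc n]"
  have "knot_norm q \<Xi> (\<lambda>x. g x - spline_of q \<Xi> c x) = sqrt (\<Sum>i=1..n. (ith r i)\<^sup>2 * weight i)"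
  proof (rule knot_norm_eq)
    show "length r = n" by (simp add: r_def)
    show "g x - spline_of q \<Xi> c x = spline_of q \<Xi> r x" if "x \<in> {a..b}" for x
      using that assms i0_ge i0_le
      by (simp only: spline_of_remove_knot[OF i0_ge i0_le that] spline_of_diff r_def)
  qed
  also have "(\<Sum>i=1..n. (ith r i)\<^sup>2 * weight i) = (\<Sum>i=1..n. defect c d i)"
    by (intro sum.cong) (auto simp: r_def defect_def simp del: upt_Suc)
  finally show ?thesis .
qed

end

lemma (in open_knots) knot_removal_index:
  assumes "2 \<le> j" "j < N"
  shows "knot_removal q a b \<Xi> (removal_index q \<Xi> j) (knot_mult q \<Xi> j - 1)"
proof
  note A = adjacent_interval[OF assms]
  have i0: "removal_index q \<Xi> j = knots_upto \<Xi> (z j)" using removal_index_eq assms by simp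
  show "q + 2 \<le> removal_index q \<Xi> j" "removal_index q \<Xi> j \<le> n" unfolding i0 using A by auto
  show "knot_mult q \<Xi> j - 1 \<le> q" using knot_mult_bounds[OF assms] by simp
  \<comment> \<open>Going back from the last copy by the multiplicity minus one reaches the first
    copy, right after the last copy of the previous breakpoint.\<close>
  have "m - (k - 1) = Suc p" if "p < m" "m - p = k" for m k p :: nat using that by simp
  from this[OF A(2,8)]
  have "knots_upto \<Xi> (z j) - (knot_mult q \<Xi> j - 1) = Suc (knots_upto \<Xi> (z (j - 1)))" .
  then show "t (removal_index q \<Xi> j - (knot_mult q \<Xi> j - 1)) = t (removal_index q \<Xi> j)"
    unfolding i0 using A by simp
qed

text \<open>\<open>LEAST\<close> on a set of reals needs an attained minimum. The merged control
  points attain it, and any g in the coarse space has coefficients to which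
  \<open>local_system_le\<close> applies. The other conclusions are what the loop invariant requires
  of the new state.\<close>

lemma (in open_knots) removal_error_eq:
  assumes "2 \<le> j" "j < N" "length c = n"
  defines "i0 \<equiv> removal_index q \<Xi> j" and "l \<equiv> knot_mult q \<Xi> j - 1"
  assumes sol: "least_squares_solution (q + 2 - l) (q + 1 - l) (EA_loc q \<Xi> i0)
     (\<lambda>r. loc_weight q \<Xi> i0 r * ith c (i0 + r - q - 2)) x"
  defines "c' \<equiv> take (i0 - q - 2) c @ x @ drop (i0 - l) c"
  shows "removal_error q \<Xi> j (spline_of q \<Xi> c)
      = knot_norm q \<Xi> (\<lambda>x. spline_of q (remove_knot i0 \<Xi>) c' x - spline_of q \<Xi> c x)"
    and "open_knots q a b (remove_knot i0 \<Xi>)" and "length c' = n - 1"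
    and "spline_dim q (remove_knot i0 \<Xi>) = n - 1" and "length (remove_knot i0 \<Xi>) = length \<Xi> - 1"
    and "2 * (q + 1) < length \<Xi>"
proof -
  interpret knot_removal q a b \<Xi> i0 l
    unfolding i0_def l_def by (rule knot_removal_index[OF assms(1,2)])
  interpret Y: open_knots q a b "remove_knot i0 \<Xi>" by (rule open_knots_remove_knot[OF i0_ge i0_le])
  show "open_knots q a b (remove_knot i0 \<Xi>)" by (rule Y.open_knots_axioms)
  have len: "length x = q + 1 - l" using sol by (simp add: least_squares_solution_def)
  have c': "c' = merged c x" by (simp add: c'_def merged_def)
  show "length c' = n - 1" unfolding c' using assms(3) len by (rule length_merged)
  show lY: "length (remove_knot i0 \<Xi>) = length \<Xi> - 1"
    using length_remove_knot[of i0 \<Xi>] i0_ge i0_le length_eq by simp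
  then show "spline_dim q (remove_knot i0 \<Xi>) = n - 1" by (simp add: spline_dim_def)
  show "2 * (q + 1) < length \<Xi>" using Y.length_knots lY by simp
  let ?E = "knot_norm q \<Xi> (\<lambda>x. spline_of q (remove_knot i0 \<Xi>) c' x - spline_of q \<Xi> c x)"
  have E: "?E = sqrt (\<Sum>i=1..n. defect c c' i)" using assms(3) by (intro knot_norm_defect) auto
  have "?E = \<bar>local_system c x\<bar>" using E unfolding c' defect_merged[OF assms(3) len] by simp
  also have "\<dots> = local_system c x" by (simp add: local_system_def lsq_residual_def sum_nonneg)
  finally have E2: "?E = local_system c x" .
  show "removal_error q \<Xi> j (spline_of q \<Xi> c) = ?E"
    unfolding removal_error_def i0_def[symmetric]
  proof (rule Least_equality)
    show "\<exists>g\<in>spline_space q (remove_knot i0 \<Xi>). ?E = knot_norm q \<Xi> (\<lambda>x. g x - spline_of q \<Xi> c x)"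
      using Y.spline_of_in_spline_space by blast
    fix v assume "\<exists>g\<in>spline_space q (remove_knot i0 \<Xi>). v = knot_norm q \<Xi> (\<lambda>x. g x - spline_of q \<Xi> c x)"
    then obtain g where g: "g \<in> spline_space q (remove_knot i0 \<Xi>)"
      "v = knot_norm q \<Xi> (\<lambda>x. g x - spline_of q \<Xi> c x)" by blast
    obtain d where "\<And>x. x \<in> {a..b} \<Longrightarrow> g x = spline_of q (remove_knot i0 \<Xi>) d x"
      using Y.spline_space_eq_spline_of[OF g(1)] by blast
    then have "v = sqrt (\<Sum>i=1..n. defect c d i)"
      unfolding g(2) using assms(3) by (intro knot_norm_defect)
    then show "?E \<le> v" unfolding E2 using local_system_le[OF sol] by simp
  qed
qed

section \<open>Square integrals of bounded measurable functions\<close>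

text \<open>Splines of degree 0 jump, so continuity is too narrow. This class is closed under sums
  and products, and on it the Lebesgue integral of the norm agrees with the gauge integral of the
  fundamental theorem.\<close>

definition bounded_meas :: "real \<Rightarrow> real \<Rightarrow> (real \<Rightarrow> real) \<Rightarrow> bool" where
  "bounded_meas a b f \<longleftrightarrow> f \<in> borel_measurable (lebesgue_on {a..b}) \<and> (\<exists>K. \<forall>x\<in>{a..b}. \<bar>f x\<bar> \<le> K)"

lemma bounded_meas_absolutely_integrable: "bounded_meas a b f \<Longrightarrow> f absolutely_integrable_on {a..b}"
  unfolding bounded_meas_def
  by (elim conjE exE, rule measurable_bounded_by_integrable_imp_absolutely_integrable[where g = "\<lambda>x. _"])
    (auto intro: integrable_on_const)

lemma bounded_meas_integrable: "bounded_meas a b f \<Longrightarrow> f integrable_on {a..b}"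
  using bounded_meas_absolutely_integrable set_lebesgue_integral_eq_integral(1) by blast

lemma bounded_meas_const: "bounded_meas a b (\<lambda>x. k)"
  unfolding bounded_meas_def by auto

lemma bounded_meas_cong:
  assumes "bounded_meas a b f" "\<And>x. x \<in> {a..b} \<Longrightarrow> f x = g x"
  shows "bounded_meas a b g"
proof -
  have "g \<in> borel_measurable (lebesgue_on {a..b}) \<longleftrightarrow> f \<in> borel_measurable (lebesgue_on {a..b})"
    by (rule measurable_cong) (use assms(2) in simp)
  then show ?thesis using assms unfolding bounded_meas_def by auto
qed

lemma bounded_meas_add:
  assumes "bounded_meas a b f" "bounded_meas a b g"
  shows "bounded_meas a b (\<lambda>x. f x + g x)"
proof -
  obtain K L where "\<And>x. x \<in> {a..b} \<Longrightarrow> \<bar>f x\<bar> \<le> K" "\<And>x. x \<in> {a..b} \<Longrightarrow> \<bar>g x\<bar> \<le> L"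
    using assms unfolding bounded_meas_def by metis
  then have "\<bar>f x + g x\<bar> \<le> K + L" if "x \<in> {a..b}" for x
    using that by (metis abs_triangle_ineq add_mono order_trans)
  then show ?thesis using assms unfolding bounded_meas_def by (auto intro!: exI[of _ "K + L"])
qed

lemma bounded_meas_mult:
  assumes "bounded_meas a b f" "bounded_meas a b g"
  shows "bounded_meas a b (\<lambda>x. f x * g x)"
proof -
  obtain K L where "\<And>x. x \<in> {a..b} \<Longrightarrow> \<bar>f x\<bar> \<le> K" "\<And>x. x \<in> {a..b} \<Longrightarrow> \<bar>g x\<bar> \<le> L"
    using assms unfolding bounded_meas_def by metis
  then have "\<bar>f x * g x\<bar> \<le> \<bar>K\<bar> * \<bar>L\<bar>" if "x \<in> {a..b}" for x
    using that unfolding abs_mult by (intro mult_mono) force+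
  then show ?thesis using assms unfolding bounded_meas_def by (auto intro!: exI[of _ "\<bar>K\<bar> * \<bar>L\<bar>"])
qed

lemma bounded_meas_diff:
  assumes "bounded_meas a b f" "bounded_meas a b g"
  shows "bounded_meas a b (\<lambda>x. f x - g x)"
  using bounded_meas_add[OF assms(1) bounded_meas_mult[OF bounded_meas_const[of a b "-1"] assms(2)]] by simp

lemma bounded_meas_power2: "bounded_meas a b f \<Longrightarrow> bounded_meas a b (\<lambda>x. (f x)\<^sup>2)"
  unfolding power2_eq_square by (intro bounded_meas_mult)

lemma bounded_meas_sum:
  assumes "\<And>i. i \<in> A \<Longrightarrow> bounded_meas a b (f i)"
  shows "bounded_meas a b (\<lambda>x. \<Sum>i\<in>A. f i x)"
  using assms
  by (induction A rule: infinite_finite_induct) (auto intro: bounded_meas_const bounded_meas_add)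

lemma bounded_meas_borel:
  assumes "f \<in> borel_measurable borel" "\<And>x. x \<in> {a..b} \<Longrightarrow> \<bar>f x\<bar> \<le> K"
  shows "bounded_meas a b f"
proof -
  have "f \<in> borel_measurable lebesgue" using assms(1) by (intro measurable_completion) simp
  then show ?thesis using assms(2) unfolding bounded_meas_def
    by (auto intro!: measurable_restrict_space1 exI[of _ K])
qed

lemma bounded_meas_continuous:
  assumes "continuous_on {a..b} f"
  shows "bounded_meas a b f"
proof -
  have "bounded (f ` {a..b})" using assms by (intro compact_imp_bounded compact_continuous_image) auto
  then show ?thesis using assms unfolding bounded_meas_def bounded_iff
    by (auto intro: continuous_imp_measurable_on_sets_lebesgue)
qed

lemma bounded_meas_subinterval:
  assumes "bounded_meas a b f" "x \<le> b"
  shows "bounded_meas a x f"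
proof -
  have "{a..x} \<subseteq> {a..b}" using assms by auto
  moreover from this obtain K where "\<forall>y\<in>{a..x}. \<bar>f y\<bar> \<le> K"
    using assms(1) unfolding bounded_meas_def by (meson subsetD)
  ultimately show ?thesis using assms(1) unfolding bounded_meas_def
    by (auto intro: measurable_restrict_mono)
qed

lemma bounded_meas_bspline: "bounded_meas u v (bspline \<Xi> b d i)"
proof (induction d arbitrary: i)
  case 0
  have "bspline \<Xi> b 0 i \<in> borel_measurable borel" unfolding bspline.simps by measurable
  then show ?case by (rule bounded_meas_borel[where K = 1]) auto
next
  case (Suc d)
  have *: "bounded_meas u v (\<lambda>x. (x - y) / z)" "bounded_meas u v (\<lambda>x. (y - x) / z)" for y z
    unfolding divide_inverse by (intro bounded_meas_continuous continuous_intros)+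
  show ?case unfolding bspline.simps by (intro bounded_meas_add bounded_meas_mult * Suc)
qed

lemma bounded_meas_spline_of: "bounded_meas u v (spline_of q \<Xi> c)"
  unfolding spline_of_def by (intro bounded_meas_sum bounded_meas_mult bounded_meas_const bounded_meas_bspline)

section \<open>Square norms: Cauchy-Schwarz, triangle and Poincare inequalities\<close>

lemma l2_norm_on_eq:
  assumes "bounded_meas a b f"
  shows "l2_norm_on a b f = sqrt (integral {a..b} (\<lambda>x. (f x)\<^sup>2))"
  unfolding l2_norm_on_def
  using set_lebesgue_integral_eq_integral(2)[OF bounded_meas_absolutely_integrable[OF bounded_meas_power2[OF assms]]]
  by simp

lemma integral_power2_nonneg: "bounded_meas a b f \<Longrightarrow> 0 \<le> integral {a..b} (\<lambda>x. (f x)\<^sup>2)"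
  by (intro integral_nonneg bounded_meas_integrable bounded_meas_power2) auto

lemma Cauchy_Schwarz_integral:
  assumes "bounded_meas a b f" "bounded_meas a b g"
  shows "(integral {a..b} (\<lambda>x. f x * g x))\<^sup>2
    \<le> integral {a..b} (\<lambda>x. (f x)\<^sup>2) * integral {a..b} (\<lambda>x. (g x)\<^sup>2)"
proof -
  define F G H where "F = integral {a..b} (\<lambda>x. (f x)\<^sup>2)" and "G = integral {a..b} (\<lambda>x. (g x)\<^sup>2)"
    and "H = integral {a..b} (\<lambda>x. f x * g x)"
  note int = bounded_meas_integrable[OF bounded_meas_power2[OF assms(1)]]
    bounded_meas_integrable[OF bounded_meas_power2[OF assms(2)]]
    bounded_meas_integrable[OF bounded_meas_mult[OF assms]]
  have *: "0 \<le> F - 2 * k * H + k\<^sup>2 * G" for k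
  proof -
    have "0 \<le> integral {a..b} (\<lambda>x. (f x - k * g x)\<^sup>2)"
      using assms by (intro integral_power2_nonneg bounded_meas_diff bounded_meas_mult bounded_meas_const)
    also have "(\<lambda>x. (f x - k * g x)\<^sup>2) = (\<lambda>x. (f x)\<^sup>2 - (2 * k) * (f x * g x) + k\<^sup>2 * (g x)\<^sup>2)"
      by (auto simp: power2_eq_square algebra_simps)
    also have "((\<lambda>x. (f x)\<^sup>2 - (2 * k) * (f x * g x) + k\<^sup>2 * (g x)\<^sup>2) has_integral (F - (2 * k) * H + k\<^sup>2 * G)) {a..b}"
      unfolding F_def G_def H_def
      by (intro has_integral_add has_integral_diff has_integral_mult_right integrable_integral int)
    then have "integral {a..b} (\<lambda>x. (f x)\<^sup>2 - (2 * k) * (f x * g x) + k\<^sup>2 * (g x)\<^sup>2) = F - (2 * k) * H + k\<^sup>2 * G"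
      by (rule integral_unique)
    finally show ?thesis .
  qed
  have G: "0 \<le> G" unfolding G_def using assms(2) by (rule integral_power2_nonneg)
  have "H\<^sup>2 \<le> F * G"
  proof (cases "G = 0")
    case True
    have "H = 0"
    proof (rule ccontr)
      assume "H \<noteq> 0"
      \<comment> \<open>For G = 0 the quadratic in k is linear, and this k gives it the value
        -1.\<close>
      then show False using *[of "(F + 1) / (2 * H)"] True by simp
    qed
    then show ?thesis using True by simp
  next
    case False
    \<comment> \<open>The minimizer of the quadratic.\<close>
    then show ?thesis using *[of "H / G"] G by (simp add: field_simps power2_eq_square)
  qed
  then show ?thesis by (simp add: F_def G_def H_def)
qed

lemma l2_norm_on_nonneg: "bounded_meas a b f \<Longrightarrow> 0 \<le> l2_norm_on a b f"
  by (simp add: l2_norm_on_eq integral_power2_nonneg)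

lemma l2_norm_on_triangle:
  assumes "bounded_meas a b f" "bounded_meas a b g"
  shows "l2_norm_on a b (\<lambda>x. f x + g x) \<le> l2_norm_on a b f + l2_norm_on a b g"
proof -
  define F G H where "F = integral {a..b} (\<lambda>x. (f x)\<^sup>2)" and "G = integral {a..b} (\<lambda>x. (g x)\<^sup>2)"
    and "H = integral {a..b} (\<lambda>x. f x * g x)"
  have FG: "0 \<le> F" "0 \<le> G" unfolding F_def G_def using assms by (auto intro: integral_power2_nonneg)
  have "(\<lambda>x. (f x + g x)\<^sup>2) = (\<lambda>x. (f x)\<^sup>2 + 2 * (f x * g x) + (g x)\<^sup>2)"
    by (auto simp: power2_eq_square algebra_simps)
  moreover have "((\<lambda>x. (f x)\<^sup>2 + 2 * (f x * g x) + (g x)\<^sup>2) has_integral (F + 2 * H + G)) {a..b}"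
    unfolding F_def G_def H_def
    by (intro has_integral_add has_integral_mult_right integrable_integral bounded_meas_integrable
        bounded_meas_power2 bounded_meas_mult assms)
  ultimately have *: "integral {a..b} (\<lambda>x. (f x + g x)\<^sup>2) = F + 2 * H + G"
    by (simp add: integral_unique)
  have "H\<^sup>2 \<le> F * G" unfolding F_def G_def H_def using assms by (rule Cauchy_Schwarz_integral)
  then have "H \<le> sqrt F * sqrt G" by (metis real_le_rsqrt real_sqrt_mult)
  then have "F + 2 * H + G \<le> (sqrt F + sqrt G)\<^sup>2" using FG by (simp add: power2_sum)
  then have "sqrt (F + 2 * H + G) \<le> sqrt F + sqrt G" using FG by (intro real_le_lsqrt) auto
  then show ?thesis using assms by (simp add: l2_norm_on_eq bounded_meas_add * F_def G_def)
qed

lemma l2_norm_on_cong: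
  assumes "\<And>x. x \<in> {a..b} \<Longrightarrow> f x = g x"
  shows "l2_norm_on a b f = l2_norm_on a b g"
  unfolding l2_norm_on_def set_lebesgue_integral_def
  by (intro arg_cong[where f = sqrt] Bochner_Integration.integral_cong refl)
    (use assms in \<open>auto simp: indicator_def\<close>)

text \<open>Cauchy-Schwarz against the constant 1 bounds the square of F pointwise by b - a times
  the integral of the square of f; integrating over [a, b] gives the second factor b - a.\<close>

lemma Poincare:
  assumes "bounded_meas a b f" "a \<le> b" and F: "\<And>x. x \<in> {a..b} \<Longrightarrow> F x = integral {a..x} f"
  shows "bounded_meas a b F" and "l2_norm_on a b F \<le> (b - a) * l2_norm_on a b f"
proof -
  define I where "I = integral {a..b} (\<lambda>x. (f x)\<^sup>2)"
  have I: "0 \<le> I" unfolding I_def using assms(1) by (rule integral_power2_nonneg)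
  show bm: "bounded_meas a b F"
  proof (rule bounded_meas_cong)
    show "bounded_meas a b (\<lambda>x. integral {a..x} f)"
      by (intro bounded_meas_continuous indefinite_integral_continuous_1 bounded_meas_integrable assms)
  qed (simp add: F)
  have le: "(F x)\<^sup>2 \<le> (b - a) * I" if x: "x \<in> {a..b}" for x
  proof -
    have f: "bounded_meas a x f" using bounded_meas_subinterval[OF assms(1)] x by simp
    have "(F x)\<^sup>2 = (integral {a..x} (\<lambda>y. 1 * f y))\<^sup>2" using F[OF x] by simp
    also have "\<dots> \<le> integral {a..x} (\<lambda>y. 1\<^sup>2) * integral {a..x} (\<lambda>y. (f y)\<^sup>2)"
      using bounded_meas_const f by (rule Cauchy_Schwarz_integral)
    also have "\<dots> = (x - a) * integral {a..x} (\<lambda>y. (f y)\<^sup>2)" using x by simp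
    also have "\<dots> \<le> (b - a) * I"
      unfolding I_def
      using x f assms by (intro mult_mono integral_subset_le bounded_meas_integrable bounded_meas_power2
          integral_power2_nonneg) auto
    finally show ?thesis .
  qed
  have "integral {a..b} (\<lambda>x. (F x)\<^sup>2) \<le> integral {a..b} (\<lambda>x. (b - a) * I)"
    using le by (intro integral_le bounded_meas_integrable bounded_meas_power2 bm bounded_meas_const)
  also have "\<dots> = (b - a)\<^sup>2 * I" using assms(2) by (simp add: power2_eq_square)
  finally have "sqrt (integral {a..b} (\<lambda>x. (F x)\<^sup>2)) \<le> sqrt ((b - a)\<^sup>2 * I)" by (rule real_sqrt_le_mono)
  then show "l2_norm_on a b F \<le> (b - a) * l2_norm_on a b f"
    using assms(1,2) bm by (simp add: l2_norm_on_eq real_sqrt_mult I_def)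
qed

section \<open>Derivatives and integrals of splines\<close>

lemma continuously_differentiable_imp_isCont:
  assumes "continuously_differentiable_at k f x"
  shows "isCont f x"
proof -
  obtain e D where e: "e > 0" and D0: "\<forall>y\<in>ball x e. D 0 y = f y"
    and D: "\<forall>r<k. \<forall>y\<in>ball x e. (D r has_real_derivative D (Suc r) y) (at y)" and cont: "isCont (D k) x"
    using assms unfolding continuously_differentiable_at_def by blast
  have "isCont (D 0) x"
  proof (cases "k = 0")
    case False
    then have "(D 0 has_real_derivative D (Suc 0) x) (at x)" using D e by auto
    then show ?thesis by (rule DERIV_isCont)
  qed (use cont in simp)
  moreover have "\<forall>\<^sub>F y in nhds x. D 0 y = f y"
    using D0 e by (intro eventually_nhds_in_open[of "ball x e" x, THEN eventually_mono]) auto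
  ultimately show ?thesis using isCont_cong by blast
qed

context open_knots
begin

text \<open>At an end of the interval one window consists of q copies of that end, and a blossom on
  equal arguments is a value of the polynomial.\<close>

lemma spline_of_ends: "spline_of q \<Xi> c a = ith c 1" "spline_of q \<Xi> c b = ith c n"
proof -
  have "spline_of q \<Xi> c x = ith c i"
    if "piece \<mu> x" "\<mu> - q \<le> i" "i \<le> \<mu>" "\<And>j. i + 1 \<le> j \<Longrightarrow> j \<le> i + q \<Longrightarrow> t j = x" for \<mu> i x
  proof -
    have \<mu>: "t \<mu> < t (Suc \<mu>)" "q \<le> \<mu>" using that(1) by (auto simp: piece_def)
    have "window t q i = map (\<lambda>_. x) [i + 1..<i + q + 1]"
      unfolding window_def using that(4) by (intro map_cong) auto
    then have "window t q i = replicate q x" by (simp add: map_replicate_const del: upt_Suc)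
    then show ?thesis
      using blossom_local_poly[OF mono_t \<mu> that(2,3), of "ith c"] blossom_diag[OF degree_local_poly, of t \<mu> q "ith c" x]
      by (simp add: spline_of_piece[OF that(1)])
  qed note * = this
  have "piece (q + 1) a" using t_first[of "q + 1"] a_less_t[of "q + 2"] dim_ge by (simp add: piece_def)
  then show "spline_of q \<Xi> c a = ith c 1" by (rule *) (auto simp: t_first)
  have "piece n b" using t_less_b[of n] t_last[of "Suc n"] dim_ge by (simp add: piece_def)
  then show "spline_of q \<Xi> c b = ith c n" by (rule *) (auto simp: t_last)
qed

lemma basis_partition_of_unity:
  assumes "x \<in> {a..b}"
  shows "(\<Sum>i=1..n. bspline \<Xi> b q i x) = 1" and "1 \<le> i \<Longrightarrow> i \<le> n \<Longrightarrow> 0 \<le> bspline \<Xi> b q i x"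
proof -
  obtain \<mu> where \<mu>: "piece \<mu> x" using ex_piece assms by auto
  then have *: "t \<mu> < t (Suc \<mu>)" "q \<le> \<mu>" by (auto simp: piece_def)
  have "(\<Sum>i=1..n. bspline \<Xi> b q i x) = spline_of q \<Xi> (replicate n 1) x"
    unfolding spline_of_def right_end_eq by (intro sum.cong) auto
  also have "\<dots> = poly (local_poly t \<mu> q (\<lambda>_. 1)) x"
    unfolding spline_of_piece[OF \<mu>] local_poly_def using \<mu>
    by (intro arg_cong2[where f = poly] sum.cong refl) (auto simp: piece_def)
  also have "\<dots> = 1" by (simp add: local_poly_const[OF mono_t *])
  finally show "(\<Sum>i=1..n. bspline \<Xi> b q i x) = 1" .
  show "0 \<le> bspline \<Xi> b q i x" if "1 \<le> i" "i \<le> n"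
    using that \<mu>
    by (subst bspline_eq_bpoly[OF \<mu>]) (auto simp: piece_def intro!: bpoly_nonneg mono_t t_le_b)
qed

text \<open>Jensen's inequality with the B-splines as weights, obtained from the nonnegative
  variance of the coefficients around their mean s.\<close>

lemma spline_of_power2_le:
  assumes "x \<in> {a..b}"
  shows "(spline_of q \<Xi> c x)\<^sup>2 \<le> spline_of q \<Xi> (map (\<lambda>i. (ith c i)\<^sup>2) [1..<Suc n]) x"
proof -
  define s where "s = spline_of q \<Xi> c x"
  let ?B = "\<lambda>i. bspline \<Xi> b q i x"
  have s: "s = (\<Sum>i=1..n. ith c i * ?B i)" by (simp add: s_def spline_of_def right_end_eq)
  have "0 \<le> (\<Sum>i=1..n. (ith c i - s)\<^sup>2 * ?B i)"
    using basis_partition_of_unity(2)[OF assms] by (intro sum_nonneg) auto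
  also have "\<dots> = (\<Sum>i=1..n. (ith c i)\<^sup>2 * ?B i - (2 * s) * (ith c i * ?B i) + s\<^sup>2 * ?B i)"
    by (intro sum.cong) (auto simp: power2_eq_square algebra_simps)
  also have "\<dots> = (\<Sum>i=1..n. (ith c i)\<^sup>2 * ?B i) - (2 * s) * s + s\<^sup>2 * 1"
    unfolding sum.distrib sum_subtractf sum_distrib_left[symmetric] basis_partition_of_unity(1)[OF assms] s[symmetric] ..
  finally have "s\<^sup>2 \<le> (\<Sum>i=1..n. (ith c i)\<^sup>2 * ?B i)" by (simp add: power2_eq_square)
  also have "\<dots> = spline_of q \<Xi> (map (\<lambda>i. (ith c i)\<^sup>2) [1..<Suc n]) x"
    unfolding spline_of_def right_end_eq by (intro sum.cong) (auto simp del: upt_Suc)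
  finally show ?thesis by (simp add: s_def)
qed

text \<open>\<open>blossom_slope\<close> on neighbouring windows of degree q + 1: they differ in the
  arguments t i and t (i + q + 1), whose distance divided by q + 1 is \<open>weight i\<close>. The
  one relation serves both to differentiate s and to differentiate the output.\<close>

lemma derivative_relation:
  assumes CD: "\<And>i. 1 \<le> i \<Longrightarrow> i \<le> n \<Longrightarrow> ith C (i + 1) - ith C i = ith d i * weight i"
  defines "S \<equiv> spline_of (Suc q) (add_end_knots \<Xi>) C"
  shows "\<And>x. x \<in> {a<..<b} - set \<Xi> \<Longrightarrow> (S has_real_derivative spline_of q \<Xi> d x) (at x)"
    and "continuous_on {a..b} S" and "S a = ith C 1" and "S b = ith C (n + 1)"
proof -
  let ?E = "add_end_knots \<Xi>"
  interpret E: open_knots "Suc q" a b ?E by (rule open_knots_add_end_knots)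
  have ne: "\<Xi> \<noteq> []" using length_eq by auto
  \<comment> \<open>The added first knot shifts all indices by one, so interval \<mu> becomes Suc
    \<mu>.\<close>
  have tE: "E.t i = t (i - 1)" for i using ne by (rule knot_add_end_knots)
  have nE: "E.n = n + 1" using length_eq by (simp add: spline_dim_def)
  have pieceE: "E.piece (Suc \<mu>) x" if "piece \<mu> x" for \<mu> x
    using that by (simp add: E.piece_def piece_def tE nE)
  show "S a = ith C 1" "S b = ith C (n + 1)"
    unfolding S_def E.spline_of_ends nE by simp_all
  have windowE: "window E.t m (Suc k) = window t m k" for m k
  proof -
    have "window E.t m (Suc k) = map E.t (map Suc [k + 1..<k + m + 1])"
      unfolding window_def map_Suc_upt by simp
    also have "\<dots> = window t m k" by (simp add: window_def tE del: map_Suc_upt)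
    finally show ?thesis .
  qed
  have deriv: "pderiv (local_poly E.t (Suc \<mu>) (Suc q) (ith C)) = local_poly t \<mu> q (ith d)"
    if "q + 1 \<le> \<mu>" "\<mu> \<le> n" "t \<mu> < t (Suc \<mu>)" for \<mu>
  proof (rule local_poly_unique[OF mono_t that(3)])
    let ?P = "local_poly E.t (Suc \<mu>) (Suc q) (ith C)"
    show "q \<le> \<mu>" using that by simp
    show "degree (pderiv ?P) \<le> q" using degree_local_poly[of E.t "Suc \<mu>" "Suc q" "ith C"] by (simp add: degree_pderiv)
    fix i assume i: "\<mu> - q \<le> i" "i \<le> \<mu>"
    then have i1: "1 \<le> i" "i \<le> n" using that by auto
    have B: "blossom ?P (window E.t (Suc q) k) = ith C k" if "\<mu> - q \<le> k" "k \<le> Suc \<mu>" for k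
      using that \<open>q + 1 \<le> \<mu>\<close> \<open>t \<mu> < t (Suc \<mu>)\<close> by (intro blossom_local_poly E.mono_t) (auto simp: tE)
    have "blossom ?P (t (i + q + 1) # window t q i) = blossom ?P (window t q i @ [t (i + q + 1)])"
      by (intro blossom_perm) simp
    also have "window t q i @ [t (i + q + 1)] = window E.t (Suc q) (Suc i)"
      unfolding windowE by (rule window_snoc[symmetric])
    also have "blossom ?P \<dots> = ith C (i + 1)" using B[of "Suc i"] i by (simp del: blossom.simps)
    finally have 1: "blossom ?P (t (i + q + 1) # window t q i) = ith C (i + 1)" .
    have "t i # window t q i = window E.t (Suc q) i"
      using windowE[of "Suc q" "i - 1"] i1 by (simp add: window_Cons)
    then have 2: "blossom ?P (t i # window t q i) = ith C i" using B[of i] i by simp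
    have "weight i * blossom (pderiv ?P) (window t q i) = ith d i * weight i"
      using blossom_slope[of ?P "t (i + q + 1)" "window t q i" "t i"] CD[OF i1]
      unfolding 1 2 weight_def by simp
    then show "blossom (pderiv ?P) (window t q i) = ith d i" using weight_pos[OF i1] by simp
  qed
  show der: "(S has_real_derivative spline_of q \<Xi> d x) (at x)" if x: "x \<in> {a<..<b} - set \<Xi>" for x
  proof -
    obtain \<mu> where \<mu>: "piece \<mu> x" using ex_piece[of x] x by auto
    have "x \<noteq> t \<mu>" "x \<noteq> t (Suc \<mu>)" using x t_in_knots by auto
    then have lt: "t \<mu> < x" "x < t (Suc \<mu>)" using \<mu> x by (auto simp: piece_def)
    have v: "q + 1 \<le> \<mu>" "\<mu> \<le> n" "t \<mu> < t (Suc \<mu>)" using \<mu> by (auto simp: piece_def)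
    have "(poly (local_poly E.t (Suc \<mu>) (Suc q) (ith C)) has_real_derivative
        poly (local_poly t \<mu> q (ith d)) x) (at x)"
      using poly_DERIV[of "local_poly E.t (Suc \<mu>) (Suc q) (ith C)" x] unfolding deriv[OF v] .
    then have "(S has_real_derivative poly (local_poly t \<mu> q (ith d)) x) (at x)"
    proof (rule has_field_derivative_transform_within_open[where S = "{t \<mu><..<t (Suc \<mu>)}"])
      fix y assume "y \<in> {t \<mu><..<t (Suc \<mu>)}"
      then have "piece \<mu> y" using v by (simp add: piece_def)
      then show "poly (local_poly E.t (Suc \<mu>) (Suc q) (ith C)) y = S y"
        unfolding S_def by (simp add: E.spline_of_piece[OF pieceE])
    qed (use lt in auto)
    then show ?thesis by (simp add: spline_of_piece[OF \<mu>])
  qed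
  have set: "set ?E = set \<Xi>" using ne by (auto simp: add_end_knots_def)
  \<comment> \<open>At the ends a single piece is involved. At interior knots the multiplicity is at
    most q + 1, the degree of S, which still leaves continuity; elsewhere S is
    differentiable.\<close>
  have "continuous (at x within {a..b}) S" if x: "x \<in> {a..b}" for x
  proof -
    consider "x = a" | "x = b" | "a < x" "x < b" "x \<in> set \<Xi>" | "a < x" "x < b" "x \<notin> set \<Xi>"
      using x by fastforce
    then show ?thesis
    proof cases
      case 1
      let ?P = "local_poly E.t (q + 2) (Suc q) (ith C)"
      have lt: "t (q + 1) = a" "a < t (q + 2)" using t_first a_less_t by auto
      have "continuous (at x within {a..b}) (poly ?P)" by (intro continuous_intros)
      then show ?thesis
      proof (rule continuous_transform_within)
        show "0 < t (q + 2) - a" using lt by simp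
        fix y assume y: "y \<in> {a..b}" "dist y x < t (q + 2) - a"
        then have "piece (q + 1) y" using 1 lt dim_ge by (simp add: piece_def dist_real_def)
        from E.spline_of_piece[OF pieceE[OF this]] show "poly ?P y = S y" by (simp add: S_def)
      qed (use x in simp)
    next
      case 2
      let ?P = "local_poly E.t (Suc n) (Suc q) (ith C)"
      have lt: "t n < b" "t (Suc n) = b" using t_less_b t_last by auto
      have "continuous (at x within {a..b}) (poly ?P)" by (intro continuous_intros)
      then show ?thesis
      proof (rule continuous_transform_within)
        show "0 < b - t n" using lt by simp
        fix y assume y: "y \<in> {a..b}" "dist y x < b - t n"
        then have "piece n y" using 2 lt dim_ge by (auto simp: piece_def dist_real_def)
        from E.spline_of_piece[OF pieceE[OF this]] show "poly ?P y = S y" by (simp add: S_def)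
      qed (use x in simp)
    next
      case 3
      then obtain j where j: "2 \<le> j" "j < E.N" "E.z j = x" using E.interior_knot_is_z[of x] set by auto
      have "knot_mult (Suc q) ?E j \<le> Suc q"
      proof (rule E.knot_mult_le[OF _ j(1,2)])
        fix i assume "2 \<le> i" "i \<le> E.n"
        then show "E.t i < E.t (i + Suc q)" using t_less[of "i - 1"] by (simp add: tE nE)
      qed
      moreover have "\<forall>j\<in>{2..<E.N}. knot_mult (Suc q) ?E j \<le> Suc q \<longrightarrow>
          continuously_differentiable_at (Suc q - knot_mult (Suc q) ?E j) S (E.z j)"
        using E.spline_of_in_spline_space[of C] unfolding S_def[symmetric] spline_space_def mem_Collect_eq
        by (rule conjunct2)
      moreover have "j \<in> {2..<E.N}" using j(1,2) by simp
      ultimately have "continuously_differentiable_at (Suc q - knot_mult (Suc q) ?E j) S x"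
        using j(3) by blast
      then show ?thesis by (rule continuous_at_imp_continuous_at_within[OF continuously_differentiable_imp_isCont])
    next
      case 4
      then show ?thesis by (intro continuous_at_imp_continuous_at_within[OF DERIV_isCont[OF der]]) simp
    qed
  qed
  then show "continuous_on {a..b} S" by (simp add: continuous_on_eq_continuous_within)
qed

text \<open>With the partial sums of the right-hand side as control points C, the spline of degree q
  + 1 is an antiderivative, and its end values are the empty and the full sum.\<close>

lemma integral_spline_of: "integral {a..b} (spline_of q \<Xi> d) = (\<Sum>i=1..n. ith d i * weight i)"
proof -
  define C where "C = map (\<lambda>i. \<Sum>k=1..i. ith d k * weight k) [0..<n + 1]"
  have C: "ith C (Suc i) = (\<Sum>k=1..i. ith d k * weight k)" if "i \<le> n" for i
    using that by (simp add: C_def del: upt_Suc)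
  have CD: "ith C (i + 1) - ith C i = ith d i * weight i" if "1 \<le> i" "i \<le> n" for i
    using that C[of i] C[of "i - 1"] by (cases i) auto
  note D = derivative_relation[of C d, OF CD]
  have "(spline_of q \<Xi> d has_integral
      (spline_of (Suc q) (add_end_knots \<Xi>) C b - spline_of (Suc q) (add_end_knots \<Xi>) C a)) {a..b}"
    using D a_less_b
    by (intro fundamental_theorem_of_calculus_interior_strong[of "set \<Xi>"])
      (auto simp: has_real_derivative_iff_has_vector_derivative)
  then show ?thesis using C[of n] C[of 0] D(3,4) by (simp add: integral_unique)
qed

lemma l2_norm_on_le_knot_norm:
  assumes "length c = n" "\<And>x. x \<in> {a..b} \<Longrightarrow> f x = spline_of q \<Xi> c x"
  shows "l2_norm_on a b f \<le> knot_norm q \<Xi> f"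
proof -
  have "integral {a..b} (\<lambda>x. (spline_of q \<Xi> c x)\<^sup>2)
      \<le> integral {a..b} (spline_of q \<Xi> (map (\<lambda>i. (ith c i)\<^sup>2) [1..<Suc n]))"
  proof (rule integral_le)
    show "(\<lambda>x. (spline_of q \<Xi> c x)\<^sup>2) integrable_on {a..b}"
      by (rule bounded_meas_integrable[OF bounded_meas_power2[OF bounded_meas_spline_of]])
    show "spline_of q \<Xi> (map (\<lambda>i. (ith c i)\<^sup>2) [1..<Suc n]) integrable_on {a..b}"
      by (rule bounded_meas_integrable[OF bounded_meas_spline_of])
  qed (rule spline_of_power2_le)
  also have "\<dots> = (\<Sum>i=1..n. (ith c i)\<^sup>2 * weight i)"
    unfolding integral_spline_of by (intro sum.cong) (auto simp del: upt_Suc)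
  finally have "sqrt (integral {a..b} (\<lambda>x. (spline_of q \<Xi> c x)\<^sup>2)) \<le> sqrt (\<Sum>i=1..n. (ith c i)\<^sup>2 * weight i)"
    by (rule real_sqrt_le_mono)
  moreover have "l2_norm_on a b f = l2_norm_on a b (spline_of q \<Xi> c)"
    using assms(2) by (rule l2_norm_on_cong)
  ultimately show ?thesis
    using knot_norm_eq[of c f, OF assms] by (simp add: l2_norm_on_eq bounded_meas_spline_of)
qed

text \<open>All but two knots cancel in the difference of the averages. The denominators in
  \<open>derivative_points\<close> are thus the weights.\<close>

lemma greville_step:
  assumes "1 \<le> i" "i \<le> n"
  shows "greville (Suc q) (add_end_knots \<Xi>) (i + 1) - greville (Suc q) (add_end_knots \<Xi>) i = weight i"
proof -
  let ?E = "add_end_knots \<Xi>"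
  have ne: "\<Xi> \<noteq> []" using length_eq by auto
  have E: "ith ?E j = t (j - 1)" if "j \<le> n + q + 3" for j
    using that knot_ith[of j ?E] knot_add_end_knots[OF ne, of j] length_eq by simp
  have "(\<Sum>r=1..Suc q. ith ?E (i + 1 + r)) - (\<Sum>r=1..Suc q. ith ?E (i + r))
      = (\<Sum>r=1..Suc q. t (i + Suc r - 1) - t (i + r - 1))"
    unfolding sum_subtractf[symmetric]
  proof (intro sum.cong refl)
    fix r assume "r \<in> {1..Suc q}"
    then show "ith ?E (i + 1 + r) - ith ?E (i + r) = t (i + Suc r - 1) - t (i + r - 1)"
      using E[of "i + 1 + r"] E[of "i + r"] assms by simp
  qed
  also have "\<dots> = t (i + Suc (Suc q) - 1) - t (i + 1 - 1)"
    by (rule sum_Suc_diff) simp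
  finally show ?thesis unfolding greville_def weight_def diff_divide_distrib[symmetric] by simp
qed

end

section \<open>The knot removal algorithms\<close>

text \<open>By knot insertion the difference is a spline over \<Xi> itself, to which the comparison
  of norms applies.\<close>

lemma (in open_knots) l2_norm_on_remove_knot:
  fixes c d
  assumes "q + 2 \<le> i0" "i0 \<le> n"
  defines "f \<equiv> \<lambda>x. spline_of q (remove_knot i0 \<Xi>) d x - spline_of q \<Xi> c x"
  shows "l2_norm_on a b f \<le> knot_norm q \<Xi> f"
proof -
  define r where "r = map (\<lambda>i. ith (map (refine i0 d) [1..<Suc n]) i - ith c i) [1..<Suc n]"
  show ?thesis
  proof (rule l2_norm_on_le_knot_norm)
    show "length r = n" by (simp add: r_def)
    show "f x = spline_of q \<Xi> r x" if "x \<in> {a..b}" for x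
      using that assms by (simp only: f_def spline_of_remove_knot[OF assms(1,2) that] spline_of_diff r_def)
  qed
qed

lemma l2_norm_on_minus_commute: "l2_norm_on a b (\<lambda>x. f x - g x) = l2_norm_on a b (\<lambda>x. g x - f x)"
  unfolding l2_norm_on_def by (simp add: power2_commute)

section \<open>Invariant and termination of the loop\<close>

locale l2_removal = open_knots +
  fixes c0 :: "real list" and \<tau>0 :: real
  assumes length_c0: "length c0 = n" and \<tau>0_pos: "0 < \<tau>0"
begin

text \<open>\<open>\<tau>0 - \<tau>\<close> is the sum of the errors spent so far. The length
  equation guarantees an interior knot as long as the counter is below its maximum.\<close>

definition invariant :: "state \<Rightarrow> bool" where
  "invariant st \<longleftrightarrow> (case st of (k, \<tau>, c, X) \<Rightarrow>
     open_knots q a b X \<and> length c = spline_dim q X \<and> length X + k = length \<Xi> \<and> 0 < \<tau> \<and>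
     l2_norm_on a b (\<lambda>x. spline_of q \<Xi> c0 x - spline_of q X c x) \<le> \<tau>0 - \<tau>)"

lemma invariant_init: "invariant (0, \<tau>0, c0, \<Xi>)"
  unfolding invariant_def using open_knots_axioms length_c0 \<tau>0_pos
  by (simp add: l2_norm_on_eq[OF bounded_meas_const])

lemma invariant_step:
  assumes "l2_step q m st st'" "invariant st"
  shows "invariant st'"
  using assms
proof cases
  case (1 k c X j \<epsilon> \<tau> i0 l d)
  have inv: "open_knots q a b X" "length c = spline_dim q X" "length X + k = length \<Xi>"
    "l2_norm_on a b (\<lambda>x. spline_of q \<Xi> c0 x - spline_of q X c x) \<le> \<tau>0 - \<tau>"
    using assms(2) 1(1) by (auto simp: invariant_def)
  interpret X: open_knots q a b X by (rule inv(1))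
  have j: "2 \<le> j" "j < X.N" using 1(4) by (auto simp: best_removal_def is_arg_min_def)
  interpret R: knot_removal q a b X i0 l unfolding 1(7,8) by (rule X.knot_removal_index[OF j])
  define c' where "c' = take (i0 - q - 2) c @ d @ drop (i0 - l) c"
  let ?Y = "remove_knot i0 X"
  note E = X.removal_error_eq[OF j inv(2) 1(9)[unfolded 1(7,8)], folded 1(7,8), folded c'_def]
  have "l2_norm_on a b (\<lambda>x. spline_of q X c x - spline_of q ?Y c' x) \<le> \<epsilon>"
    unfolding l2_norm_on_minus_commute[of a b "spline_of q X c"] 1(5) E(1)
    by (rule X.l2_norm_on_remove_knot[OF R.i0_ge R.i0_le])
  moreover have "l2_norm_on a b (\<lambda>x. (spline_of q \<Xi> c0 x - spline_of q X c x) + (spline_of q X c x - spline_of q ?Y c' x))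
      \<le> l2_norm_on a b (\<lambda>x. spline_of q \<Xi> c0 x - spline_of q X c x)
        + l2_norm_on a b (\<lambda>x. spline_of q X c x - spline_of q ?Y c' x)"
    by (intro l2_norm_on_triangle bounded_meas_diff bounded_meas_spline_of)
  ultimately have "l2_norm_on a b (\<lambda>x. spline_of q \<Xi> c0 x - spline_of q ?Y c' x) \<le> \<tau>0 - (\<tau> - \<epsilon>)"
    using inv(4) by simp
  then show ?thesis
    unfolding 1(2) invariant_def c'_def[symmetric] prod.case
    using E(2-6) inv 1(6) by simp
qed

lemma invariant_reachable:
  assumes "(l2_step q m)\<^sup>*\<^sup>* (0, \<tau>0, c0, \<Xi>) st"
  shows "invariant st"
  using assms by (induction rule: rtranclp_induct) (auto intro: invariant_init invariant_step)

text \<open>The counter grows and is bounded, so no run is infinite. In a stuck state below the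
  maximum a minimizing index exists, and only the test against the tolerance can fail for it, as the
  least squares problem is always solvable.\<close>

lemma l2_removal_finishes: "l2_removal_finishes q \<tau>0 c0 \<Xi>"
  unfolding l2_removal_finishes_def
proof (intro conjI allI impI notI)
  let ?m = "l2_kmax q \<Xi>"
  assume "\<exists>run. run 0 = (0, \<tau>0, c0, \<Xi>) \<and> (\<forall>i. l2_step q ?m (run i) (run (Suc i)))"
  then obtain run where run: "run 0 = (0, \<tau>0, c0, \<Xi>)" "\<And>i. l2_step q ?m (run i) (run (Suc i))" by blast
  have step: "fst st < ?m \<and> fst st' = Suc (fst st)" if "l2_step q ?m st st'" for st st'
    using that by cases simp
  have "fst (run i) = i" for i
    by (induction i) (use run(1) step[OF run(2)] in auto)
  then show False using step[OF run(2)[of ?m]] by simp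
next
  fix st
  let ?m = "l2_kmax q \<Xi>"
  assume *: "(l2_step q ?m)\<^sup>*\<^sup>* (0, \<tau>0, c0, \<Xi>) st \<and> (\<nexists>st'. l2_step q ?m st st')"
  obtain k \<tau> c X where st: "st = (k, \<tau>, c, X)" by (cases st) auto
  have inv: "open_knots q a b X" "length X + k = length \<Xi>"
    using invariant_reachable[of ?m st] * by (auto simp: invariant_def st)
  interpret X: open_knots q a b X by (rule inv(1))
  show "l2_exit q ?m st"
  proof (cases "?m \<le> k")
    case True
    then show ?thesis by (simp add: l2_exit_def st)
  next
    case False
    \<comment> \<open>The current vector has more than twice q + 1 knots, so its knot number q + 2
      is interior.\<close>
    then have "q + 2 \<le> X.n" using inv(2) by (simp add: l2_kmax_def spline_dim_def)
    then obtain i where "i \<in> {2..<X.N}"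
      using X.interior_knot_is_z[OF X.t_in_knots[of "q + 2"]] X.a_less_t[of "q + 2"] X.t_less_b[of "q + 2"]
      by auto
    then have "\<exists>j. is_arg_min (\<lambda>i. removal_error q X i (spline_of q X c)) (\<lambda>i. i \<in> {2..<X.N}) j"
      by (intro ex_is_arg_min_if_finite) auto
    then obtain j where j: "best_removal q c X j"
      unfolding best_removal_def by auto
    have "\<tau> \<le> removal_error q X j (spline_of q X c)"
    proof (rule ccontr)
      assume "\<not> ?thesis"
      moreover obtain d where "least_squares_solution (q + 2 - (knot_mult q X j - 1)) (q + 1 - (knot_mult q X j - 1))
          (EA_loc q X (removal_index q X j))
          (\<lambda>r. loc_weight q X (removal_index q X j) r * ith c (removal_index q X j + r - q - 2)) d"
        using least_squares_solution_exists by blast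
      ultimately have "\<exists>st'. l2_step q ?m st st'"
        unfolding st using False j by (intro exI) (rule l2_step.intros, auto)
      then show False using * by blast
    qed
    then show ?thesis using j by (auto simp: l2_exit_def st)
  qed
qed

lemma l2_removal_returns:
  assumes "l2_removal_returns q \<tau>0 c0 \<Xi> d X"
  shows "open_knots q a b X" "length d = spline_dim q X"
    "l2_norm_on a b (\<lambda>x. spline_of q \<Xi> c0 x - spline_of q X d x) < \<tau>0"
  using assms invariant_reachable unfolding l2_removal_returns_def by (force simp: invariant_def)+

end

section \<open>Control points of a spline and of its derivative\<close>

lemma length_antiderivative_points [simp]: "length (antiderivative_points p \<Xi> c1 d) = length d + 1"
  by (simp add: antiderivative_points_def)

lemma ith_antiderivative_points:
  "i \<le> length d \<Longrightarrow> ith (antiderivative_points p \<Xi> c1 d) (Suc i) = antiderivative_point p \<Xi> c1 d i"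
  by (simp add: antiderivative_points_def del: upt_Suc)

lemma (in open_knots) antiderivative_points_diff:
  fixes c1 :: real
  assumes "length d = n" "1 \<le> i" "i \<le> n"
  defines "C \<equiv> antiderivative_points (Suc q) (add_end_knots \<Xi>) c1 d"
  shows "ith C (i + 1) - ith C i = ith d i * weight i"
proof -
  obtain k where k: "i = Suc k" using assms(2) by (cases i) auto
  have "ith C (Suc (Suc k)) = ith d (k + 1) * weight (k + 1) + ith C (Suc k)"
    unfolding C_def using assms(1,3) greville_step[of "k + 1"] k
    by (simp only: ith_antiderivative_points antiderivative_point.simps) simp
  then show ?thesis using k by simp
qed

lemma (in open_knots) derivative_points_diff:
  fixes C :: "real list"
  assumes "1 \<le> i" "i \<le> n"
  defines "d \<equiv> derivative_points (Suc q) (add_end_knots \<Xi>) C"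
  shows "ith C (i + 1) - ith C i = ith d i * weight i" and "length d = n"
proof -
  have nE: "spline_dim (Suc q) (add_end_knots \<Xi>) = n + 1" using length_eq by (simp add: spline_dim_def)
  show "length d = n" by (simp add: d_def derivative_points_def nE del: upt_Suc)
  have "[2..<n + 2] ! (i - 1) = i + 1" using assms by (subst nth_upt) auto
  then have "ith d i = (ith C (i + 1) - ith C i) / weight i"
    using assms greville_step[of i] by (simp add: d_def derivative_points_def nE del: upt_Suc)
  then show "ith C (i + 1) - ith C i = ith d i * weight i" using weight_pos[OF assms(1,2)] by simp
qed

text \<open>\<open>deriv e\<close> is arbitrary at finitely many points, so under every integral it
  may be replaced by g. The fundamental theorem makes e the indefinite integral of g, as
  \<open>Poincare\<close> requires, and the factor (b - a)^2 + 1 cancels against the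
  tolerance.\<close>

lemma h1_norm_on_less:
  assumes ab: "a < b" and K: "finite K" and g: "bounded_meas a b g" "l2_norm_on a b g < \<tau> / sqrt ((b - a)\<^sup>2 + 1)"
    and e: "continuous_on {a..b} e" "e a = 0"
    and der: "\<And>x. x \<in> {a<..<b} - K \<Longrightarrow> (e has_real_derivative g x) (at x)"
  shows "e \<in> h1_space a b" and "h1_norm_on a b e < \<tau>"
proof -
  \<comment> \<open>The end points join the exceptional set because \<open>deriv\<close> is
    two-sided.\<close>
  define K' where "K' = K \<union> {a, b}"
  have neg: "negligible K'" using K by (intro negligible_finite) (simp add: K'_def)
  have eq: "deriv e x = g x" if "x \<in> {a..b} - K'" for x
    using that der[of x] by (intro DERIV_imp_deriv) (auto simp: K'_def)
  have int: "deriv e absolutely_integrable_on {a..x}" "integral {a..x} (deriv e) = integral {a..x} g"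
    "integral {a..x} g = e x" if "x \<in> {a..b}" for x
  proof -
    have sub: "bounded_meas a x g" using bounded_meas_subinterval g(1) that by simp
    show "deriv e absolutely_integrable_on {a..x}"
      using bounded_meas_absolutely_integrable[OF sub] neg
      by (rule absolutely_integrable_spike) (use eq that in auto)
    show "integral {a..x} (deriv e) = integral {a..x} g"
      by (rule integral_spike[OF neg]) (use eq that in auto)
    have "(g has_integral (e x - e a)) {a..x}"
    proof (rule fundamental_theorem_of_calculus_interior_strong[OF K])
      show "continuous_on {a..x} e" using e(1) by (rule continuous_on_subset) (use that in auto)
    qed (use that der in \<open>auto simp: has_real_derivative_iff_has_vector_derivative\<close>)
    then show "integral {a..x} g = e x" using e(2) by (simp add: integral_unique)
  qed
  have sq: "(\<lambda>x. (deriv e x)\<^sup>2) absolutely_integrable_on {a..b}"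
    using bounded_meas_absolutely_integrable[OF bounded_meas_power2[OF g(1)]] neg
    by (rule absolutely_integrable_spike) (use eq in auto)
  show "e \<in> h1_space a b"
    unfolding h1_space_def using int(1)[of b] sq ab e(2) int
    by (auto simp: set_lebesgue_integral_eq_integral(2))
  have "integral {a..b} (\<lambda>x. (deriv e x)\<^sup>2) = integral {a..b} (\<lambda>x. (g x)\<^sup>2)"
    by (rule integral_spike[OF neg]) (use eq in auto)
  then have l2: "l2_norm_on a b (deriv e) = l2_norm_on a b g"
    unfolding l2_norm_on_eq[OF g(1)] by (simp add: l2_norm_on_def set_lebesgue_integral_eq_integral(2)[OF sq])
  note P = Poincare[OF g(1) less_imp_le[OF ab] int(3)[symmetric]]
  have nonneg: "0 \<le> l2_norm_on a b e" "0 \<le> l2_norm_on a b g" using P(1) g(1) by (auto intro: l2_norm_on_nonneg)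
  have "(l2_norm_on a b e)\<^sup>2 + (l2_norm_on a b g)\<^sup>2
      \<le> ((b - a) * l2_norm_on a b g)\<^sup>2 + (l2_norm_on a b g)\<^sup>2"
    using P(2) nonneg by (intro add_right_mono power_mono)
  also have "\<dots> = ((b - a)\<^sup>2 + 1) * (l2_norm_on a b g)\<^sup>2" by (simp only: power_mult_distrib distrib_right mult_1)
  finally have "h1_norm_on a b e \<le> sqrt (((b - a)\<^sup>2 + 1) * (l2_norm_on a b g)\<^sup>2)"
    unfolding h1_norm_on_def l2 by (rule real_sqrt_le_mono)
  also have "\<dots> = sqrt ((b - a)\<^sup>2 + 1) * l2_norm_on a b g" using nonneg by (simp add: real_sqrt_mult)
  also have "\<dots> < \<tau>"
    using g(2) by (simp add: pos_less_divide_eq add_nonneg_pos mult.commute)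
  finally show "h1_norm_on a b e < \<tau>" .
qed

theorem theorem4p4:
  fixes p :: nat and a b TOL :: real and \<Xi> :: "real list" and s :: "real \<Rightarrow> real"
  assumes "p \<ge> 1"
    and "open_knot_vector p a b \<Xi>"
    and "\<forall>j\<in>{2..<num_breakpoints p \<Xi>}. knot_mult p \<Xi> j \<le> p"
    and "s \<in> spline_space p \<Xi>"
    and "TOL > 0"
  shows "h1_removal_finishes p TOL (control_points p \<Xi> s) \<Xi> \<and>
         (\<forall>c_hat \<Xi>_hat. h1_removal_returns p TOL (control_points p \<Xi> s) \<Xi> c_hat \<Xi>_hat \<longrightarrow>
            open_knot_vector p a b \<Xi>_hat \<and>
            length c_hat = spline_dim p \<Xi>_hat \<and>
            spline_of p \<Xi>_hat c_hat \<in> spline_space p \<Xi>_hat \<and>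
            (\<lambda>x. s x - spline_of p \<Xi>_hat c_hat x) \<in> h1_space a b \<and>
            h1_norm_on a b (\<lambda>x. s x - spline_of p \<Xi>_hat c_hat x) < TOL)"
proof -
  \<comment> \<open>q is the degree of the derivative, in which the loop runs.\<close>
  obtain q where p: "p = Suc q" using assms(1) by (cases p) auto
  interpret S: open_knots "Suc q" a b \<Xi>
    using open_knot_vector_imp_open_knots assms(2) by (simp add: p)
  obtain c where c: "length c = S.n" "\<And>x. x \<in> {a..b} \<Longrightarrow> s x = spline_of p \<Xi> c x"
    using S.spline_space_eq_spline_of assms(4) p by blast
  have cp: "control_points p \<Xi> s = c" unfolding p using c by (intro S.control_points_eq) (auto simp: p)
  define X where "X = drop_end_knots \<Xi>"
  have \<Xi>: "\<Xi> = add_end_knots X"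
    unfolding X_def by (rule add_drop_end_knots[symmetric, OF S.open_knots_axioms])
  interpret X: open_knots q a b X
    unfolding X_def using assms(3) p by (intro open_knots_drop_end_knots S.open_knots_axioms) simp
  define d where "d = derivative_points p \<Xi> c"
  have CD: "ith c (i + 1) - ith c i = ith d i * X.weight i" if "1 \<le> i" "i \<le> X.n" for i
    unfolding d_def p using X.derivative_points_diff(1)[OF that, of c] \<Xi> by simp
  have len_d: "length d = X.n"
    unfolding d_def p using X.derivative_points_diff(2)[of 1 c] X.dim_ge \<Xi> by simp
  have tol: "reduced_tol p TOL \<Xi> = TOL / sqrt ((b - a)\<^sup>2 + 1)"
    unfolding reduced_tol_def p S.left_end_eq S.right_end_eq ..
  have "0 < (b - a)\<^sup>2 + 1" by (simp add: add_nonneg_pos)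
  then have tol_pos: "0 < reduced_tol p TOL \<Xi>" unfolding tol using assms(5) by simp
  interpret L: l2_removal q a b X d "reduced_tol p TOL \<Xi>" by standard (use len_d tol_pos in auto)
  have "h1_removal_finishes p TOL c \<Xi>"
    using L.l2_removal_finishes by (simp add: h1_removal_finishes_def p d_def X_def)
  moreover have "open_knot_vector p a b Y \<and> length C = spline_dim p Y \<and> spline_of p Y C \<in> spline_space p Y \<and>
      (\<lambda>x. s x - spline_of p Y C x) \<in> h1_space a b \<and> h1_norm_on a b (\<lambda>x. s x - spline_of p Y C x) < TOL"
    if ret: "h1_removal_returns p TOL c \<Xi> C Y" for C Y
  proof -
    obtain d' X' where ret': "l2_removal_returns q (reduced_tol p TOL \<Xi>) d X d' X'"
      and Y: "Y = add_end_knots X'" and C: "C = antiderivative_points p Y (ith c 1) d'"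
      using ret by (auto simp: h1_removal_returns_def p d_def X_def)
    note R = L.l2_removal_returns[OF ret']
    interpret X': open_knots q a b X' by (rule R(1))
    interpret Y: open_knots "Suc q" a b Y unfolding Y by (rule X'.open_knots_add_end_knots)
    have CD': "ith C (i + 1) - ith C i = ith d' i * X'.weight i" if "1 \<le> i" "i \<le> X'.n" for i
      unfolding C Y p using X'.antiderivative_points_diff[OF R(2) that] .
    have C1: "ith C 1 = ith c 1" unfolding C using ith_antiderivative_points[of 0 d' p Y "ith c 1"] by simp
    \<comment> \<open>The splines that enter and leave the loop are the derivatives, away from
      knots, of s and of the result.\<close>
    note D = X.derivative_relation[of c d, OF CD, folded \<Xi> p]
    note D' = X'.derivative_relation[of C d', OF CD', folded Y p]
    let ?e = "\<lambda>x. s x - spline_of p Y C x"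
    let ?g = "\<lambda>x. spline_of q X d x - spline_of q X' d' x"
    have e: "?e x = spline_of p \<Xi> c x - spline_of p Y C x" if "x \<in> {a..b}" for x
      using c(2)[OF that] by simp
    have "continuous_on {a..b} (\<lambda>x. spline_of p \<Xi> c x - spline_of p Y C x)"
      by (intro continuous_on_diff D(2) D'(2))
    then have cont: "continuous_on {a..b} ?e" by (subst continuous_on_cong[OF refl e])
    have der: "(?e has_real_derivative ?g x) (at x)" if x: "x \<in> {a<..<b} - (set X \<union> set X')" for x
    proof -
      \<comment> \<open>s equals its spline only on [a, b]; inside the open interval the derivative
        carries over.\<close>
      have "((\<lambda>x. spline_of p \<Xi> c x - spline_of p Y C x) has_real_derivative ?g x) (at x)"
        using x by (intro DERIV_diff D(1) D'(1)) auto
      then show ?thesis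
        by (rule has_field_derivative_transform_within_open[where S = "{a<..<b}"]) (use x e in auto)
    qed
    \<comment> \<open>The first control points agree by construction, and they are the values at
      a.\<close>
    have ea: "?e a = 0" using e[of a] D(3) D'(3) C1 S.a_less_b by simp
    have bm: "bounded_meas a b ?g" by (intro bounded_meas_diff bounded_meas_spline_of)
    have fin: "finite (set X \<union> set X')" by simp
    note H = h1_norm_on_less[OF S.a_less_b fin bm R(3)[unfolded tol] cont ea]
    have "length C = spline_dim p Y" using R(2) X'.length_knots by (simp add: C Y p spline_dim_def)
    moreover have "open_knot_vector p a b Y" "spline_of p Y C \<in> spline_space p Y"
      unfolding p by (rule Y.open_knot_vector Y.spline_of_in_spline_space)+
    moreover have "?e \<in> h1_space a b" using der by (rule H(1))
    moreover have "h1_norm_on a b ?e < TOL" using der by (rule H(2))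
    ultimately show ?thesis by blast
  qed
  ultimately show ?thesis unfolding cp by blast
qed

end
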